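(* The functional $\mathcal{E}_6(f_1,f_2,f_3,f_4,f_5,f_6)$ on $L^2(\mathbb{R}\to\mathbb{C})^6$ is invariant under each of the following actions, applied simultaneously to all $f_k$, $k=1,\dots,6$ (for all $\lambda\in\mathbb{R}$, with $\lambda>0$ in (iii)): (i) Fourier transform, $f_k\mapsto\widehat{f}_k$; (ii) modulation, $f_k\mapsto e^{i\lambda}f_k$; (iii) $L^2$ scaling, $f_k(x)\mapsto\lambda^{1/2}f_k(\lambda x)$; (iv) linear modulation, $f_k\mapsto e^{i\lambda x}f_k$; (v) translation, $f_k\mapsto f_k(\cdot+\lambda)$; (vi) quadratic modulation, $f_k\mapsto e^{i\lambda x^2}f_k$; (vii) Schrödinger group, $f_k\mapsto e^{i\lambda\Delta}f_k$; (viii) Schrödinger with harmonic trapping group, $f_k\mapsto e^{i\lambda H}f_k$.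
   Context: $H=-\Delta+x^2$ on $L^2(\mathbb{R})$, and $e^{itH}$ is the unitary propagator of $iu_t+Hu=0$ (so $e^{itH}\phi_n=e^{it(2n+1)}\phi_n$ for the Hermite functions $\phi_n$, $H\phi_n=(2n+1)\phi_n$). $e^{it\Delta}$ is the free Schrödinger propagator on $\mathbb{R}$. The Fourier transform is $\widehat{f}(\xi)=(2\pi)^{-1/2}\int_{\mathbb{R}}e^{-ix\xi}f(x)\,dx$. The functional is $$\mathcal{E}_6(f_1,\dots,f_6)=\frac{2}{\pi}\int_{-\pi/4}^{\pi/4}\int_{\mathbb{R}}(e^{itH}f_1)(e^{itH}f_2)(e^{itH}f_3)\overline{(e^{itH}f_4)(e^{itH}f_5)(e^{itH}f_6)}\,dx\,dt.$$ *)

theory Defs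
  imports "HOL-Analysis.Analysis"
begin

section \<open>The space L2 of the real line\<close>

text \<open>
  Elements of \<open>L\<^sup>2(\<real>)\<close> are represented by Borel functions; every class modulo null sets has
  such a representative. The operators below that are only defined modulo null sets return an
  arbitrary representative.
\<close>

definition L2 :: "(real \<Rightarrow> complex) set" where
  "L2 = {f. f \<in> borel_measurable lborel \<and> integrable lborel (\<lambda>x. (cmod (f x))\<^sup>2)}"

definition L2_limit :: "(nat \<Rightarrow> real \<Rightarrow> complex) \<Rightarrow> (real \<Rightarrow> complex) \<Rightarrow> bool" where
  "L2_limit F g \<longleftrightarrow>
     g \<in> L2 \<and> (\<forall>N. F N \<in> L2) \<and> (\<lambda>N. LINT x|lborel. (cmod (F N x - g x))\<^sup>2) \<longlonglongrightarrow> 0"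

definition L2_lim :: "(nat \<Rightarrow> real \<Rightarrow> complex) \<Rightarrow> real \<Rightarrow> complex" where
  "L2_lim F = (SOME g. L2_limit F g)"


section \<open>Fourier transform and free Schroedinger group\<close>

text \<open>
  On \<open>L\<^sup>2\<close> the Fourier integral is a limit in mean of the integrals over \<open>[-N, N]\<close> (Plancherel);
  on integrable functions in \<open>L\<^sup>2\<close> it agrees almost everywhere with the absolutely convergent
  integral over \<open>\<real>\<close>.
\<close>

definition fourier :: "(real \<Rightarrow> complex) \<Rightarrow> real \<Rightarrow> complex" where
  "fourier f = L2_lim (\<lambda>N \<xi>.
     of_real (1 / sqrt (2 * pi)) * (LINT x:{- real N..real N}|lborel. cis (- (x * \<xi>)) * f x))"

definition inverse_fourier :: "(real \<Rightarrow> complex) \<Rightarrow> real \<Rightarrow> complex" where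
  "inverse_fourier g = L2_lim (\<lambda>N x.
     of_real (1 / sqrt (2 * pi)) * (LINT \<xi>:{- real N..real N}|lborel. cis (x * \<xi>) * g \<xi>))"

text \<open>The group \<open>e\<^sup>i\<^sup>t\<^sup>\<Delta>\<close>: \<open>\<Delta>\<close> is multiplication by \<open>-\<xi>\<^sup>2\<close> on the Fourier side.\<close>

definition free_schroedinger :: "real \<Rightarrow> (real \<Rightarrow> complex) \<Rightarrow> real \<Rightarrow> complex" where
  "free_schroedinger t f = inverse_fourier (\<lambda>\<xi>. cis (- (t * \<xi>\<^sup>2)) * fourier f \<xi>)"


section \<open>Harmonic oscillator\<close>

text \<open>The \<open>L\<^sup>2\<close>-normalised Hermite functions, by Rodrigues' formula.\<close>

definition hermite_fun :: "nat \<Rightarrow> real \<Rightarrow> real" where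
  "hermite_fun n x =
     (- 1) ^ n / sqrt (2 ^ n * fact n * sqrt pi) * exp (x\<^sup>2 / 2) *
     (deriv ^^ n) (\<lambda>y. exp (- y\<^sup>2)) x"

definition harmonic_oscillator :: "(real \<Rightarrow> real) \<Rightarrow> real \<Rightarrow> real" where
  "harmonic_oscillator u x = - deriv (deriv u) x + x\<^sup>2 * u x"

fun gauss_deriv_poly :: "nat \<Rightarrow> real poly" where
  "gauss_deriv_poly 0 = 1"
| "gauss_deriv_poly (Suc n) = pderiv (gauss_deriv_poly n) - [:0, 2:] * gauss_deriv_poly n"

lemma deriv_poly_exp:
  fixes p :: "real poly"
  shows "deriv (\<lambda>x. poly p x * exp (c * x\<^sup>2)) =
         (\<lambda>x. poly (pderiv p + [:0, 2 * c:] * p) x * exp (c * x\<^sup>2))"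
  by (rule ext, rule DERIV_imp_deriv)
     (auto intro!: derivative_eq_intros simp: algebra_simps)

lemma funpow_deriv_gauss:
  "(deriv ^^ n) (\<lambda>y. exp (- y\<^sup>2)) = (\<lambda>x::real. poly (gauss_deriv_poly n) x * exp (- x\<^sup>2))"
proof (induction n)
  case (Suc n)
  then show ?case
    using deriv_poly_exp[of "gauss_deriv_poly n" "-1"] by (simp add: algebra_simps)
qed simp

lemma pderiv_gauss_deriv_poly:
  "pderiv (gauss_deriv_poly (Suc n)) = smult (- 2 * real (Suc n)) (gauss_deriv_poly n)"
proof (induction n)
  case 0
  show ?case by (simp add: pderiv_pCons one_pCons)
next
  case (Suc n)
  let ?p = "gauss_deriv_poly"
  have "pderiv (?p (Suc (Suc n))) = pderiv (pderiv (?p (Suc n)) - [:0, 2:] * ?p (Suc n))"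
    by simp
  also have "\<dots> = pderiv (pderiv (?p (Suc n))) - [:0, 2:] * pderiv (?p (Suc n)) - [:2:] * ?p (Suc n)"
    by (simp only: pderiv_diff pderiv_mult) (simp add: pderiv_pCons)
  also have "\<dots> = smult (- 2 * real (Suc n)) (pderiv (?p n) - [:0, 2:] * ?p n) - [:2:] * ?p (Suc n)"
    by (simp only: Suc.IH pderiv_smult) (simp add: smult_diff_right)
  also have "\<dots> = smult (- 2 * real (Suc (Suc n))) (?p (Suc n))"
    by (rule poly_eqI) (simp add: algebra_simps coeff_pCons split: nat.split)
  finally show ?case .
qed

lemma harmonic_oscillator_hermite_fun:
  "harmonic_oscillator (hermite_fun n) x = (2 * real n + 1) * hermite_fun n x"
proof -
  define p where "p = gauss_deriv_poly n"
  define C :: real where "C = (- 1) ^ n / sqrt (2 ^ n * fact n * sqrt pi)"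
  define q where "q = smult C p"
  have h: "hermite_fun n = (\<lambda>x. poly q x * exp (- (1 / 2) * x\<^sup>2))"
  proof
    fix x :: real
    have "exp (x\<^sup>2 / 2) * exp (- x\<^sup>2) = exp (- (1 / 2) * x\<^sup>2)"
      by (simp flip: exp_add)
    then show "hermite_fun n x = poly q x * exp (- (1 / 2) * x\<^sup>2)"
      by (simp add: hermite_fun_def funpow_deriv_gauss q_def C_def p_def mult.assoc mult.left_commute)
  qed
  have "pderiv (pderiv p - [:0, 2:] * p) = smult (- 2 * real (Suc n)) p"
    using pderiv_gauss_deriv_poly[of n] by (simp add: p_def)
  then have "poly (pderiv (pderiv p - [:0, 2:] * p)) x = poly (smult (- 2 * real (Suc n)) p) x"
    by simp
  then have "poly (pderiv (pderiv p)) x = 2 * x * poly (pderiv p) x - 2 * real n * poly p x"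
    by (simp add: pderiv_diff pderiv_mult pderiv_pCons pderiv_smult algebra_simps)
  then have "C * poly (pderiv (pderiv p)) x = C * (2 * x * poly (pderiv p) x - 2 * real n * poly p x)"
    by simp
  then have q'': "poly (pderiv (pderiv q)) x = 2 * x * poly (pderiv q) x - 2 * real n * poly q x"
    by (simp add: q_def pderiv_smult algebra_simps)
  show ?thesis
    unfolding harmonic_oscillator_def h deriv_poly_exp
    by (simp add: q'' pderiv_add pderiv_mult pderiv_pCons pderiv_minus pderiv_smult
        algebra_simps power2_eq_square)
qed

text \<open>
  The propagator \<open>e\<^sup>i\<^sup>t\<^sup>H\<close> of \<open>i u\<^sub>t + H u = 0\<close>, through the spectral decomposition of \<open>H\<close> in the
  Hermite basis.
\<close>

definition hermite_coeff :: "(real \<Rightarrow> complex) \<Rightarrow> nat \<Rightarrow> complex" where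
  "hermite_coeff f n = (LINT x|lborel. f x * of_real (hermite_fun n x))"

definition harmonic_schroedinger :: "real \<Rightarrow> (real \<Rightarrow> complex) \<Rightarrow> real \<Rightarrow> complex" where
  "harmonic_schroedinger t f = L2_lim (\<lambda>N x.
     \<Sum>n<N. cis (t * (2 * real n + 1)) * hermite_coeff f n * of_real (hermite_fun n x))"


section \<open>The functional\<close>

text \<open>
  For each \<open>t\<close> the inner integral does not depend on the representatives chosen by
  \<^const>\<open>harmonic_schroedinger\<close>. By the Strichartz estimate the integral converges absolutely;
  at the exceptional null set of times where the inner integrand is not integrable, the library
  convention assigns the value 0.
\<close>

definition E6 :: "(real \<Rightarrow> complex) \<Rightarrow> (real \<Rightarrow> complex) \<Rightarrow> (real \<Rightarrow> complex) \<Rightarrow>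
    (real \<Rightarrow> complex) \<Rightarrow> (real \<Rightarrow> complex) \<Rightarrow> (real \<Rightarrow> complex) \<Rightarrow> complex" where
  "E6 f1 f2 f3 f4 f5 f6 = of_real (2 / pi) *
     (LINT t:{- pi / 4..pi / 4}|lborel. LINT x|lborel.
        harmonic_schroedinger t f1 x * harmonic_schroedinger t f2 x * harmonic_schroedinger t f3 x *
        cnj (harmonic_schroedinger t f4 x * harmonic_schroedinger t f5 x * harmonic_schroedinger t f6 x))"

definition E6_invariant :: "((real \<Rightarrow> complex) \<Rightarrow> real \<Rightarrow> complex) \<Rightarrow> bool" where
  "E6_invariant T \<longleftrightarrow>
     (\<forall>f1\<in>L2. \<forall>f2\<in>L2. \<forall>f3\<in>L2. \<forall>f4\<in>L2. \<forall>f5\<in>L2. \<forall>f6\<in>L2.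
        E6 (T f1) (T f2) (T f3) (T f4) (T f5) (T f6) = E6 f1 f2 f3 f4 f5 f6)"

end

theory Submission
  imports Defs "HOL-Probability.Probability"
begin

text \<open>
  The harmonic group and the Fourier transform act diagonally on Hermite coefficients. The inner
  integral of the form is periodic in \<open>t\<close> with period \<open>\<pi> / 2\<close>, and these two operators only
  translate \<open>t\<close>. For the other symmetries, Mehler's
  formula writes \<open>e\<^sup>i\<^sup>t\<^sup>H f (x)\<close> for \<open>0 < t < \<pi> / 2\<close>, up to a factor independent of \<open>f\<close>, as
  \<open>exp (i a x\<^sup>2)\<close> times the inverse Fourier transform of \<open>y \<mapsto> exp (i a y\<^sup>2) f (y)\<close> at \<open>x / sin (2 t)\<close>, where
  \<open>a = - cot (2 t) / 2\<close>. Phases cancel in the product, and substituting \<open>a\<close> for \<open>t\<close> gives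
  \<open>(2 / \<pi>) \<integral> Q a da\<close> over the real line, with \<open>Q a\<close> the integral of the product of these inverse
  Fourier transforms. There quadratic modulation is a translation of \<open>a\<close>, scaling a dilation of \<open>a\<close>,
  and linear modulation a translation of \<open>x\<close>; translation and the free group are Fourier
  conjugates of linear and quadratic modulation. Every step is an identity of Bochner integrals valid
  without integrability, so no Strichartz estimate is needed.
\<close>

subsection \<open>Square-integrable functions\<close>

text \<open>A count of powers makes the change of picture exact. Mehler's formula has a constant of
  modulus s^(-1/2) with s = sin (2 t); six factors give s^(-3), the dilation of x gives back s, and
  the remaining s^(-2) is precisely da/dt for a = - cot (2 t) / 2. The same count makes scaling an
  exact dilation of a.

  The operators return chosen representatives of L2 classes, so pointwise identities are out of
  reach. Identities between them are reduced to equality of Hermite coefficients, and completeness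
  of the Hermite functions carries the load; it rests on uniqueness of characteristic functions.
  Plancherel, Fourier inversion and Mehler's formula then become statements about multipliers on
  coefficients, of modulus one up to a common factor.

  The complex Gaussian integral in Mehler's formula stays symbolic, its modulus being read off from
  norms. Measurability in t of the inner integral is not established either: the rules that
  transform the t-integral also cover the case in which both sides have the default value 0.\<close>

abbreviation L2_sq :: "(real \<Rightarrow> complex) \<Rightarrow> real" where
  "L2_sq f \<equiv> LINT x|lborel. (cmod (f x))\<^sup>2"

lemma L2_measurable: "f \<in> L2 \<Longrightarrow> f \<in> borel_measurable borel"
  by (simp add: L2_def)

lemma L2_integrable_sq: "f \<in> L2 \<Longrightarrow> integrable lborel (\<lambda>x. (cmod (f x))\<^sup>2)"
  by (simp add: L2_def)

lemma L2_I:
  "f \<in> borel_measurable borel \<Longrightarrow> integrable lborel (\<lambda>x. (cmod (f x))\<^sup>2) \<Longrightarrow> f \<in> L2"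
  by (simp add: L2_def)

lemma cmod_add_sq_le: "(cmod (a + b))\<^sup>2 \<le> 2 * (cmod a)\<^sup>2 + 2 * (cmod b)\<^sup>2"
proof -
  have "(cmod (a + b))\<^sup>2 \<le> (cmod a + cmod b)\<^sup>2"
    by (intro power_mono norm_triangle_ineq) simp
  also have "\<dots> \<le> 2 * (cmod a)\<^sup>2 + 2 * (cmod b)\<^sup>2"
    using zero_le_power2[of "cmod a - cmod b"] by (simp add: power2_eq_square algebra_simps)
  finally show ?thesis .
qed

lemma L2_mult_bounded:
  assumes [measurable]: "u \<in> borel_measurable borel" and u: "\<And>x. cmod (u x) \<le> B" and f: "f \<in> L2"
  shows "(\<lambda>x. u x * f x) \<in> L2"
proof (rule L2_I)
  note [measurable] = L2_measurable[OF f]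
  show "(\<lambda>x. u x * f x) \<in> borel_measurable borel" by measurable
  show "integrable lborel (\<lambda>x. (cmod (u x * f x))\<^sup>2)"
  proof (rule Bochner_Integration.integrable_bound)
    show "integrable lborel (\<lambda>x. B\<^sup>2 * (cmod (f x))\<^sup>2)"
      using L2_integrable_sq[OF f] by simp
    show "AE x in lborel. norm ((cmod (u x * f x))\<^sup>2) \<le> norm (B\<^sup>2 * (cmod (f x))\<^sup>2)"
      using u by (auto simp: norm_mult power_mult_distrib intro!: mult_right_mono power_mono)
  qed measurable
qed

lemma L2_scale: "f \<in> L2 \<Longrightarrow> (\<lambda>x. c * f x) \<in> L2"
  by (rule L2_mult_bounded[where B="cmod c"]) auto

lemma L2_cis: "f \<in> L2 \<Longrightarrow> u \<in> borel_measurable borel \<Longrightarrow> (\<lambda>x. cis (u x) * f x) \<in> L2"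
  by (rule L2_mult_bounded[where B=1]) (auto simp: cis_conv_exp)

lemma L2_add:
  assumes f: "f \<in> L2" and g: "g \<in> L2"
  shows "(\<lambda>x. f x + g x) \<in> L2"
proof (rule L2_I)
  note [measurable] = L2_measurable[OF f] L2_measurable[OF g]
  show "(\<lambda>x. f x + g x) \<in> borel_measurable borel" by measurable
  show "integrable lborel (\<lambda>x. (cmod (f x + g x))\<^sup>2)"
  proof (rule Bochner_Integration.integrable_bound)
    show "integrable lborel (\<lambda>x. 2 * (cmod (f x))\<^sup>2 + 2 * (cmod (g x))\<^sup>2)"
      using L2_integrable_sq[OF f] L2_integrable_sq[OF g] by simp
  qed (auto simp: cmod_add_sq_le)
qed

lemma L2_diff:
  assumes f: "f \<in> L2" and g: "g \<in> L2"
  shows "(\<lambda>x. f x - g x) \<in> L2"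
  using L2_add[OF f L2_scale[OF g, of "-1"]] by simp

lemma L2_zero: "(\<lambda>x. 0) \<in> L2"
  by (rule L2_I) auto

lemma L2_sum: "(\<And>i. i \<in> I \<Longrightarrow> f i \<in> L2) \<Longrightarrow> (\<lambda>x. \<Sum>i\<in>I. f i x) \<in> L2"
  by (induction I rule: infinite_finite_induct) (auto simp: L2_zero L2_add)

lemma L2_mult_integrable:
  assumes f: "f \<in> L2" and g: "g \<in> L2"
  shows "integrable lborel (\<lambda>x. f x * g x)"
proof (rule Bochner_Integration.integrable_bound)
  note [measurable] = L2_measurable[OF f] L2_measurable[OF g]
  show "(\<lambda>x. f x * g x) \<in> borel_measurable lborel" by measurable
  show "integrable lborel (\<lambda>x. (cmod (f x))\<^sup>2 + (cmod (g x))\<^sup>2)"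
    using L2_integrable_sq[OF f] L2_integrable_sq[OF g] by simp
  have "a * b \<le> a\<^sup>2 + b\<^sup>2" if "a \<ge> 0" "b \<ge> 0" for a b :: real
    using sum_squares_bound[of a b] mult_nonneg_nonneg[OF that] by linarith
  then show "AE x in lborel. norm (f x * g x) \<le> norm ((cmod (f x))\<^sup>2 + (cmod (g x))\<^sup>2)"
    by (simp add: norm_mult)
qed

lemma L2_real_affine:
  assumes f: "f \<in> L2" and c: "c \<noteq> 0"
  shows "(\<lambda>x. f (t + c * x)) \<in> L2"
proof (rule L2_I)
  note [measurable] = L2_measurable[OF f]
  show "(\<lambda>x. f (t + c * x)) \<in> borel_measurable borel" by measurable
  show "integrable lborel (\<lambda>x. (cmod (f (t + c * x)))\<^sup>2)"
    using L2_integrable_sq[OF f] c by (rule lborel_integrable_real_affine)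
qed

lemma L2_sq_nonneg: "0 \<le> L2_sq f"
  by (rule Bochner_Integration.integral_nonneg) auto

lemma L2_Cauchy_Schwarz:
  assumes f: "f \<in> L2" and g: "g \<in> L2"
  shows "(cmod (LINT x|lborel. f x * g x))\<^sup>2 \<le> L2_sq f * L2_sq g"
proof -
  note i = L2_mult_integrable[OF f g] L2_integrable_sq[OF f] L2_integrable_sq[OF g]
  define I where "I = (LINT x|lborel. cmod (f x * g x))"
  have I0: "0 \<le> I" unfolding I_def by (rule Bochner_Integration.integral_nonneg) auto
  have "cmod (LINT x|lborel. f x * g x) \<le> I"
    unfolding I_def by (rule integral_norm_bound)
  then have le: "(cmod (LINT x|lborel. f x * g x))\<^sup>2 \<le> I\<^sup>2"
    by (intro power_mono) auto
  \<comment> \<open>The square of |f| - s |g| has nonnegative integral for every real s; the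
    inequality comes from a good choice of s.\<close>
  have q: "0 \<le> L2_sq f - 2 * s * I + s\<^sup>2 * L2_sq g" for s
  proof -
    have "0 \<le> (LINT x|lborel. (cmod (f x) - s * cmod (g x))\<^sup>2)"
      by (rule Bochner_Integration.integral_nonneg) auto
    also have "\<dots> = (LINT x|lborel. (cmod (f x))\<^sup>2 - 2 * s * cmod (f x * g x) + s\<^sup>2 * (cmod (g x))\<^sup>2)"
      by (simp add: power2_eq_square algebra_simps norm_mult)
    also have "\<dots> = L2_sq f - 2 * s * I + s\<^sup>2 * L2_sq g"
      unfolding I_def using i
      by (subst Bochner_Integration.integral_add Bochner_Integration.integral_diff | simp)+
    finally show ?thesis .
  qed
  have "I\<^sup>2 \<le> L2_sq f * L2_sq g"
  proof (cases "L2_sq g = 0")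
    case True
    have "I = 0"
    proof (rule ccontr)
      assume "I \<noteq> 0"
      with I0 have "I > 0" by simp
      \<comment> \<open>Without its leading term the quadratic is affine in s, and at this s it has
        the value - 1.\<close>
      with q[of "(L2_sq f + 1) / (2 * I)"] show False
        unfolding True by (simp add: field_simps)
    qed
    then show ?thesis by (simp add: L2_sq_nonneg)
  next
    case False
    with L2_sq_nonneg[of g] have p: "L2_sq g > 0" by linarith
    \<comment> \<open>The value at the minimiser of the quadratic.\<close>
    have "0 \<le> L2_sq f - I\<^sup>2 / L2_sq g"
      using q[of "I / L2_sq g"] p by (simp add: field_simps power2_eq_square)
    with p show ?thesis by (simp add: field_simps)
  qed
  with le show ?thesis by linarith
qed

lemma L2_pairing_tendsto:
  assumes F: "\<And>n. F n \<in> L2" and g: "g \<in> L2" and h: "h \<in> L2"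
    and lim: "(\<lambda>n. L2_sq (\<lambda>x. F n x - g x)) \<longlonglongrightarrow> 0"
  shows "(\<lambda>n. LINT x|lborel. F n x * h x) \<longlonglongrightarrow> (LINT x|lborel. g x * h x)"
proof -
  have "(\<lambda>n. L2_sq (\<lambda>x. F n x - g x) * L2_sq h) \<longlonglongrightarrow> 0"
    using tendsto_mult[OF lim tendsto_const, of "L2_sq h"] by (simp only: mult_zero_left)
  then have "(\<lambda>n. (cmod (LINT x|lborel. (F n x - g x) * h x))\<^sup>2) \<longlonglongrightarrow> 0"
    by (rule Lim_null_comparison[rotated]) (auto simp: L2_Cauchy_Schwarz L2_diff F g h)
  then have "(\<lambda>n. sqrt ((cmod (LINT x|lborel. (F n x - g x) * h x))\<^sup>2)) \<longlonglongrightarrow> sqrt 0"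
    by (rule tendsto_real_sqrt)
  then have "(\<lambda>n. (LINT x|lborel. (F n x - g x) * h x)) \<longlonglongrightarrow> 0"
    by (simp add: tendsto_norm_zero_iff)
  moreover have "(LINT x|lborel. (F n x - g x) * h x) =
      (LINT x|lborel. F n x * h x) - (LINT x|lborel. g x * h x)" for n
    by (simp add: left_diff_distrib L2_mult_integrable F g h)
  ultimately show ?thesis
    by (simp add: Lim_null[symmetric])
qed

lemma L2_sq_eq_0_AE:
  assumes f: "f \<in> L2" and z: "L2_sq f = 0"
  shows "AE x in lborel. f x = 0"
proof -
  have "AE x in lborel. (cmod (f x))\<^sup>2 = 0"
    using integral_nonneg_eq_0_iff_AE[OF L2_integrable_sq[OF f]] z by simp
  then show ?thesis by simp
qed

text \<open>\<open>L2_lim\<close> selects an unspecified limit. Uniqueness up to null sets lets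
  whatever is known of one limit pass to the selected one.\<close>

lemma L2_limit_unique:
  assumes "L2_limit F g" "L2_limit F h"
  shows "AE x in lborel. g x = h x"
proof -
  have L: "g \<in> L2" "h \<in> L2" "\<And>n. F n \<in> L2" using assms by (auto simp: L2_limit_def)
  have b: "L2_sq (\<lambda>x. g x - h x) \<le> 2 * L2_sq (\<lambda>x. F n x - g x) + 2 * L2_sq (\<lambda>x. F n x - h x)" for n
  proof -
    have i: "integrable lborel (\<lambda>x. (cmod (F n x - g x))\<^sup>2)" "integrable lborel (\<lambda>x. (cmod (F n x - h x))\<^sup>2)"
      "integrable lborel (\<lambda>x. (cmod (g x - h x))\<^sup>2)"
      by (intro L2_integrable_sq L2_diff L)+
    have "L2_sq (\<lambda>x. g x - h x) \<le> (LINT x|lborel. 2 * (cmod (F n x - g x))\<^sup>2 + 2 * (cmod (F n x - h x))\<^sup>2)"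
    proof (rule integral_mono)
      fix x
      show "(cmod (g x - h x))\<^sup>2 \<le> 2 * (cmod (F n x - g x))\<^sup>2 + 2 * (cmod (F n x - h x))\<^sup>2"
        using cmod_add_sq_le[of "g x - F n x" "F n x - h x"] by (simp add: norm_minus_commute)
    qed (use i in simp_all)
    then show ?thesis using i by simp
  qed
  have "(\<lambda>n. 2 * L2_sq (\<lambda>x. F n x - g x) + 2 * L2_sq (\<lambda>x. F n x - h x)) \<longlonglongrightarrow> 2 * 0 + 2 * 0"
    using assms unfolding L2_limit_def by (intro tendsto_intros) auto
  then have "L2_sq (\<lambda>x. g x - h x) \<le> 2 * 0 + 2 * 0"
    using b by (intro tendsto_lowerbound) auto
  then have "L2_sq (\<lambda>x. g x - h x) = 0"
    using L2_sq_nonneg[of "\<lambda>x. g x - h x"] by linarith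
  from L2_sq_eq_0_AE[OF L2_diff[OF L(1,2)] this] show ?thesis by simp
qed

lemma L2_cong_AE:
  assumes "f \<in> L2" "g \<in> borel_measurable borel" "AE x in lborel. f x = g x"
  shows "g \<in> L2"
proof (rule L2_I)
  note [measurable] = L2_measurable[OF assms(1)] assms(2)
  show "integrable lborel (\<lambda>x. (cmod (g x))\<^sup>2)"
    using L2_integrable_sq[OF assms(1)] by (rule integrable_cong_AE_imp) (use assms(3) in auto)
qed fact

lemma L2_limit_L2_lim: "L2_limit F g \<Longrightarrow> L2_limit F (L2_lim F)"
  unfolding L2_lim_def by (rule someI[of "L2_limit F" g])

text \<open>The Riesz-Fischer step. The weight 2^k is small enough for the weighted squares to have
  finite total integral, as 2^k 4^(-k) is summable, and large enough to recover the increments from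
  their squares. The telescoping series therefore converges absolutely almost everywhere.\<close>

lemma L2_complete_aux:
  assumes G: "\<And>k. G k \<in> L2" and d: "\<And>k. L2_sq (\<lambda>x. G (Suc k) x - G k x) \<le> (1/4) ^ k"
  shows "AE x in lborel. convergent (\<lambda>k. G k x)"
proof -
  note [measurable] = L2_measurable[OF G]
  define D where "D k x = G (Suc k) x - G k x" for k x
  have [measurable]: "D k \<in> borel_measurable borel" for k unfolding D_def by measurable
  have nn: "(\<integral>\<^sup>+x. ennreal ((cmod (D k x))\<^sup>2) \<partial>lborel) \<le> ennreal ((1/4) ^ k)" for k
    using d[of k] L2_integrable_sq[OF L2_diff[OF G G]]
    by (subst nn_integral_eq_integral) (auto simp: D_def)
  have "(\<integral>\<^sup>+x. (\<Sum>k. ennreal (2 ^ k * (cmod (D k x))\<^sup>2)) \<partial>lborel) =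
        (\<Sum>k. \<integral>\<^sup>+x. ennreal (2 ^ k * (cmod (D k x))\<^sup>2) \<partial>lborel)"
    by (rule nn_integral_suminf) measurable
  also have "\<dots> \<le> (\<Sum>k. ennreal ((1/2) ^ k))"
  proof (rule suminf_le)
    fix k
    have "(\<integral>\<^sup>+x. ennreal (2 ^ k * (cmod (D k x))\<^sup>2) \<partial>lborel) =
          ennreal (2 ^ k) * (\<integral>\<^sup>+x. ennreal ((cmod (D k x))\<^sup>2) \<partial>lborel)"
      by (subst nn_integral_cmult[symmetric]) (auto simp: ennreal_mult)
    also have "\<dots> \<le> ennreal (2 ^ k) * ennreal ((1/4) ^ k)"
      using nn by (intro mult_left_mono) auto
    also have "\<dots> = ennreal ((1/2) ^ k)"
      by (subst ennreal_mult[symmetric]) (auto simp: power_mult_distrib[symmetric])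
    finally show "(\<integral>\<^sup>+x. ennreal (2 ^ k * (cmod (D k x))\<^sup>2) \<partial>lborel) \<le> ennreal ((1/2) ^ k)" .
  qed auto
  also have "\<dots> = ennreal (\<Sum>k. (1/2) ^ k)"
    by (rule suminf_ennreal2) auto
  also have "\<dots> < \<infinity>" by simp
  finally have "(\<integral>\<^sup>+x. (\<Sum>k. ennreal (2 ^ k * (cmod (D k x))\<^sup>2)) \<partial>lborel) \<noteq> \<infinity>" by simp
  then have "AE x in lborel. (\<Sum>k. ennreal (2 ^ k * (cmod (D k x))\<^sup>2)) \<noteq> \<infinity>"
    by (rule nn_integral_PInf_AE[rotated]) measurable
  then show ?thesis
  proof eventually_elim
    case (elim x)
    have s: "summable (\<lambda>k. 2 ^ k * (cmod (D k x))\<^sup>2)"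
      using elim by (intro summable_suminf_not_top) auto
    have "summable (\<lambda>k. (1/2) ^ k + 2 ^ k * (cmod (D k x))\<^sup>2)"
      using s by (intro summable_add) auto
    then have "summable (\<lambda>k. D k x)"
    proof (rule summable_comparison_test')
      fix k
      have e: "(1/2::real) ^ k * 2 ^ k = 1" by (simp add: power_mult_distrib[symmetric])
      define a :: real where "a = (1/2) ^ k"
      define b :: real where "b = 2 ^ k"
      have ab: "a * b = 1" "a > 0" "b > 0" using e by (auto simp: a_def b_def)
      \<comment> \<open>Expanding this square with a b = 1 bounds |D| by the summable a + b
        |D|^2.\<close>
      have "0 \<le> b * (a - cmod (D k x))\<^sup>2" using ab by simp
      also have "\<dots> = (a * b) * a - 2 * (a * b) * cmod (D k x) + b * (cmod (D k x))\<^sup>2"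
        by (simp add: power2_eq_square algebra_simps)
      also have "\<dots> = a - 2 * cmod (D k x) + b * (cmod (D k x))\<^sup>2"
        using ab by simp
      finally show "norm (D k x) \<le> (1/2) ^ k + 2 ^ k * (cmod (D k x))\<^sup>2"
        unfolding a_def[symmetric] b_def[symmetric]
        using norm_ge_zero[of "D k x"] by linarith
    qed
    then have "convergent (\<lambda>n. \<Sum>k<n. D k x)"
      by (simp add: summable_iff_convergent)
    then have "convergent (\<lambda>n. G 0 x + (\<Sum>k<n. D k x))"
      by (intro convergent_add convergent_const)
    moreover have "(\<lambda>n. G 0 x + (\<Sum>k<n. D k x)) = (\<lambda>n. G n x)"
      unfolding D_def by (subst sum_lessThan_telescope) simp
    ultimately show ?case by simp
  qed
qed

theorem L2_complete:
  assumes F: "\<And>n. F n \<in> L2"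
    and C: "\<And>e. e > 0 \<Longrightarrow> \<exists>M. \<forall>m\<ge>M. \<forall>n\<ge>M. L2_sq (\<lambda>x. F m x - F n x) \<le> e"
  shows "\<exists>g. L2_limit F g"
proof -
  note [measurable] = L2_measurable[OF F]
  have "\<forall>k. \<exists>M. \<forall>m\<ge>M. \<forall>n\<ge>M. L2_sq (\<lambda>x. F m x - F n x) \<le> (1/4) ^ k"
    using C by simp
  from choice[OF this] obtain M
    where M: "\<And>k m n. m \<ge> M k \<Longrightarrow> n \<ge> M k \<Longrightarrow> L2_sq (\<lambda>x. F m x - F n x) \<le> (1/4) ^ k"
    by blast
  \<comment> \<open>Adding up all earlier thresholds puts \<open>r k'\<close> beyond
    \<open>M k\<close> for every k' from k on; the summand k makes \<open>r\<close>
    unbounded.\<close>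
  define r where "r k = k + (\<Sum>j\<le>k. M j)" for k
  have rM: "r k' \<ge> M k" if "k \<le> k'" for k k'
    using member_le_sum[of k "{..k'}" M] that unfolding r_def by auto
  have rk: "r k \<ge> k" for k by (simp add: r_def)
  define G where "G k = F (r k)" for k
  have G: "G k \<in> L2" for k by (simp add: G_def F)
  note [measurable] = L2_measurable[OF G]
  have conv: "AE x in lborel. convergent (\<lambda>k. G k x)"
    by (rule L2_complete_aux) (auto simp: G_def intro!: F M rM)
  define g where "g x = lim (\<lambda>k. G k x)" for x
  have [measurable]: "g \<in> borel_measurable borel"
    unfolding g_def by measurable
  \<comment> \<open>Fatou along the subsequence compares an arbitrary \<open>F n\<close> with
    \<open>g\<close>, so the whole sequence converges and not only the subsequence.\<close>
  have fatou: "(\<integral>\<^sup>+x. ennreal ((cmod (F n x - g x))\<^sup>2) \<partial>lborel) \<le> ennreal e"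
    if e: "e > 0" and n: "\<And>m. m \<ge> N \<Longrightarrow> L2_sq (\<lambda>x. F n x - F m x) \<le> e" for n N e
  proof -
    have "(\<integral>\<^sup>+x. ennreal ((cmod (F n x - g x))\<^sup>2) \<partial>lborel) =
          (\<integral>\<^sup>+x. liminf (\<lambda>k. ennreal ((cmod (F n x - G k x))\<^sup>2)) \<partial>lborel)"
    proof (rule nn_integral_cong_AE)
      show "AE x in lborel. ennreal ((cmod (F n x - g x))\<^sup>2) = liminf (\<lambda>k. ennreal ((cmod (F n x - G k x))\<^sup>2))"
        using conv
      proof eventually_elim
        case (elim x)
        then have "(\<lambda>k. G k x) \<longlonglongrightarrow> g x" by (simp add: g_def convergent_LIMSEQ_iff)
        then have "(\<lambda>k. ennreal ((cmod (F n x - G k x))\<^sup>2)) \<longlonglongrightarrow> ennreal ((cmod (F n x - g x))\<^sup>2)"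
          by (intro tendsto_intros)
        then show ?case by (rule lim_imp_Liminf[OF sequentially_bot, symmetric])
      qed
    qed
    also have "\<dots> \<le> liminf (\<lambda>k. \<integral>\<^sup>+x. ennreal ((cmod (F n x - G k x))\<^sup>2) \<partial>lborel)"
      by (rule nn_integral_liminf) measurable
    also have "\<dots> \<le> ennreal e"
    proof (rule Liminf_le)
      have "(\<integral>\<^sup>+x. ennreal ((cmod (F n x - G k x))\<^sup>2) \<partial>lborel) \<le> ennreal e" if "k \<ge> N" for k
      proof -
        have "r k \<ge> N" using that rk[of k] by linarith
        from n[OF this] show ?thesis
          using L2_integrable_sq[OF L2_diff[OF F G]]
          by (subst nn_integral_eq_integral) (auto simp: G_def intro: ennreal_leI)
      qed
      then show "\<forall>\<^sub>F k in sequentially. (\<integral>\<^sup>+x. ennreal ((cmod (F n x - G k x))\<^sup>2) \<partial>lborel) \<le> ennreal e"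
        by (auto simp: eventually_sequentially)
    qed simp
    finally show ?thesis .
  qed
  have L2d: "(\<lambda>x. F n x - g x) \<in> L2" and le: "L2_sq (\<lambda>x. F n x - g x) \<le> e"
    if e: "e > 0" and n: "\<And>m. m \<ge> N \<Longrightarrow> L2_sq (\<lambda>x. F n x - F m x) \<le> e" for n N e
  proof -
    have i: "integrable lborel (\<lambda>x. (cmod (F n x - g x))\<^sup>2)"
      using fatou[OF e n] by (intro integrableI_bounded) (auto simp: top_unique less_top[symmetric])
    then show "(\<lambda>x. F n x - g x) \<in> L2"
      by (intro L2_I) measurable
    have "ennreal (L2_sq (\<lambda>x. F n x - g x)) \<le> ennreal e"
      using fatou[OF e n] i by (subst (asm) nn_integral_eq_integral) auto
    then show "L2_sq (\<lambda>x. F n x - g x) \<le> e"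
      using e by (subst (asm) ennreal_le_iff) auto
  qed
  obtain N where N: "\<And>m n. m \<ge> N \<Longrightarrow> n \<ge> N \<Longrightarrow> L2_sq (\<lambda>x. F m x - F n x) \<le> 1"
    using C[of 1] by auto
  have "(\<lambda>x. F N x - (F N x - g x)) \<in> L2"
    by (rule L2_diff[OF F L2d[of 1 N]]) (use N in auto)
  then have g: "g \<in> L2" by simp
  have "(\<lambda>n. L2_sq (\<lambda>x. F n x - g x)) \<longlonglongrightarrow> 0"
  proof (rule LIMSEQ_I)
    fix e :: real assume e: "e > 0"
    obtain N where N: "\<And>m n. m \<ge> N \<Longrightarrow> n \<ge> N \<Longrightarrow> L2_sq (\<lambda>x. F m x - F n x) \<le> e / 2"
      using C[of "e / 2"] e by auto
    have "L2_sq (\<lambda>x. F n x - g x) \<le> e / 2" if "n \<ge> N" for n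
      using that e N by (intro le[of _ N]) auto
    then show "\<exists>no. \<forall>n\<ge>no. norm (L2_sq (\<lambda>x. F n x - g x) - 0) < e"
      using e by (intro exI[of _ N]) (fastforce simp: L2_sq_nonneg)
  qed
  with g F show ?thesis by (auto simp: L2_limit_def)
qed

subsection \<open>Functions of Gaussian decay\<close>

text \<open>The linear term B |x| absorbs factors of exponential growth, hence also polynomial ones,
  without changing c.\<close>

definition gauss_bd :: "(real \<Rightarrow> complex) \<Rightarrow> bool" where
  "gauss_bd f \<longleftrightarrow> (\<exists>K B c. c > 0 \<and> (\<forall>x. cmod (f x) \<le> K * exp (B * \<bar>x\<bar> - c * x\<^sup>2)))"

lemma gauss_bdI: "c > 0 \<Longrightarrow> (\<And>x. cmod (f x) \<le> K * exp (B * \<bar>x\<bar> - c * x\<^sup>2)) \<Longrightarrow> gauss_bd f"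
  unfolding gauss_bd_def by blast

lemma gauss_bdE:
  assumes "gauss_bd f"
  obtains K B c where "c > 0" "K \<ge> 0" "\<And>x. cmod (f x) \<le> K * exp (B * \<bar>x\<bar> - c * x\<^sup>2)"
proof -
  obtain K B c where *: "c > 0" "\<And>x. cmod (f x) \<le> K * exp (B * \<bar>x\<bar> - c * x\<^sup>2)"
    using assms unfolding gauss_bd_def by blast
  have "0 \<le> K" using order_trans[OF norm_ge_zero *(2)[of 0]] by simp
  with * that show ?thesis by blast
qed

text \<open>Half of the quadratic exponent absorbs the linear one: by completing the square, B |x| -
  c x^2 is at most B^2 / (2 c) - (c / 2) x^2.\<close>

lemma gauss_bdE':
  assumes "gauss_bd f"
  obtains K c where "c > 0" "K \<ge> 0" "\<And>x. cmod (f x) \<le> K * exp (- c * x\<^sup>2)"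
proof -
  obtain K B c where *: "c > 0" "K \<ge> 0" "\<And>x. cmod (f x) \<le> K * exp (B * \<bar>x\<bar> - c * x\<^sup>2)"
    using gauss_bdE[OF assms] by metis
  have "cmod (f x) \<le> (K * exp (B\<^sup>2 / (2 * c))) * exp (- (c / 2) * x\<^sup>2)" for x
  proof -
    have "0 \<le> (c * \<bar>x\<bar> - B)\<^sup>2 / (2 * c)" using * by simp
    also have "(c * \<bar>x\<bar> - B)\<^sup>2 / (2 * c) = c / 2 * x\<^sup>2 - B * \<bar>x\<bar> + B\<^sup>2 / (2 * c)"
    proof -
      have "(c * \<bar>x\<bar> - B)\<^sup>2 = c\<^sup>2 * x\<^sup>2 - 2 * c * B * \<bar>x\<bar> + B\<^sup>2"
        by (simp add: power2_diff power_mult_distrib)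
      then show ?thesis using * by (simp add: field_simps power2_eq_square)
    qed
    finally have "B * \<bar>x\<bar> - c * x\<^sup>2 \<le> B\<^sup>2 / (2 * c) + - (c / 2) * x\<^sup>2" by simp
    then have "exp (B * \<bar>x\<bar> - c * x\<^sup>2) \<le> exp (B\<^sup>2 / (2 * c)) * exp (- (c / 2) * x\<^sup>2)"
      by (simp flip: exp_add)
    then have "K * exp (B * \<bar>x\<bar> - c * x\<^sup>2) \<le> K * (exp (B\<^sup>2 / (2 * c)) * exp (- (c / 2) * x\<^sup>2))"
      using * by (intro mult_left_mono)
    with *(3)[of x] show ?thesis by (simp add: mult.assoc)
  qed
  with * that[of "c / 2" "K * exp (B\<^sup>2 / (2 * c))"] show ?thesis by simp
qed

lemma gauss_bd_mult_exp:
  assumes f: "gauss_bd f" and u: "\<And>x. cmod (u x) \<le> M * exp (A * \<bar>x\<bar>)"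
  shows "gauss_bd (\<lambda>x. u x * f x)"
proof -
  obtain K B c where *: "c > 0" "K \<ge> 0" "\<And>x. cmod (f x) \<le> K * exp (B * \<bar>x\<bar> - c * x\<^sup>2)"
    using gauss_bdE[OF f] by metis
  show ?thesis
  proof (rule gauss_bdI[OF *(1)])
    fix x
    have "cmod (u x * f x) \<le> (M * exp (A * \<bar>x\<bar>)) * (K * exp (B * \<bar>x\<bar> - c * x\<^sup>2))"
      unfolding norm_mult by (rule mult_mono'[OF u *(3)]) auto
    also have "\<dots> = (M * K) * exp ((A + B) * \<bar>x\<bar> - c * x\<^sup>2)"
      by (simp add: algebra_simps exp_add exp_diff)
    finally show "cmod (u x * f x) \<le> (M * K) * exp ((A + B) * \<bar>x\<bar> - c * x\<^sup>2)" .
  qed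
qed

lemma gauss_bd_mult_bounded:
  "gauss_bd f \<Longrightarrow> (\<And>x. cmod (u x) \<le> M) \<Longrightarrow> gauss_bd (\<lambda>x. u x * f x)"
  by (rule gauss_bd_mult_exp[where A=0 and M=M]) auto

lemma gauss_bd_cmult: "gauss_bd f \<Longrightarrow> gauss_bd (\<lambda>x. c * f x)"
  by (rule gauss_bd_mult_bounded[where M="cmod c"]) auto

lemma gauss_bd_cis: "gauss_bd f \<Longrightarrow> gauss_bd (\<lambda>x. cis (u x) * f x)"
  by (rule gauss_bd_mult_bounded[where M=1]) auto

lemma gauss_bd_x: "gauss_bd f \<Longrightarrow> gauss_bd (\<lambda>x. of_real x * f x)"
proof (erule gauss_bd_mult_exp)
  fix x :: real
  show "cmod (of_real x) \<le> 1 * exp (1 * \<bar>x\<bar>)"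
    using exp_ge_add_one_self[of "\<bar>x\<bar>"] by (simp only: norm_of_real mult_1_left)
qed

lemma gauss_bd_add:
  assumes f: "gauss_bd f" and g: "gauss_bd g"
  shows "gauss_bd (\<lambda>x. f x + g x)"
proof -
  obtain K c where 1: "c > 0" "K \<ge> 0" "\<And>x. cmod (f x) \<le> K * exp (- c * x\<^sup>2)"
    using gauss_bdE'[OF f] by metis
  obtain K' c' where 2: "c' > 0" "K' \<ge> 0" "\<And>x. cmod (g x) \<le> K' * exp (- c' * x\<^sup>2)"
    using gauss_bdE'[OF g] by metis
  show ?thesis
  proof (rule gauss_bdI)
    show "min c c' > 0" using 1 2 by simp
    fix x
    have "cmod (f x + g x) \<le> K * exp (- c * x\<^sup>2) + K' * exp (- c' * x\<^sup>2)"
      by (rule order_trans[OF norm_triangle_ineq add_mono[OF 1(3) 2(3)]])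
    also have "\<dots> \<le> K * exp (- min c c' * x\<^sup>2) + K' * exp (- min c c' * x\<^sup>2)"
      using 1 2 by (intro add_mono mult_left_mono) (auto intro!: mult_right_mono)
    finally show "cmod (f x + g x) \<le> (K + K') * exp (0 * \<bar>x\<bar> - min c c' * x\<^sup>2)"
      by (simp add: algebra_simps)
  qed
qed

lemma gauss_bd_diff: "gauss_bd f \<Longrightarrow> gauss_bd g \<Longrightarrow> gauss_bd (\<lambda>x. f x - g x)"
  using gauss_bd_add[of f "\<lambda>x. (-1) * g x"] gauss_bd_cmult[of g "-1"] by simp

lemma gauss_bd_mult:
  assumes f: "gauss_bd f" and g: "gauss_bd g"
  shows "gauss_bd (\<lambda>x. f x * g x)"
proof -
  obtain K c where 1: "c > 0" "K \<ge> 0" "\<And>x. cmod (f x) \<le> K * exp (- c * x\<^sup>2)"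
    using gauss_bdE'[OF f] by metis
  show ?thesis
  proof (rule gauss_bd_mult_bounded[OF g])
    fix x
    have "exp (- c * x\<^sup>2) \<le> 1" using 1(1) by simp
    then have "K * exp (- c * x\<^sup>2) \<le> K" using 1(2) by (simp add: mult_left_le)
    with 1(3)[of x] show "cmod (f x) \<le> K" by linarith
  qed
qed

section \<open>Gaussian integrals and vanishing boundary terms\<close>

lemma has_bochner_integral_gaussian: "has_bochner_integral lborel (\<lambda>x::real. exp (- x\<^sup>2)) (sqrt pi)"
  using has_bochner_integral_even_function[OF gaussian_moment_0] by simp

lemma integrable_exp_neg_sq:
  assumes "c > 0"
  shows "integrable lborel (\<lambda>x::real. exp (- c * x\<^sup>2))"
proof -
  have "integrable lborel (\<lambda>x::real. exp (- x\<^sup>2))"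
    using has_bochner_integral_gaussian by (simp add: has_bochner_integral_iff)
  then have "integrable lborel (\<lambda>x::real. exp (- (0 + sqrt c * x)\<^sup>2))"
    by (rule lborel_integrable_real_affine) (use assms in auto)
  then show ?thesis using assms by (simp add: power_mult_distrib)
qed

lemma gauss_bd_integrable:
  assumes "gauss_bd f" and "f \<in> borel_measurable borel"
  shows "integrable lborel f"
proof -
  obtain K c where 1: "c > 0" "K \<ge> 0" "\<And>x. cmod (f x) \<le> K * exp (- c * x\<^sup>2)"
    using gauss_bdE'[OF assms(1)] by metis
  show ?thesis
  proof (rule Bochner_Integration.integrable_bound)
    show "integrable lborel (\<lambda>x. K * exp (- c * x\<^sup>2))"
      using integrable_exp_neg_sq[OF 1(1)] by simp
    show "AE x in lborel. norm (f x) \<le> norm (K * exp (- c * x\<^sup>2))"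
      using 1(3) 1(2) by simp
  qed (use assms in simp)
qed

lemma gauss_bd_L2:
  assumes f: "gauss_bd f" and m[measurable]: "f \<in> borel_measurable borel"
  shows "f \<in> L2"
proof (rule L2_I[OF m])
  obtain K c where 1: "c > 0" "K \<ge> 0" "\<And>x. cmod (f x) \<le> K * exp (- c * x\<^sup>2)"
    using gauss_bdE'[OF f] by metis
  have "gauss_bd (\<lambda>x. cnj (f x))" by (rule gauss_bdI[of c _ K 0]) (use 1 in auto)
  have "(\<lambda>x. cnj (f x)) \<in> borel_measurable borel"
    using borel_measurable_continuous_onI[of cnj] by (intro measurable_compose[OF m]) (auto intro: continuous_intros)
  note [measurable] = this
  from gauss_bd_mult[OF f \<open>gauss_bd (\<lambda>x. cnj (f x))\<close>] have "integrable lborel (\<lambda>x. cmod (f x * cnj (f x)))"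
    by (intro integrable_norm gauss_bd_integrable) measurable
  then show "integrable lborel (\<lambda>x. (cmod (f x))\<^sup>2)"
    by (simp add: norm_mult power2_eq_square)
qed

lemma gauss_bd_tendsto:
  assumes f: "gauss_bd f"
  shows "(f \<longlongrightarrow> 0) at_top" "(f \<longlongrightarrow> 0) at_bot"
proof -
  obtain K c where 1: "c > 0" "K \<ge> 0" "\<And>x. cmod (f x) \<le> K * exp (- c * x\<^sup>2)"
    using gauss_bdE'[OF f] by metis
  have "((\<lambda>x::real. exp (- (c * (x * x)))) \<longlongrightarrow> 0) at_top"
    using 1(1) by (intro filterlim_compose[OF exp_at_bot] filterlim_compose[OF filterlim_uminus_at_bot_at_top]
        filterlim_tendsto_pos_mult_at_top[OF tendsto_const] filterlim_at_top_mult_at_top filterlim_ident)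
  then have *: "((\<lambda>x::real. K * exp (- c * x\<^sup>2)) \<longlongrightarrow> 0) at_top"
    using tendsto_mult_right_zero[where c=K] by (simp add: power2_eq_square)
  moreover have "((\<lambda>x. K * exp (- c * x\<^sup>2)) \<longlongrightarrow> 0) at_bot"
    unfolding filterlim_at_bot_mirror using * by simp
  ultimately have "((\<lambda>x. K * exp (- c * x\<^sup>2)) \<longlongrightarrow> 0) at_top" "((\<lambda>x. K * exp (- c * x\<^sup>2)) \<longlongrightarrow> 0) at_bot"
    by auto
  then show "(f \<longlongrightarrow> 0) at_top" "(f \<longlongrightarrow> 0) at_bot"
    using 1(3) by (auto intro: Lim_null_comparison[of f "\<lambda>x. K * exp (- c * x\<^sup>2)"])
qed

text \<open>Every integration by parts below is an instance: the derivative of a product integrates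
  to 0 because Gaussian decay kills the boundary values.\<close>

lemma gauss_bd_integral_deriv:
  assumes D: "\<And>x. (F has_vector_derivative f x) (at x)" and f: "\<And>x. isCont f x"
    and F': "gauss_bd F" and f': "gauss_bd f"
  shows "(LINT x|lborel. f x) = 0"
proof -
  have "continuous_on UNIV f" using f by (simp add: continuous_on_eq_continuous_at)
  then have m: "f \<in> borel_measurable borel" by (rule borel_measurable_continuous_onI)
  have "(LBINT x=-\<infinity>..\<infinity>. f x) = 0 - 0"
  proof (rule interval_integral_FTC_integrable[where F=F])
    show "set_integrable lborel (einterval (- \<infinity>) \<infinity>) f"
      using gauss_bd_integrable[OF f' m] by (simp add: set_integrable_def)
    show "((F \<circ> real_of_ereal) \<longlongrightarrow> 0) (at_right (- \<infinity>))" "((F \<circ> real_of_ereal) \<longlongrightarrow> 0) (at_left \<infinity>)"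
      using gauss_bd_tendsto[OF F'] by (simp_all add: ereal_tendsto_simps)
  qed (use D f in auto)
  then show ?thesis by (simp add: interval_integral_eq_integral' interval_lebesgue_integral_def set_lebesgue_integral_def)
qed

subsection \<open>Hermite functions\<close>

text \<open>The unnormalised Hermite functions H_n(x) exp (- x^2 / 2) with the physicists'
  polynomials H_n. Their recurrences have integer coefficients, which keeps the square roots of
  \<open>hnorm\<close> out of the computations.\<close>

definition hpsi :: "nat \<Rightarrow> real \<Rightarrow> real" where
  "hpsi n x = (- 1) ^ n * poly (gauss_deriv_poly n) x * exp (- x\<^sup>2 / 2)"

definition hnorm :: "nat \<Rightarrow> real" where
  "hnorm n = sqrt (2 ^ n * fact n * sqrt pi)"

lemma hnorm_pos: "hnorm n > 0"
  by (simp add: hnorm_def)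

lemma hermite_fun_eq_hpsi: "hermite_fun n x = hpsi n x / hnorm n"
proof -
  have "exp (x\<^sup>2 / 2) * exp (- x\<^sup>2) = exp (- x\<^sup>2 / 2)"
    by (simp flip: exp_add)
  then show ?thesis
    by (simp add: hermite_fun_def funpow_deriv_gauss hpsi_def hnorm_def)
qed

lemma hpsi_0: "hpsi 0 x = exp (- x\<^sup>2 / 2)"
  by (simp add: hpsi_def)

text \<open>Combines H_(n+1) = 2 x H_n - H_n' with H_n' = 2 n H_(n-1). At n = 0 the truncated
  \<open>n - 1\<close> is harmless, its coefficient being 0.\<close>

lemma hpsi_Suc: "hpsi (Suc n) x = 2 * x * hpsi n x - 2 * real n * hpsi (n - 1) x"
proof (cases n)
  case (Suc m)
  then have "pderiv (gauss_deriv_poly n) = smult (- 2 * real n) (gauss_deriv_poly m)"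
    using pderiv_gauss_deriv_poly[of m] by simp
  then show ?thesis using Suc
    by (simp add: hpsi_def algebra_simps)
qed (simp add: hpsi_def)

lemma hpsi_deriv: "(hpsi n has_real_derivative (x * hpsi n x - hpsi (Suc n) x)) (at x)"
  unfolding hpsi_def
  by (auto intro!: derivative_eq_intros simp: algebra_simps)

lemma hpsi_uminus: "hpsi n (- x) = (- 1) ^ n * hpsi n x"
proof (induction n rule: less_induct)
  case (less n)
  show ?case
  proof (cases n)
    case (Suc m)
    then have A: "real m * hpsi (m - 1) (- x) = (- 1) ^ (Suc m) * (real m * hpsi (m - 1) x)"
      using less[of "m - 1"] by (cases m) auto
    have B: "hpsi m (- x) = (- 1) ^ m * hpsi m x" using less[of m] Suc by simp
    have "hpsi n (- x) = 2 * (- x) * hpsi m (- x) - 2 * (real m * hpsi (m - 1) (- x))"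
      unfolding Suc hpsi_Suc by (simp only: mult.assoc)
    also have "\<dots> = (- 1) ^ n * (2 * x * hpsi m x - 2 * (real m * hpsi (m - 1) x))"
      unfolding A B Suc by (simp add: right_diff_distrib)
    also have "\<dots> = (- 1) ^ n * hpsi n x"
      unfolding Suc hpsi_Suc by (simp only: mult.assoc)
    finally show ?thesis .
  qed (simp add: hpsi_0)
qed

lemma isCont_hpsi: "isCont (hpsi n) x"
  using hpsi_deriv DERIV_isCont by blast

lemma hpsi_measurable [measurable]: "hpsi n \<in> borel_measurable borel"
  by (rule borel_measurable_continuous_onI) (simp add: continuous_on_eq_continuous_at isCont_hpsi)

lemma gauss_bd_hpsi: "gauss_bd (\<lambda>x. of_real (hpsi n x))"
proof (induction n rule: less_induct)
  case (less n)
  show ?case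
  proof (cases n)
    case 0
    show ?thesis unfolding 0 by (rule gauss_bdI[of "1/2" _ 1 0]) (auto simp: hpsi_0)
  next
    case (Suc m)
    have "gauss_bd (\<lambda>x. 2 * (of_real x * of_real (hpsi m x)) - 2 * of_nat m * of_real (hpsi (m - 1) x))"
      using Suc by (intro gauss_bd_diff gauss_bd_cmult gauss_bd_x less) auto
    then show ?thesis unfolding Suc hpsi_Suc by (simp add: mult.assoc)
  qed
qed

text \<open>Raising one index is adjoint to lowering the other. Differentiating the product raises
  an index in each factor, and the recurrence for index m turns one of the two terms into a
  lowering.\<close>

lemma hpsi_product_integral_Suc:
  "(LINT x|lborel. complex_of_real (hpsi (Suc n) x) * of_real (hpsi m x)) =
   2 * of_nat m * (LINT x|lborel. of_real (hpsi n x) * of_real (hpsi (m - 1) x))"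
proof -
  let ?\<psi> = "\<lambda>n x. complex_of_real (hpsi n x)"
  have b: "gauss_bd (\<lambda>x. ?\<psi> i x * ?\<psi> j x)" for i j
    by (intro gauss_bd_mult gauss_bd_hpsi)
  have i: "integrable lborel (\<lambda>x. ?\<psi> i x * ?\<psi> j x)" for i j
    by (rule gauss_bd_integrable[OF b]) measurable
  define f where "f x = 2 * of_nat m * (?\<psi> n x * ?\<psi> (m - 1) x) - ?\<psi> (Suc n) x * ?\<psi> m x" for x
  have "((\<lambda>x. ?\<psi> n x * ?\<psi> m x) has_vector_derivative f x) (at x)" for x
  proof -
    have "((\<lambda>x. hpsi n x * hpsi m x) has_real_derivative
        (x * hpsi n x - hpsi (Suc n) x) * hpsi m x + (x * hpsi m x - hpsi (Suc m) x) * hpsi n x) (at x)"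
      by (rule DERIV_mult[OF hpsi_deriv hpsi_deriv])
    also have "(x * hpsi n x - hpsi (Suc n) x) * hpsi m x + (x * hpsi m x - hpsi (Suc m) x) * hpsi n x =
        2 * real m * (hpsi n x * hpsi (m - 1) x) - hpsi (Suc n) x * hpsi m x"
      unfolding hpsi_Suc[of m] by (simp add: algebra_simps)
    finally have "((\<lambda>x. complex_of_real (hpsi n x * hpsi m x)) has_vector_derivative
        of_real (2 * real m * (hpsi n x * hpsi (m - 1) x) - hpsi (Suc n) x * hpsi m x)) (at x)"
      by (intro has_vector_derivative_of_real) (simp add: has_real_derivative_iff_has_vector_derivative)
    then show ?thesis by (simp add: f_def)
  qed
  moreover have "isCont f x" for x
    unfolding f_def by (intro continuous_intros isCont_hpsi)
  moreover have "gauss_bd f"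
    unfolding f_def by (intro gauss_bd_diff gauss_bd_cmult b)
  ultimately have "(LINT x|lborel. f x) = 0"
    by (rule gauss_bd_integral_deriv[OF _ _ b])
  then show ?thesis
    unfolding f_def using i by simp
qed

text \<open>Adjointness lowers both indices together. If one of them reaches 0 first, the factor m =
  0 annihilates the integral; equal indices end in the Gaussian integral, and \<open>hnorm\<close>
  squared grows by the same factor 2 (n + 1).\<close>

lemma hpsi_orthogonal:
  "(LINT x|lborel. complex_of_real (hpsi n x) * of_real (hpsi m x)) = (if n = m then of_real ((hnorm n)\<^sup>2) else 0)"
proof (induction n arbitrary: m)
  case 0
  show ?case
  proof (cases m)
    case 0
    have "exp (- x\<^sup>2 / 2) * exp (- x\<^sup>2 / 2) = exp (- x\<^sup>2)" for x :: real
      by (simp flip: exp_add)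
    then have "complex_of_real (hpsi 0 x) * of_real (hpsi 0 x) = of_real (exp (- x\<^sup>2))" for x
      by (simp add: hpsi_0 flip: of_real_mult)
    then show ?thesis
      using has_bochner_integral_gaussian 0 by (simp add: hnorm_def has_bochner_integral_iff)
  next
    case (Suc k)
    then show ?thesis
      using hpsi_product_integral_Suc[of k 0] by (simp add: mult.commute)
  qed
next
  case (Suc n)
  have "complex_of_real ((hnorm (Suc n))\<^sup>2) = of_real (2 * real (Suc n) * (hnorm n)\<^sup>2)"
    by (simp add: hnorm_def)
  then show ?case
    unfolding hpsi_product_integral_Suc Suc.IH by (cases m) auto
qed

lemma gauss_bd_hermite: "gauss_bd (\<lambda>x. of_real (hermite_fun n x))"
  using gauss_bd_cmult[OF gauss_bd_hpsi, of "of_real (1 / hnorm n)" n] by (simp add: hermite_fun_eq_hpsi)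

lemma hermite_fun_measurable [measurable]: "hermite_fun n \<in> borel_measurable borel"
  unfolding hermite_fun_eq_hpsi[abs_def] by measurable

lemma hermite_L2: "(\<lambda>x. of_real (hermite_fun n x)) \<in> L2"
  by (rule gauss_bd_L2[OF gauss_bd_hermite]) measurable

lemma hermite_orthonormal:
  "(LINT x|lborel. complex_of_real (hermite_fun n x) * of_real (hermite_fun m x)) = (if n = m then 1 else 0)"
proof -
  have "(LINT x|lborel. complex_of_real (hermite_fun n x) * of_real (hermite_fun m x)) =
    (LINT x|lborel. of_real (1 / (hnorm n * hnorm m)) * (complex_of_real (hpsi n x) * of_real (hpsi m x)))"
    by (simp add: hermite_fun_eq_hpsi)
  then show ?thesis
    using hnorm_pos[of n] hnorm_pos[of m] by (simp only: integral_mult_right_zero hpsi_orthogonal) (simp add: power2_eq_square)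
qed

subsection \<open>Completeness of the Hermite functions\<close>

lemma exp_series_partial_le: "cmod (\<Sum>k<N. z ^ k /\<^sub>R fact k) \<le> exp (cmod z)"
proof -
  have "cmod (\<Sum>k<N. z ^ k /\<^sub>R fact k) \<le> (\<Sum>k<N. cmod z ^ k /\<^sub>R fact k)"
    by (rule order_trans[OF norm_sum]) (simp add: norm_power norm_mult divide_inverse_commute)
  also have "\<dots> \<le> (\<Sum>k. cmod z ^ k /\<^sub>R fact k)"
    by (rule sum_le_suminf) (use exp_converges[of "cmod z"] in \<open>auto simp: sums_iff\<close>)
  also have "\<dots> = exp (cmod z)" using exp_converges[of "cmod z"] by (simp add: sums_iff)
  finally show ?thesis .
qed

text \<open>The function |g| exp (|u| |x|) dominates all partial sums of the exponential series. The
  expansion serves twice: with vanishing moments in the completeness proof, and with explicit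
  moments for the chirped Gaussian.\<close>

lemma fourier_integral_moment_series:
  fixes g :: "real \<Rightarrow> complex"
  assumes m[measurable]: "g \<in> borel_measurable borel"
    and i: "\<And>A. integrable lborel (\<lambda>x. cmod (g x) * exp (A * \<bar>x\<bar>))"
  shows "(\<lambda>n. (\<i> * of_real u) ^ n /\<^sub>R fact n * (LINT x|lborel. of_real x ^ n * g x)) sums
         (LINT x|lborel. cis (u * x) * g x)"
proof -
  let ?z = "\<lambda>x. \<i> * of_real (u * x)"
  have e: "(\<Sum>k<N. ?z x ^ k /\<^sub>R fact k) * g x = (\<Sum>k<N. (\<i> * of_real u) ^ k /\<^sub>R fact k * (of_real x ^ k * g x))" for N x
    unfolding sum_distrib_right by (intro sum.cong refl) (simp add: power_mult_distrib mult_ac)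
  have int: "integrable lborel (\<lambda>x. of_real x ^ k * g x)" for k
  proof (rule Bochner_Integration.integrable_bound[OF i[of "real k"]])
    have "\<bar>x\<bar> ^ k \<le> exp (real k * \<bar>x\<bar>)" for x :: real
      using power_mono[of "\<bar>x\<bar>" "exp \<bar>x\<bar>" k] exp_ge_add_one_self[of "\<bar>x\<bar>"]
      by (simp add: exp_of_nat_mult) 
    then show "AE x in lborel. norm (of_real x ^ k * g x) \<le> norm (cmod (g x) * exp (real k * \<bar>x\<bar>))"
      by (intro AE_I2) (simp add: norm_mult norm_power mult.commute[of _ "cmod _"] mult_left_mono)
  qed measurable
  have "(\<lambda>N. LINT x|lborel. (\<Sum>k<N. ?z x ^ k /\<^sub>R fact k) * g x) \<longlonglongrightarrow> (LINT x|lborel. cis (u * x) * g x)"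
  proof (rule integral_dominated_convergence[where w="\<lambda>x. cmod (g x) * exp (\<bar>u\<bar> * \<bar>x\<bar>)"])
    show "AE x in lborel. (\<lambda>N. (\<Sum>k<N. ?z x ^ k /\<^sub>R fact k) * g x) \<longlonglongrightarrow> cis (u * x) * g x"
    proof (intro AE_I2 tendsto_intros)
      fix x
      show "(\<lambda>N. \<Sum>k<N. ?z x ^ k /\<^sub>R fact k) \<longlonglongrightarrow> cis (u * x)"
        using exp_converges[of "?z x"] by (simp add: sums_def cis_conv_exp)
    qed
    show "AE x in lborel. norm ((\<Sum>k<N. ?z x ^ k /\<^sub>R fact k) * g x) \<le> cmod (g x) * exp (\<bar>u\<bar> * \<bar>x\<bar>)" for N
    proof (intro AE_I2)
      fix x
      have "cmod (?z x) = \<bar>u\<bar> * \<bar>x\<bar>" by (simp only: norm_mult norm_ii norm_of_real abs_mult mult_1_left)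
      then show "norm ((\<Sum>k<N. ?z x ^ k /\<^sub>R fact k) * g x) \<le> cmod (g x) * exp (\<bar>u\<bar> * \<bar>x\<bar>)"
        using mult_right_mono[OF exp_series_partial_le[of "?z x" N], of "cmod (g x)"]
        by (simp only: norm_mult norm_ge_zero mult.commute[of "cmod (g x)"])
    qed
    show "(\<lambda>x. cis (u * x) * g x) \<in> borel_measurable lborel" unfolding cis_conv_exp by measurable
    show "(\<lambda>x. (\<Sum>k<N. ?z x ^ k /\<^sub>R fact k) * g x) \<in> borel_measurable lborel" for N by measurable
  qed (rule i)
  moreover have "(LINT x|lborel. (\<Sum>k<N. ?z x ^ k /\<^sub>R fact k) * g x) =
      (\<Sum>k<N. (\<i> * of_real u) ^ k /\<^sub>R fact k * (LINT x|lborel. of_real x ^ k * g x))" for N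
    unfolding e by (subst Bochner_Integration.integral_sum) (use int in auto)
  ultimately show ?thesis by (simp add: sums_def)
qed

text \<open>The positive and negative parts of \<open>g\<close> have equal transforms, hence, at u =
  0, equal mass. Divided by that mass they are densities of probability laws with the same
  characteristic function, and Levy's uniqueness theorem makes them equal.\<close>

lemma fourier_unique_real:
  fixes g :: "real \<Rightarrow> real"
  assumes g: "integrable lborel g" and z: "\<And>u. (LINT x|lborel. cis (u * x) * of_real (g x)) = 0"
  shows "AE x in lborel. g x = 0"
proof -
  note [measurable] = borel_measurable_integrable[OF g, simplified]
  define p where "p x = max 0 (g x)" for x
  define q where "q x = max 0 (- g x)" for x
  have [measurable]: "p \<in> borel_measurable borel" "q \<in> borel_measurable borel"
    unfolding p_def[abs_def] q_def[abs_def] by measurable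
  have i: "integrable lborel p" "integrable lborel q"
    unfolding p_def q_def using g by auto
  have nn: "p x \<ge> 0" "q x \<ge> 0" and gpq: "g x = p x - q x" for x
    by (auto simp: p_def q_def)
  have ic: "integrable lborel (\<lambda>x. cis (u * x) * of_real (h x))" if "integrable lborel h" for h :: "real \<Rightarrow> real" and u
  proof (rule Bochner_Integration.integrable_bound[OF that])
    show "(\<lambda>x. cis (u * x) * of_real (h x)) \<in> borel_measurable lborel"
      using borel_measurable_integrable[OF that] unfolding cis_conv_exp by measurable
  qed (simp add: norm_mult)
  have eq: "(LINT x|lborel. cis (u * x) * of_real (p x)) = (LINT x|lborel. cis (u * x) * of_real (q x))" for u
    using z[of u] ic[OF i(1), of u] ic[OF i(2), of u] unfolding gpq by (simp add: right_diff_distrib)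
  define m where "m = (LINT x|lborel. p x)"
  have mq: "m = (LINT x|lborel. q x)" using eq[of 0] by (simp add: m_def)
  have m0: "m \<ge> 0" unfolding m_def by (rule Bochner_Integration.integral_nonneg) (simp add: nn)
  show ?thesis
  proof (cases "m = 0")
    case True
    have "AE x in lborel. p x = 0" "AE x in lborel. q x = 0"
      using integral_nonneg_eq_0_iff_AE[OF i(1)] integral_nonneg_eq_0_iff_AE[OF i(2)] True mq
      by (auto simp: m_def nn)
    then show ?thesis by eventually_elim (simp add: gpq)
  next
    case False
    with m0 have m: "m > 0" by simp
    have D: "real_distribution (density lborel (\<lambda>x. ennreal (h x / m)))"
      "char (density lborel (\<lambda>x. ennreal (h x / m))) u = (LINT x|lborel. cis (u * x) * of_real (h x)) / of_real m"
      if h[measurable]: "h \<in> borel_measurable borel" and "integrable lborel h" "\<And>x. h x \<ge> 0" "(LINT x|lborel. h x) = m" for h u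
    proof -
      have "emeasure (density lborel (\<lambda>x. ennreal (h x / m))) UNIV = (\<integral>\<^sup>+x. ennreal (h x / m) \<partial>lborel)"
        by (subst emeasure_density) auto
      also have "\<dots> = ennreal (LINT x|lborel. h x / m)"
        using that m by (intro nn_integral_eq_integral) auto
      also have "\<dots> = 1" using that m by simp
      finally have "prob_space (density lborel (\<lambda>x. ennreal (h x / m)))"
        by (intro prob_spaceI) simp
      then show "real_distribution (density lborel (\<lambda>x. ennreal (h x / m)))"
        by (intro real_distribution.intro real_distribution_axioms.intro) auto
      have "char (density lborel (\<lambda>x. ennreal (h x / m))) u = (LINT x|lborel. (h x / m) *\<^sub>R iexp (u * x))"
        unfolding char_def using that m by (subst integral_density) auto
      also have "\<dots> = (LINT x|lborel. (cis (u * x) * of_real (h x)) / of_real m)"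
        by (intro Bochner_Integration.integral_cong) (auto simp: cis_conv_exp scaleR_conv_of_real mult_ac)
      finally show "char (density lborel (\<lambda>x. ennreal (h x / m))) u = (LINT x|lborel. cis (u * x) * of_real (h x)) / of_real m"
        by simp
    qed
    have "density lborel (\<lambda>x. ennreal (p x / m)) = density lborel (\<lambda>x. ennreal (q x / m))"
    proof (rule Levy_uniqueness)
      show "char (density lborel (\<lambda>x. ennreal (p x / m))) = char (density lborel (\<lambda>x. ennreal (q x / m)))"
        by (rule ext) (simp add: D(2) i nn eq m_def[symmetric] mq[symmetric])
    qed (use D(1) i nn m_def mq in auto)
    then have "AE x in lborel. ennreal (p x / m) = ennreal (q x / m)"
      by (subst (asm) sigma_finite_measure.density_unique_iff[OF sigma_finite_lborel]) auto
    then show ?thesis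
      by eventually_elim (use m nn in \<open>simp add: gpq\<close>)
  qed
qed

text \<open>The transform of the conjugate at u is the conjugate of the transform at - u, so it
  vanishes too, and real and imaginary parts can be treated separately.\<close>

lemma fourier_unique:
  fixes g :: "real \<Rightarrow> complex"
  assumes g: "integrable lborel g" and z: "\<And>u. (LINT x|lborel. cis (u * x) * g x) = 0"
  shows "AE x in lborel. g x = 0"
proof -
  note [measurable] = borel_measurable_integrable[OF g, simplified]
  have gc: "integrable lborel (\<lambda>x. cnj (g x))" using g by simp
  have ic: "integrable lborel (\<lambda>x. cis (u * x) * h x)" if "integrable lborel h" for h u
  proof (rule Bochner_Integration.integrable_bound[OF that])
    show "(\<lambda>x. cis (u * x) * h x) \<in> borel_measurable lborel"
      using borel_measurable_integrable[OF that] unfolding cis_conv_exp by measurable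
  qed (simp add: norm_mult)
  have zc: "(LINT x|lborel. cis (u * x) * cnj (g x)) = 0" for u
  proof -
    have "(LINT x|lborel. cis (u * x) * cnj (g x)) = (LINT x|lborel. cnj (cis ((- u) * x) * g x))"
      by (simp add: cis_cnj)
    also have "\<dots> = cnj (LINT x|lborel. cis ((- u) * x) * g x)" by (rule Bochner_Integration.integral_cnj)
    also have "\<dots> = 0" by (simp only: z complex_cnj_zero)
    finally show ?thesis .
  qed
  have "(LINT x|lborel. cis (u * x) * of_real (Re (g x))) = 0" for u
  proof -
    have "(LINT x|lborel. cis (u * x) * of_real (Re (g x))) =
        (LINT x|lborel. (1/2) * (cis (u * x) * g x + cis (u * x) * cnj (g x)))"
      by (intro Bochner_Integration.integral_cong refl) (simp add: complex_eq_iff)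
    then show ?thesis using ic[OF g, of u] ic[OF gc, of u] z[of u] zc[of u] by simp
  qed
  then have R: "AE x in lborel. Re (g x) = 0"
    using g by (intro fourier_unique_real) auto
  have "(LINT x|lborel. cis (u * x) * of_real (Im (g x))) = 0" for u
  proof -
    have "(LINT x|lborel. cis (u * x) * of_real (Im (g x))) =
        (LINT x|lborel. (- \<i> / 2) * (cis (u * x) * g x - cis (u * x) * cnj (g x)))"
      by (intro Bochner_Integration.integral_cong refl) (simp add: complex_eq_iff)
    then show ?thesis using ic[OF g, of u] ic[OF gc, of u] z[of u] zc[of u] by simp
  qed
  then have I: "AE x in lborel. Im (g x) = 0"
    using g by (intro fourier_unique_real) auto
  from R I show ?thesis by eventually_elim (simp add: complex_eq_iff)
qed

text \<open>A common home for \<open>L\<^sup>2\<close> functions and classical Fourier transforms, where Hermite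
  coefficients make sense.\<close>

definition hermite_testable :: "(real \<Rightarrow> complex) \<Rightarrow> bool" where
  "hermite_testable f \<longleftrightarrow> f \<in> borel_measurable borel \<and>
     (\<forall>\<phi>. gauss_bd \<phi> \<longrightarrow> \<phi> \<in> borel_measurable borel \<longrightarrow> integrable lborel (\<lambda>x. f x * \<phi> x))"

lemma hermite_testable_L2: "f \<in> L2 \<Longrightarrow> hermite_testable f"
  unfolding hermite_testable_def using L2_measurable L2_mult_integrable gauss_bd_L2 by blast

lemma hermite_testable_bounded:
  assumes [measurable]: "f \<in> borel_measurable borel" and "\<And>x. cmod (f x) \<le> B"
  shows "hermite_testable f"
  unfolding hermite_testable_def
  by (intro conjI allI impI gauss_bd_integrable gauss_bd_mult_bounded[where M=B] assms) measurable

lemma hermite_testable_diff: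
  "hermite_testable f \<Longrightarrow> hermite_testable g \<Longrightarrow> hermite_testable (\<lambda>x. f x - g x)"
  by (auto simp: hermite_testable_def left_diff_distrib)

text \<open>If all coefficients vanish, so do all moments of f times the Gaussian. Its Fourier
  transform is a power series in these moments, hence 0, and the Gaussian has no zeros.\<close>

theorem hermite_complete:
  assumes f: "hermite_testable f" and c: "\<And>n. hermite_coeff f n = 0"
  shows "AE x in lborel. f x = 0"
proof -
  have [measurable]: "f \<in> borel_measurable borel"
    and fi: "\<And>\<phi>. gauss_bd \<phi> \<Longrightarrow> \<phi> \<in> borel_measurable borel \<Longrightarrow> integrable lborel (\<lambda>x. f x * \<phi> x)"
    using f by (auto simp: hermite_testable_def)
  let ?\<psi> = "\<lambda>n x. complex_of_real (hpsi n x)"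
  have b: "gauss_bd (\<lambda>x. of_real x ^ m * ?\<psi> n x)" for m n
    by (induction m) (auto simp: gauss_bd_hpsi mult.assoc intro!: gauss_bd_x)
  have i: "integrable lborel (\<lambda>x. f x * (of_real x ^ m * ?\<psi> n x))" for m n
    by (rule fi[OF b]) measurable
  \<comment> \<open>Multiplication by x sends index n to n + 1 and n - 1, so the induction on the
    power has to treat all n at once.\<close>
  have z: "(LINT x|lborel. f x * (of_real x ^ m * ?\<psi> n x)) = 0" for m n
  proof (induction m arbitrary: n)
    case 0
    have "(LINT x|lborel. f x * ?\<psi> n x) = (LINT x|lborel. of_real (hnorm n) * (f x * of_real (hermite_fun n x)))"
      using hnorm_pos[of n] by (intro Bochner_Integration.integral_cong refl) (simp add: hermite_fun_eq_hpsi)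
    then show ?case using c[of n] by (simp add: hermite_coeff_def)
  next
    case (Suc m)
    have "x * hpsi n x = hpsi (Suc n) x / 2 + real n * hpsi (n - 1) x" for x
      by (simp add: hpsi_Suc field_simps)
    from arg_cong[OF this, of complex_of_real]
    have E: "of_real x * ?\<psi> n x = ?\<psi> (Suc n) x / 2 + of_nat n * ?\<psi> (n - 1) x" for x
      by simp
    have "f x * (of_real x ^ Suc m * ?\<psi> n x) =
        f x * (of_real x ^ m * ?\<psi> (Suc n) x) / 2 + of_nat n * (f x * (of_real x ^ m * ?\<psi> (n - 1) x))" for x
    proof -
      have "f x * (of_real x ^ Suc m * ?\<psi> n x) = f x * of_real x ^ m * (of_real x * ?\<psi> n x)"
        by (simp add: mult_ac)
      then show ?thesis unfolding E by (simp add: algebra_simps)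
    qed
    then have "(LINT x|lborel. f x * (of_real x ^ Suc m * ?\<psi> n x)) =
        (LINT x|lborel. f x * (of_real x ^ m * ?\<psi> (Suc n) x) / 2 + of_nat n * (f x * (of_real x ^ m * ?\<psi> (n - 1) x)))"
      by simp
    also have "\<dots> = 0" using i Suc.IH by simp
    finally show ?case .
  qed
  define g where "g x = f x * ?\<psi> 0 x" for x
  have gm[measurable]: "g \<in> borel_measurable borel" unfolding g_def by measurable
  have gi: "integrable lborel (\<lambda>x. cmod (g x) * exp (A * \<bar>x\<bar>))" for A
  proof -
    have "integrable lborel (\<lambda>x. cmod (f x * (of_real (exp (A * \<bar>x\<bar>)) * ?\<psi> 0 x)))"
      by (intro integrable_norm fi gauss_bd_mult_exp[where M=1 and A=A] gauss_bd_hpsi) (auto intro!: measurable_compose[OF _ borel_measurable_of_real])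
    then show ?thesis by (simp add: g_def norm_mult mult_ac)
  qed
  have "(LINT x|lborel. cis (u * x) * g x) = 0" for u
  proof -
    have "(LINT x|lborel. of_real x ^ n * g x) = 0" for n
      using z[of n 0] by (simp add: g_def mult_ac)
    then show ?thesis
      using fourier_integral_moment_series[OF gm gi, of u] sums_unique2[OF sums_zero] by simp
  qed
  moreover have "integrable lborel g"
    using gi[of 0] by (simp add: integrable_norm_iff)
  ultimately have "AE x in lborel. g x = 0" by (intro fourier_unique)
  then show ?thesis by eventually_elim (simp add: g_def hpsi_0)
qed

subsection \<open>Hermite expansions\<close>

text \<open>Arbitrary index sets make the difference of two partial sums again such a sum.\<close>

definition hermite_sum :: "(nat \<Rightarrow> complex) \<Rightarrow> nat set \<Rightarrow> real \<Rightarrow> complex" where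
  "hermite_sum d A x = (\<Sum>n\<in>A. d n * of_real (hermite_fun n x))"

lemma hermite_sum_L2: "hermite_sum d A \<in> L2"
  unfolding hermite_sum_def[abs_def] by (intro L2_sum L2_scale hermite_L2)

lemma hermite_coeff_diff:
  assumes "hermite_testable f" "hermite_testable g"
  shows "hermite_coeff (\<lambda>x. f x - g x) n = hermite_coeff f n - hermite_coeff g n"
proof -
  have "integrable lborel (\<lambda>x. h x * of_real (hermite_fun n x))" if "hermite_testable h" for h
    using that gauss_bd_hermite unfolding hermite_testable_def by (auto intro!: measurable_compose[OF _ borel_measurable_of_real])
  with assms show ?thesis by (simp add: hermite_coeff_def left_diff_distrib)
qed

lemma hermite_coeff_scale: "hermite_coeff (\<lambda>x. c * f x) n = c * hermite_coeff f n"
  by (simp add: hermite_coeff_def mult.assoc)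

lemma hermite_coeff_cnj: "hermite_coeff (\<lambda>x. cnj (f x)) n = cnj (hermite_coeff f n)"
proof -
  have "hermite_coeff (\<lambda>x. cnj (f x)) n = (LINT x|lborel. cnj (f x * of_real (hermite_fun n x)))"
    by (simp add: hermite_coeff_def)
  also have "\<dots> = cnj (hermite_coeff f n)"
    unfolding hermite_coeff_def by (rule Bochner_Integration.integral_cnj)
  finally show ?thesis .
qed

lemma L2_cnj:
  assumes f: "f \<in> L2" shows "(\<lambda>x. cnj (f x)) \<in> L2"
proof (rule L2_I)
  show "(\<lambda>x. cnj (f x)) \<in> borel_measurable borel"
    using borel_measurable_continuous_onI[of cnj]
    by (intro measurable_compose[OF L2_measurable[OF f]]) (auto intro: continuous_intros)
qed (use L2_integrable_sq[OF f] in simp)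

text \<open>Pairings are kept bilinear since the Hermite functions are real; norms enter by pairing
  with the conjugate.\<close>

lemma L2_sq_eq_pairing: "of_real (L2_sq f) = (LINT x|lborel. f x * cnj (f x))"
  unfolding complex_norm_square[symmetric] by (rule integral_complex_of_real[symmetric])

lemma hermite_sum_pairing:
  assumes f: "f \<in> L2"
  shows "(LINT x|lborel. hermite_sum d A x * f x) = (\<Sum>n\<in>A. d n * hermite_coeff f n)"
proof -
  have "integrable lborel (\<lambda>x. d n * (f x * of_real (hermite_fun n x)))" for n
    using L2_mult_integrable[OF f hermite_L2] by simp
  then have "(LINT x|lborel. (\<Sum>n\<in>A. d n * (f x * of_real (hermite_fun n x)))) = (\<Sum>n\<in>A. d n * hermite_coeff f n)"
    by (subst Bochner_Integration.integral_sum) (auto simp: hermite_coeff_def)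
  moreover have "hermite_sum d A x * f x = (\<Sum>n\<in>A. d n * (f x * of_real (hermite_fun n x)))" for x
    unfolding hermite_sum_def sum_distrib_right by (intro sum.cong refl) (simp add: mult_ac)
  ultimately show ?thesis by simp
qed

lemma hermite_coeff_sum:
  assumes "finite A"
  shows "hermite_coeff (hermite_sum d A) n = (if n \<in> A then d n else 0)"
proof -
  have "hermite_coeff (hermite_sum d A) n = (\<Sum>k\<in>A. d k * hermite_coeff (\<lambda>x. of_real (hermite_fun n x)) k)"
    unfolding hermite_coeff_def[of "hermite_sum d A"] by (rule hermite_sum_pairing[OF hermite_L2])
  also have "\<dots> = (\<Sum>k\<in>A. if k = n then d k else 0)"
    by (intro sum.cong refl) (simp add: hermite_coeff_def hermite_orthonormal)
  also have "\<dots> = (if n \<in> A then d n else 0)" using assms by simp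
  finally show ?thesis .
qed

lemma L2_sq_hermite_sum:
  assumes A: "finite A"
  shows "L2_sq (hermite_sum d A) = (\<Sum>n\<in>A. (cmod (d n))\<^sup>2)"
proof -
  have "complex_of_real (L2_sq (hermite_sum d A)) = (\<Sum>n\<in>A. d n * cnj (hermite_coeff (hermite_sum d A) n))"
    unfolding L2_sq_eq_pairing
    by (subst hermite_sum_pairing) (auto intro: L2_cnj hermite_sum_L2 simp: hermite_coeff_cnj)
  also have "\<dots> = of_real (\<Sum>n\<in>A. (cmod (d n))\<^sup>2)"
    by (simp add: hermite_coeff_sum[OF A] complex_norm_square[symmetric] flip: of_real_power)
  finally show ?thesis by (simp only: of_real_eq_iff)
qed

text \<open>The squared distance from \<open>f\<close> to its partial Hermite sum is exactly the
  defect in this inequality.\<close>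

lemma hermite_bessel:
  assumes f: "f \<in> L2"
  shows "(\<Sum>n<N. (cmod (hermite_coeff f n))\<^sup>2) \<le> L2_sq f"
proof -
  define S where "S = hermite_sum (hermite_coeff f) {..<N}"
  define s where "s = (\<Sum>n<N. (cmod (hermite_coeff f n))\<^sup>2)"
  have S: "S \<in> L2" by (simp add: S_def hermite_sum_L2)
  have 1: "(LINT x|lborel. S x * cnj (f x)) = of_real s"
    unfolding S_def s_def
    by (subst hermite_sum_pairing) (auto intro: L2_cnj f simp: hermite_coeff_cnj complex_norm_square[symmetric])
  have "(LINT x|lborel. f x * cnj (S x)) = (LINT x|lborel. cnj (S x * cnj (f x)))"
    by (simp add: mult.commute)
  also have "\<dots> = of_real s" unfolding Bochner_Integration.integral_cnj 1 by simp
  finally have 2: "(LINT x|lborel. f x * cnj (S x)) = of_real s" .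
  have 3: "(LINT x|lborel. S x * cnj (S x)) = of_real s"
    unfolding L2_sq_eq_pairing[symmetric] by (simp add: S_def s_def L2_sq_hermite_sum)
  note i = L2_mult_integrable[OF f L2_cnj[OF f]] L2_mult_integrable[OF f L2_cnj[OF S]]
    L2_mult_integrable[OF S L2_cnj[OF f]] L2_mult_integrable[OF S L2_cnj[OF S]]
  have "complex_of_real (L2_sq (\<lambda>x. f x - S x)) =
      (LINT x|lborel. (f x * cnj (f x) - f x * cnj (S x)) - (S x * cnj (f x) - S x * cnj (S x)))"
    unfolding L2_sq_eq_pairing by (simp add: algebra_simps)
  also have "\<dots> = of_real (L2_sq f - s)"
    using i by (simp add: 1 2 3 L2_sq_eq_pairing[symmetric])
  finally have "L2_sq (\<lambda>x. f x - S x) = L2_sq f - s"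
    by (simp only: of_real_eq_iff)
  with L2_sq_nonneg[of "\<lambda>x. f x - S x"] show ?thesis unfolding s_def by linarith
qed

lemma summable_hermite_coeff:
  assumes f: "f \<in> L2"
  shows "summable (\<lambda>n. (cmod (hermite_coeff f n))\<^sup>2)"
  by (rule bounded_imp_summable[where B="L2_sq f"])
     (use hermite_bessel[OF f, of "Suc _"] in \<open>simp_all add: lessThan_Suc_atMost\<close>)

lemma hermite_series_limit_ex:
  assumes s: "summable (\<lambda>n. (cmod (d n))\<^sup>2)"
  shows "\<exists>g. L2_limit (\<lambda>N. hermite_sum d {..<N}) g"
proof (rule L2_complete)
  fix e :: real assume "e > 0"
  then obtain M where M: "\<And>m n. m \<ge> M \<Longrightarrow> norm (\<Sum>k\<in>{m..<n}. (cmod (d k))\<^sup>2) < e"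
    using s unfolding summable_Cauchy by blast
  have le: "L2_sq (\<lambda>x. hermite_sum d {..<n} x - hermite_sum d {..<m} x) \<le> e" if "m \<ge> M" "m \<le> n" for m n
  proof -
    have "hermite_sum d {..<n} x - hermite_sum d {..<m} x = hermite_sum d {m..<n} x" for x
      using sum_diff_nat_ivl[of 0 m n "\<lambda>k. d k * of_real (hermite_fun k x)"] that
      by (simp add: hermite_sum_def lessThan_atLeast0)
    then show ?thesis using M[OF that(1), of n] by (simp add: L2_sq_hermite_sum)
  qed
  show "\<exists>M. \<forall>m\<ge>M. \<forall>n\<ge>M. L2_sq (\<lambda>x. hermite_sum d {..<m} x - hermite_sum d {..<n} x) \<le> e"
  proof (intro exI[of _ M] allI impI)
    fix m n assume "m \<ge> M" "n \<ge> M"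
    then show "L2_sq (\<lambda>x. hermite_sum d {..<m} x - hermite_sum d {..<n} x) \<le> e"
      using le[of m n] le[of n m] by (cases "m \<le> n") (auto simp: norm_minus_commute)
  qed
qed (rule hermite_sum_L2)

lemma hermite_coeff_limit:
  assumes "L2_limit F g"
  shows "(\<lambda>N. hermite_coeff (F N) n) \<longlonglongrightarrow> hermite_coeff g n"
  unfolding hermite_coeff_def
  by (rule L2_pairing_tendsto) (use assms in \<open>auto simp: L2_limit_def hermite_L2\<close>)

lemma hermite_series_limit:
  assumes L: "L2_limit (\<lambda>N. hermite_sum d {..<N}) g"
  shows "hermite_coeff g n = d n"
proof -
  have "\<forall>\<^sub>F N in sequentially. hermite_coeff (hermite_sum d {..<N}) n = d n"
    using eventually_gt_at_top[of n] by eventually_elim (simp add: hermite_coeff_sum)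
  then have "(\<lambda>N. hermite_coeff (hermite_sum d {..<N}) n) \<longlonglongrightarrow> d n"
    by (rule tendsto_eventually)
  with hermite_coeff_limit[OF L] show ?thesis by (rule LIMSEQ_unique)
qed

text \<open>The tool behind the operator identities below. Since testability is enough, a bounded
  classical Fourier transform can be compared with an L2 function before it is known to lie in
  L2.\<close>

lemma hermite_testable_eqI:
  assumes "hermite_testable f" "hermite_testable g" "\<And>n. hermite_coeff f n = hermite_coeff g n"
  shows "AE x in lborel. f x = g x"
  using hermite_complete[OF hermite_testable_diff[OF assms(1,2)]] assms
  by (simp add: hermite_coeff_diff)

lemma L2_eqI:
  "f \<in> L2 \<Longrightarrow> g \<in> L2 \<Longrightarrow> (\<And>n. hermite_coeff f n = hermite_coeff g n) \<Longrightarrow> AE x in lborel. f x = g x"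
  by (intro hermite_testable_eqI hermite_testable_L2)

lemma integral_mult_cong_AE:
  fixes f g :: "real \<Rightarrow> complex"
  assumes f: "f \<in> L2" "f' \<in> L2" "AE x in lborel. f x = f' x" and g: "g \<in> L2"
  shows "(LINT x|lborel. f x * g x) = (LINT x|lborel. f' x * g x)"
proof (rule integral_cong_AE)
  note [measurable] = L2_measurable[OF f(1)] L2_measurable[OF f(2)] L2_measurable[OF g]
  show "(\<lambda>x. f x * g x) \<in> borel_measurable lborel" "(\<lambda>x. f' x * g x) \<in> borel_measurable lborel"
    by measurable
  show "AE x in lborel. f x * g x = f' x * g x"
    using f(3) by eventually_elim simp
qed

lemma hermite_coeff_cong_AE:
  "f \<in> L2 \<Longrightarrow> g \<in> L2 \<Longrightarrow> AE x in lborel. f x = g x \<Longrightarrow> hermite_coeff f n = hermite_coeff g n"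
  unfolding hermite_coeff_def by (intro integral_mult_cong_AE hermite_L2)

text \<open>Bessel's inequality gives the Hermite series some L2 limit, completeness identifies it
  with \<open>f\<close>, and the pairing is continuous.\<close>

lemma hermite_parseval:
  assumes f: "f \<in> L2" and g: "g \<in> L2"
  shows "(\<lambda>n. hermite_coeff f n * hermite_coeff g n) sums (LINT x|lborel. f x * g x)"
proof -
  obtain h where h: "L2_limit (\<lambda>N. hermite_sum (hermite_coeff f) {..<N}) h"
    using hermite_series_limit_ex[OF summable_hermite_coeff[OF f]] by blast
  then have hL: "h \<in> L2" by (simp add: L2_limit_def)
  have "AE x in lborel. h x = f x"
    by (rule L2_eqI[OF hL f]) (rule hermite_series_limit[OF h])
  then have "(LINT x|lborel. h x * g x) = (LINT x|lborel. f x * g x)"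
    by (intro integral_mult_cong_AE hL f g)
  moreover have "(\<lambda>N. LINT x|lborel. hermite_sum (hermite_coeff f) {..<N} x * g x) \<longlonglongrightarrow> (LINT x|lborel. h x * g x)"
    by (rule L2_pairing_tendsto[OF _ hL g]) (use h in \<open>auto simp: L2_limit_def\<close>)
  ultimately show ?thesis
    by (simp add: hermite_sum_pairing[OF g] sums_def)
qed

lemma hermite_parseval_sq:
  assumes f: "f \<in> L2"
  shows "(\<lambda>n. (cmod (hermite_coeff f n))\<^sup>2) sums L2_sq f"
proof -
  have "(\<lambda>n. hermite_coeff f n * cnj (hermite_coeff f n)) sums of_real (L2_sq f)"
    using hermite_parseval[OF f L2_cnj[OF f]] by (simp add: L2_sq_eq_pairing hermite_coeff_cnj)
  then have "(\<lambda>n. complex_of_real ((cmod (hermite_coeff f n))\<^sup>2)) sums of_real (L2_sq f)"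
    by (simp only: complex_norm_square)
  then show ?thesis by (simp only: sums_of_real_iff)
qed

text \<open>By Parseval the distances to the two limits agree. If \<open>F\<close> and
  \<open>g\<close> arise from \<open>G\<close> and \<open>f\<close> by a unimodular multiplier on
  coefficients, convergence is carried over.\<close>

lemma L2_limit_by_coeff:
  assumes F: "\<And>N. F N \<in> L2" and g: "g \<in> L2" and f: "\<And>N. G N \<in> L2" "f \<in> L2"
    and c: "\<And>N n. cmod (hermite_coeff (F N) n - hermite_coeff g n) = cmod (hermite_coeff (G N) n - hermite_coeff f n)"
    and L: "L2_limit G f"
  shows "L2_limit F g"
proof -
  have "L2_sq (\<lambda>x. F N x - g x) = L2_sq (\<lambda>x. G N x - f x)" for N
  proof -
    have "(\<lambda>n. (cmod (hermite_coeff (F N) n - hermite_coeff g n))\<^sup>2) sums L2_sq (\<lambda>x. F N x - g x)"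
      using hermite_parseval_sq[OF L2_diff[OF F[of N] g]]
      by (simp add: hermite_coeff_diff hermite_testable_L2 F g)
    moreover have "(\<lambda>n. (cmod (hermite_coeff (G N) n - hermite_coeff f n))\<^sup>2) sums L2_sq (\<lambda>x. G N x - f x)"
      using hermite_parseval_sq[OF L2_diff[OF f(1)[of N] f(2)]]
      by (simp add: hermite_coeff_diff hermite_testable_L2 f)
    ultimately show ?thesis unfolding c by (rule sums_unique2)
  qed
  with L show ?thesis by (simp add: L2_limit_def F g)
qed

text \<open>Unimodular multipliers preserve square summability, so the limit selected in the
  definition exists and its coefficients can be read off.\<close>

lemma harmonic_schroedinger_L2_coeff:
  assumes f: "f \<in> L2"
  shows harmonic_schroedinger_L2: "harmonic_schroedinger t f \<in> L2"
    and hermite_coeff_harmonic_schroedinger: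
      "hermite_coeff (harmonic_schroedinger t f) n = cis (t * (2 * real n + 1)) * hermite_coeff f n"
proof -
  let ?d = "\<lambda>n. cis (t * (2 * real n + 1)) * hermite_coeff f n"
  have "summable (\<lambda>n. (cmod (?d n))\<^sup>2)"
    using summable_hermite_coeff[OF f] by (simp add: norm_mult)
  then obtain g where "L2_limit (\<lambda>N. hermite_sum ?d {..<N}) g"
    using hermite_series_limit_ex[of ?d] by blast
  then have "L2_limit (\<lambda>N. hermite_sum ?d {..<N}) (L2_lim (\<lambda>N. hermite_sum ?d {..<N}))"
    by (rule L2_limit_L2_lim)
  then have L: "L2_limit (\<lambda>N. hermite_sum ?d {..<N}) (harmonic_schroedinger t f)"
    unfolding harmonic_schroedinger_def hermite_sum_def .
  show "harmonic_schroedinger t f \<in> L2" using L by (simp add: L2_limit_def)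
  show "hermite_coeff (harmonic_schroedinger t f) n = ?d n"
    using hermite_series_limit[OF L] .
qed

subsection \<open>Gaussian Fourier integrals of Hermite functions\<close>

text \<open>The kernel \<open>K y = cis (u * y) * cis (a * y\<^sup>2)\<close> is differentiated in \<open>y\<close> only, so that all
  identities come from integration by parts.\<close>

lemma cis_has_vector_derivative:
  assumes "(f has_real_derivative d) (at x)"
  shows "((\<lambda>x. cis (f x)) has_vector_derivative (\<i> * of_real d * cis (f x))) (at x)"
proof -
  have "((\<lambda>x. \<i> * of_real (f x)) has_vector_derivative \<i> * of_real d) (at x)"
    by (intro has_vector_derivative_mult_right has_vector_derivative_of_real assms)
  from field_vector_diff_chain_at[OF this DERIV_exp]
  show ?thesis by (simp add: cis_conv_exp o_def)
qed

lemma cis_measurable [measurable (raw)]: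
  "f \<in> borel_measurable M \<Longrightarrow> (\<lambda>x. cis (f x)) \<in> borel_measurable M"
  unfolding cis_conv_exp by measurable

lemma chirp_hpsi_deriv:
  "((\<lambda>y. cis (u * y) * (cis (a * y\<^sup>2) * of_real (hpsi n y))) has_vector_derivative
     cis (u * y) * (cis (a * y\<^sup>2) *
       ((\<i> * of_real u) * of_real (hpsi n y) + (1 + 2 * \<i> * of_real a) * (of_real y * of_real (hpsi n y)) - of_real (hpsi (Suc n) y)))) (at y)"
proof -
  have 1: "((\<lambda>y. cis (u * y)) has_vector_derivative \<i> * of_real u * cis (u * y)) (at y)"
    by (rule cis_has_vector_derivative) (auto intro!: derivative_eq_intros)
  have 2: "((\<lambda>y. cis (a * y\<^sup>2)) has_vector_derivative \<i> * of_real (2 * a * y) * cis (a * y\<^sup>2)) (at y)"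
    by (rule cis_has_vector_derivative) (auto intro!: derivative_eq_intros)
  have 3: "((\<lambda>y. complex_of_real (hpsi n y)) has_vector_derivative of_real (y * hpsi n y - hpsi (Suc n) y)) (at y)"
    using hpsi_deriv by (intro has_vector_derivative_of_real) (simp add: has_real_derivative_iff_has_vector_derivative)
  show ?thesis
    by (rule has_vector_derivative_eq_rhs[OF has_vector_derivative_mult[OF 1 has_vector_derivative_mult[OF 2 3]]])
       (simp add: algebra_simps)
qed

lemma gauss_bd_chirp_hpsi:
  "gauss_bd (\<lambda>y. cis (u y) * (cis (v y) * of_real (hpsi n y)))"
  by (intro gauss_bd_cis gauss_bd_hpsi)

lemma chirp_hpsi_integrable:
  "integrable lborel (\<lambda>y. cis (u * y) * (cis (a * y\<^sup>2) * of_real (hpsi n y)))"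
  by (rule gauss_bd_integrable[OF gauss_bd_chirp_hpsi]) measurable

text \<open>The Mehler kernel applied to a Hermite function, up to its outer chirp, a dilation of
  the argument and constants.\<close>

definition chirp_hpsi_integral :: "real \<Rightarrow> nat \<Rightarrow> real \<Rightarrow> complex" where
  "chirp_hpsi_integral a n u = (LINT y|lborel. cis (u * y) * (cis (a * y\<^sup>2) * of_real (hpsi n y)))"

text \<open>The y-derivative of the integrand at index n integrates to 0. Expressing y times
  \<open>hpsi n y\<close> through its two neighbours leaves a three-term recurrence; the coefficient
  1/2 - i a is 1 - (1 + 2 i a) / 2.\<close>

lemma chirp_hpsi_integral_Suc:
  "(1 / 2 - \<i> * of_real a) * chirp_hpsi_integral a (Suc n) u =
   \<i> * of_real u * chirp_hpsi_integral a n u +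
   (1 + 2 * \<i> * of_real a) * of_nat n * chirp_hpsi_integral a (n - 1) u"
proof -
  let ?K = "\<lambda>n y. cis (u * y) * (cis (a * y\<^sup>2) * complex_of_real (hpsi n y))"
  define f where "f y = cis (u * y) * (cis (a * y\<^sup>2) *
       ((\<i> * of_real u) * of_real (hpsi n y) + (1 + 2 * \<i> * of_real a) * (of_real y * of_real (hpsi n y)) - of_real (hpsi (Suc n) y)))" for y
  have feq: "f y = \<i> * of_real u * ?K n y + (1 + 2 * \<i> * of_real a) * of_nat n * ?K (n - 1) y
      - (1 / 2 - \<i> * of_real a) * ?K (Suc n) y" for y
  proof -
    have "y * hpsi n y = hpsi (Suc n) y / 2 + real n * hpsi (n - 1) y"
      by (simp add: hpsi_Suc field_simps)
    from arg_cong[OF this, of complex_of_real]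
    have E: "of_real y * complex_of_real (hpsi n y) = of_real (hpsi (Suc n) y) / 2 + of_nat n * of_real (hpsi (n - 1) y)"
      by simp
    show ?thesis unfolding f_def E by (simp add: algebra_simps)
  qed
  have "(LINT y|lborel. f y) = 0"
  proof (rule gauss_bd_integral_deriv)
    show "(?K n has_vector_derivative f y) (at y)" for y
      unfolding f_def by (rule chirp_hpsi_deriv)
    show "isCont f y" for y
      unfolding f_def cis_conv_exp by (intro continuous_intros isCont_hpsi)
    show "gauss_bd f"
      unfolding feq[abs_def] by (intro gauss_bd_diff gauss_bd_add gauss_bd_cmult gauss_bd_chirp_hpsi)
  qed (rule gauss_bd_chirp_hpsi)
  moreover have "(LINT y|lborel. f y) = \<i> * of_real u * chirp_hpsi_integral a n u +
      (1 + 2 * \<i> * of_real a) * of_nat n * chirp_hpsi_integral a (n - 1) u -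
      (1 / 2 - \<i> * of_real a) * chirp_hpsi_integral a (Suc n) u"
    unfolding feq chirp_hpsi_integral_def
    by (subst Bochner_Integration.integral_diff Bochner_Integration.integral_add |
        (intro Bochner_Integration.integrable_add integrable_mult_right chirp_hpsi_integrable) | simp only: integral_mult_right_zero)+
  ultimately show ?thesis by simp
qed

section \<open>Moments of the chirped Gaussian\<close>

definition chirp_moment :: "real \<Rightarrow> nat \<Rightarrow> complex" where
  "chirp_moment a k = (LINT y|lborel. of_real y ^ k * (cis (a * y\<^sup>2) * of_real (hpsi 0 y)))"

lemma gauss_bd_chirp_power: "gauss_bd (\<lambda>y. of_real y ^ k * (cis (a * y\<^sup>2) * of_real (hpsi 0 y)))"
proof (induction k)
  case 0
  then show ?case by (simp add: gauss_bd_cis gauss_bd_hpsi)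
next
  case (Suc k)
  from gauss_bd_x[OF this] show ?case by (simp add: mult.assoc)
qed

text \<open>Integrates the derivative of y^k exp ((i a - 1/2) y^2). At k = 0 the left side is 0 by
  its factor, which starts the vanishing of the odd moments.\<close>

lemma chirp_moment_rec:
  "of_nat k * chirp_moment a (k - 1) = (1 - 2 * \<i> * of_real a) * chirp_moment a (Suc k)"
proof -
  let ?E = "\<lambda>k y. complex_of_real y ^ k * (cis (a * y\<^sup>2) * of_real (hpsi 0 y))"
  define f where "f y = of_nat k * ?E (k - 1) y - (1 - 2 * \<i> * of_real a) * ?E (Suc k) y" for y
  have int: "integrable lborel (?E j)" for j
    by (rule gauss_bd_integrable[OF gauss_bd_chirp_power]) measurable
  have "(LINT y|lborel. f y) = 0"
  proof (rule gauss_bd_integral_deriv)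
    show "(?E k has_vector_derivative f y) (at y)" for y
    proof -
      have 1: "((\<lambda>y. complex_of_real y ^ k) has_vector_derivative of_real (real k * y ^ (k - 1))) (at y)"
        unfolding of_real_power[symmetric]
        by (rule has_vector_derivative_of_real)
           (auto intro!: derivative_eq_intros simp flip: has_real_derivative_iff_has_vector_derivative)
      show ?thesis unfolding f_def
        by (rule has_vector_derivative_eq_rhs[OF has_vector_derivative_mult[OF 1 chirp_hpsi_deriv[of 0 a 0, simplified]]])
           (simp add: algebra_simps hpsi_Suc)
    qed
    show "isCont f y" for y
      unfolding f_def cis_conv_exp by (intro continuous_intros isCont_hpsi)
    show "gauss_bd f"
      unfolding f_def by (intro gauss_bd_diff gauss_bd_add gauss_bd_cmult gauss_bd_chirp_power)
  qed (rule gauss_bd_chirp_power)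
  moreover have "(LINT y|lborel. f y) = of_nat k * chirp_moment a (k - 1) - (1 - 2 * \<i> * of_real a) * chirp_moment a (Suc k)"
    unfolding f_def chirp_moment_def
    by (subst Bochner_Integration.integral_diff | (intro integrable_mult_right int) | simp only: integral_mult_right_zero)+
  ultimately show ?thesis by simp
qed

lemma chirp_moment_odd: "chirp_moment a (Suc (2 * k)) = 0"
proof (induction k)
  case 0
  have "1 - 2 * \<i> * of_real a \<noteq> 0" by (simp add: complex_eq_iff)
  then show ?case using chirp_moment_rec[of 0 a] by simp
next
  case (Suc k)
  have "1 - 2 * \<i> * of_real a \<noteq> 0" by (simp add: complex_eq_iff)
  then show ?case using chirp_moment_rec[of "2 * Suc k" a] Suc by simp
qed

text \<open>The quotient is (2k - 1)!! / (1 - 2 i a)^k, written with factorials so that (2k)!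
  cancels in the exponential series.\<close>

lemma chirp_moment_even:
  "chirp_moment a (2 * k) = fact (2 * k) / (fact k * (2 * (1 - 2 * \<i> * of_real a)) ^ k) * chirp_moment a 0"
proof (induction k)
  case (Suc k)
  define q where "q = 1 - 2 * \<i> * of_real a"
  have q: "q \<noteq> 0" by (simp add: complex_eq_iff q_def)
  have "q * chirp_moment a (2 * Suc k) = of_nat (Suc (2 * k)) * chirp_moment a (2 * k)"
    using chirp_moment_rec[of "Suc (2 * k)" a] by (simp add: q_def)
  then have 1: "chirp_moment a (2 * Suc k) = of_nat (Suc (2 * k)) / q * chirp_moment a (2 * k)"
    using q by (simp add: field_simps)
  have "fact (2 * Suc k) = of_nat (2 * Suc k) * (of_nat (Suc (2 * k)) * fact (2 * k) :: complex)"
    by (simp add: algebra_simps)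
  then have "fact (2 * Suc k) / (fact (Suc k) * (2 * q) ^ Suc k) =
      of_nat (Suc (2 * k)) / q * (fact (2 * k) / (fact k * (2 * q) ^ k))"
    using q by (simp add: field_simps del: fact_Suc of_nat_Suc) (simp add: field_simps)
  then show ?case unfolding 1 Suc.IH q_def[symmetric] by simp
qed simp

text \<open>Summing the moment series yields the Gaussian in u directly, with neither a contour
  shift nor a complex square root. The value at u = 0 stays symbolic as
  \<open>chirp_moment a 0\<close>.\<close>

lemma chirp_hpsi_integral_0:
  "chirp_hpsi_integral a 0 u = chirp_moment a 0 * exp (- (of_real u)\<^sup>2 / (2 * (1 - 2 * \<i> * of_real a)))"
proof -
  define q where "q = 1 - 2 * \<i> * of_real a"
  have q: "q \<noteq> 0" by (simp add: complex_eq_iff q_def)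
  have R: "z /\<^sub>R fact k = z / fact k" for z :: complex and k
    by (simp add: scaleR_conv_of_real field_simps)
  have F: "X / F * (F / (G * Q) * M) = M * (X / Q / G)" if "F \<noteq> 0" for X F G Q M :: complex
    using that by (simp add: field_simps)
  define t where "t n = (\<i> * of_real u) ^ n /\<^sub>R fact n * chirp_moment a n" for n
  let ?E = "\<lambda>y. cis (a * y\<^sup>2) * of_real (hpsi 0 y)"
  have "(\<lambda>n. (\<i> * of_real u) ^ n /\<^sub>R fact n * (LINT x|lborel. of_real x ^ n * ?E x)) sums
      (LINT x|lborel. cis (u * x) * ?E x)"
  proof (rule fourier_integral_moment_series)
    show "integrable lborel (\<lambda>x. cmod (?E x) * exp (A * \<bar>x\<bar>))" for A
    proof -
      have "gauss_bd (\<lambda>x. of_real (exp (A * \<bar>x\<bar>)) * ?E x)"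
        by (rule gauss_bd_mult_exp[where M=1 and A=A]) (auto intro: gauss_bd_cis gauss_bd_hpsi)
      then have "integrable lborel (\<lambda>x. cmod (of_real (exp (A * \<bar>x\<bar>)) * ?E x))"
        by (intro integrable_norm gauss_bd_integrable) measurable
      then show ?thesis by (simp add: norm_mult mult_ac)
    qed
  qed measurable
  then have "t sums chirp_hpsi_integral a 0 u"
    unfolding t_def chirp_moment_def chirp_hpsi_integral_def .
  \<comment> \<open>Odd moments vanish, so it suffices to follow partial sums of even length, which
    regroup into a series over k.\<close>
  then have "(\<lambda>N. \<Sum>n<2*N. t n) \<longlonglongrightarrow> chirp_hpsi_integral a 0 u"
    unfolding sums_def by (rule filterlim_compose) (simp add: filterlim_subseq strict_mono_def)
  moreover have "(\<Sum>n<2*N. t n) = (\<Sum>k<N. t (2 * k))" for N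
    by (induction N) (auto simp: t_def chirp_moment_odd)
  moreover have "t (2 * k) = chirp_moment a 0 * ((- (of_real u)\<^sup>2 / (2 * q)) ^ k /\<^sub>R fact k)" for k
  proof -
    have "(\<i> * of_real u) ^ (2 * k) = (- (complex_of_real u)\<^sup>2) ^ k"
      by (simp add: power_mult power_mult_distrib)
    then have "t (2 * k) = (- (complex_of_real u)\<^sup>2) ^ k / fact (2 * k) * (fact (2 * k) / (fact k * (2 * q) ^ k) * chirp_moment a 0)"
      unfolding t_def chirp_moment_even q_def R by simp
    also have "\<dots> = chirp_moment a 0 * ((- (of_real u)\<^sup>2 / (2 * q)) ^ k / fact k)"
      unfolding power_divide by (rule F) simp
    finally show ?thesis unfolding R .
  qed
  ultimately have "(\<lambda>N. \<Sum>k<N. chirp_moment a 0 * ((- (of_real u)\<^sup>2 / (2 * q)) ^ k /\<^sub>R fact k)) \<longlonglongrightarrow> chirp_hpsi_integral a 0 u"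
    by simp
  moreover have "(\<lambda>k. chirp_moment a 0 * ((- (of_real u)\<^sup>2 / (2 * q)) ^ k /\<^sub>R fact k)) sums
      (chirp_moment a 0 * exp (- (of_real u)\<^sup>2 / (2 * q)))"
    by (intro sums_mult exp_converges)
  ultimately show ?thesis
    unfolding sums_def q_def using LIMSEQ_unique by blast
qed

text \<open>Mehler's formula, read as an eigenvalue identity for the kernel.\<close>

lemma chirp_hpsi_integral_eq:
  fixes a s :: real
  assumes s: "s\<^sup>2 * (1 + 4 * a\<^sup>2) = 1"
  shows "chirp_hpsi_integral a n u =
    chirp_moment a 0 * (\<i> * of_real s * (1 + 2 * \<i> * of_real a)) ^ n * (cis (- a * (s * u)\<^sup>2) * of_real (hpsi n (s * u)))"
proof -
  define p where "p = 1 / 2 - \<i> * of_real a"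
  define z where "z = 1 + 2 * \<i> * of_real a"
  define w where "w = \<i> * of_real s * z"
  have p: "p \<noteq> 0" by (simp add: complex_eq_iff p_def)
  have "2 * p * z = of_real (1 + 4 * a\<^sup>2)"
    by (simp add: p_def z_def algebra_simps power2_eq_square)
  then have "(of_real s)\<^sup>2 * (2 * p * z) = of_real (s\<^sup>2 * (1 + 4 * a\<^sup>2))" by simp
  then have pz: "(of_real s)\<^sup>2 * (2 * p * z) = 1" using s by simp
  \<comment> \<open>\<open>R1\<close> and \<open>R2\<close> turn the recurrence of
    \<open>chirp_hpsi_integral\<close> into that of \<open>hpsi\<close> at s u, each step of the
    index contributing a factor \<open>w\<close>. Both restate the assumption on s in the form
    \<open>pz\<close>.\<close>
  have R1: "2 * p * w * of_real s = \<i>"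
  proof -
    have "2 * p * w * of_real s = \<i> * ((of_real s)\<^sup>2 * (2 * p * z))"
      by (simp add: w_def power2_eq_square mult_ac)
    then show ?thesis by (simp add: pz)
  qed
  have R2: "- (2 * p * w\<^sup>2) = z"
  proof -
    have "- (2 * p * w\<^sup>2) = z * ((of_real s)\<^sup>2 * (2 * p * z))"
      by (simp add: w_def power_mult_distrib) (simp add: power2_eq_square mult_ac)
    then show ?thesis by (simp add: pz)
  qed
  define e where "e = chirp_moment a 0 * cis (- a * (s * u)\<^sup>2)"
  let ?\<psi> = "\<lambda>n. complex_of_real (hpsi n (s * u))"
  have "chirp_hpsi_integral a n u = e * w ^ n * ?\<psi> n"
  proof (induction n rule: less_induct)
    case (less n)
    show ?case
    proof (cases n)
      case 0
      have "1 - 2 * \<i> * of_real a = 2 * p" by (simp add: p_def)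
      moreover have "- (of_real u)\<^sup>2 / (2 * (2 * p)) = - (of_real u)\<^sup>2 * ((of_real s)\<^sup>2 * (2 * p * z)) / (2 * (2 * p))"
        by (simp add: pz)
      moreover have "\<dots> = - ((of_real (s * u))\<^sup>2 * z / 2)"
        using p by (simp add: power_mult_distrib)
      moreover have "\<dots> = \<i> * of_real (- a * (s * u)\<^sup>2) + of_real (- (s * u)\<^sup>2 / 2)"
        by (simp add: z_def algebra_simps)
      ultimately show ?thesis
        unfolding 0 chirp_hpsi_integral_0 e_def hpsi_0 cis_conv_exp
        by (simp only: exp_add exp_of_real power_0 mult_1_right mult.assoc)
    next
      case (Suc m)
      have I1: "chirp_hpsi_integral a m u = e * w ^ m * ?\<psi> m" using less[of m] Suc by simp
      \<comment> \<open>The factor m takes care of m = 0, where the index m - 1 is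
        truncated.\<close>
      have I2: "of_nat m * chirp_hpsi_integral a (m - 1) u * w\<^sup>2 = of_nat m * (e * w ^ Suc m * ?\<psi> (m - 1))"
      proof (cases m)
        case (Suc k)
        then show ?thesis using less[of k] \<open>n = Suc m\<close> by (simp add: power2_eq_square)
      qed simp
      have "p * chirp_hpsi_integral a (Suc m) u = \<i> * of_real u * chirp_hpsi_integral a m u + z * of_nat m * chirp_hpsi_integral a (m - 1) u"
        using chirp_hpsi_integral_Suc[of a m u] by (simp add: p_def z_def)
      also have "\<dots> = 2 * p * w * of_real s * of_real u * (e * w ^ m * ?\<psi> m) - 2 * p * (of_nat m * chirp_hpsi_integral a (m - 1) u * w\<^sup>2)"
        unfolding I1 R1 by (subst R2[symmetric]) (simp add: mult_ac)
      also have "\<dots> = p * (e * w ^ Suc m * (2 * of_real (s * u) * ?\<psi> m - 2 * of_nat m * ?\<psi> (m - 1)))"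
        unfolding I2 by (simp add: algebra_simps)
      also have "2 * of_real (s * u) * ?\<psi> m - 2 * of_nat m * ?\<psi> (m - 1) = ?\<psi> (Suc m)"
        by (simp add: hpsi_Suc)
      finally show ?thesis using p Suc by simp
    qed
  qed
  then show ?thesis by (simp add: e_def w_def z_def mult_ac)
qed

lemma chirp_moment_0_0: "chirp_moment 0 0 = of_real (sqrt (2 * pi))"
proof -
  have "sqrt pi = (LINT x|lborel. exp (- x\<^sup>2))"
    using has_bochner_integral_gaussian by (simp add: has_bochner_integral_iff)
  also have "\<dots> = \<bar>1 / sqrt 2\<bar> *\<^sub>R (LINT x|lborel. exp (- (0 + 1 / sqrt 2 * x)\<^sup>2))"
    by (rule lborel_integral_real_affine) simp
  also have "\<dots> = (LINT x|lborel. hpsi 0 x) / sqrt 2"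
    by (simp add: hpsi_0 power_divide)
  finally have "(LINT x|lborel. hpsi 0 x) = sqrt (2 * pi)"
    by (simp add: field_simps real_sqrt_mult)
  then show ?thesis by (simp add: chirp_moment_def)
qed

subsection \<open>The Fourier transform on \<open>L\<^sup>2\<close>\<close>

text \<open>Both signs share one development: - 1 gives the Fourier integral and 1 the inverse one,
  read classically for integrable \<open>f\<close>.\<close>

definition fint :: "real \<Rightarrow> (real \<Rightarrow> complex) \<Rightarrow> real \<Rightarrow> complex" where
  "fint \<sigma> f \<xi> = of_real (1 / sqrt (2 * pi)) * (LINT x|lborel. cis (\<sigma> * (x * \<xi>)) * f x)"

text \<open>The case a = 0, s = 1 of \<open>chirp_hpsi_integral_eq\<close>; parity of
  \<open>hpsi\<close> moves the sign out of the argument.\<close>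

lemma fint_hermite:
  assumes "\<sigma> = 1 \<or> \<sigma> = - 1"
  shows "fint \<sigma> (\<lambda>x. of_real (hermite_fun n x)) \<xi> = (\<i> * of_real \<sigma>) ^ n * of_real (hermite_fun n \<xi>)"
proof -
  have "(LINT x|lborel. cis (\<sigma> * (x * \<xi>)) * complex_of_real (hermite_fun n x)) =
      (LINT x|lborel. of_real (1 / hnorm n) * (cis ((\<sigma> * \<xi>) * x) * (cis (0 * x\<^sup>2) * of_real (hpsi n x))))"
    by (intro Bochner_Integration.integral_cong refl) (simp add: hermite_fun_eq_hpsi mult_ac)
  also have "\<dots> = of_real (1 / hnorm n) * chirp_hpsi_integral 0 n (\<sigma> * \<xi>)"
    unfolding chirp_hpsi_integral_def by (rule integral_mult_right_zero)
  also have "chirp_hpsi_integral 0 n (\<sigma> * \<xi>) = of_real (sqrt (2 * pi)) * \<i> ^ n * of_real (hpsi n (\<sigma> * \<xi>))"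
    using chirp_hpsi_integral_eq[of 1 0 n "\<sigma> * \<xi>"] by (simp add: chirp_moment_0_0)
  also have "hpsi n (\<sigma> * \<xi>) = \<sigma> ^ n * hpsi n \<xi>"
    using assms by (auto simp: hpsi_uminus)
  finally have E: "(LINT x|lborel. cis (\<sigma> * (x * \<xi>)) * complex_of_real (hermite_fun n x)) =
      of_real (1 / hnorm n) * (of_real (sqrt (2 * pi)) * \<i> ^ n * of_real (\<sigma> ^ n * hpsi n \<xi>))" .
  show ?thesis
    unfolding fint_def E by (simp add: hermite_fun_eq_hpsi power_mult_distrib)
qed

lemma fint_measurable [measurable]:
  assumes [measurable]: "f \<in> borel_measurable borel"
  shows "fint \<sigma> f \<in> borel_measurable borel"
  unfolding fint_def[abs_def] by measurable

lemma integrable_cis_mult: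
  fixes f :: "real \<Rightarrow> complex"
  assumes f: "integrable lborel f" and u: "u \<in> borel_measurable borel"
  shows "integrable lborel (\<lambda>x. cis (u x) * f x)"
proof (rule Bochner_Integration.integrable_bound[OF f])
  note [measurable] = borel_measurable_integrable[OF f, simplified] u
  show "(\<lambda>x. cis (u x) * f x) \<in> borel_measurable lborel" by measurable
qed (simp add: norm_mult)

lemma fint_bounded:
  assumes f: "integrable lborel f"
  shows "cmod (fint \<sigma> f \<xi>) \<le> 1 / sqrt (2 * pi) * (LINT x|lborel. cmod (f x))"
proof -
  have "cmod (LINT x|lborel. cis (\<sigma> * (x * \<xi>)) * f x) \<le> (LINT x|lborel. cmod (cis (\<sigma> * (x * \<xi>)) * f x))"
    by (rule integral_norm_bound)
  also have "\<dots> = (LINT x|lborel. cmod (f x))" by (simp add: norm_mult)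
  finally have "1 / sqrt (2 * pi) * cmod (LINT x|lborel. cis (\<sigma> * (x * \<xi>)) * f x) \<le> 1 / sqrt (2 * pi) * (LINT x|lborel. cmod (f x))"
    by (rule mult_left_mono) simp
  then show ?thesis by (simp add: fint_def norm_mult norm_divide)
qed

lemma fint_testable: "integrable lborel f \<Longrightarrow> hermite_testable (fint \<sigma> f)"
  using fint_bounded borel_measurable_integrable[of lborel f]
  by (intro hermite_testable_bounded fint_measurable) auto

text \<open>Fubini with a kernel symmetric in its two variables. It moves the transform onto Hermite
  functions, where it is explicit.\<close>

lemma fint_pairing:
  assumes f: "integrable lborel f" and g: "integrable lborel g"
  shows "(LINT \<xi>|lborel. fint \<sigma> f \<xi> * g \<xi>) = (LINT x|lborel. f x * fint \<sigma> g x)"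
proof -
  note [measurable] = borel_measurable_integrable[OF f, simplified] borel_measurable_integrable[OF g, simplified]
  define k where "k = (\<lambda>(\<xi>, x). cis (\<sigma> * (x * \<xi>)) * f x * g \<xi>)"
  have [measurable]: "k \<in> borel_measurable (lborel \<Otimes>\<^sub>M lborel)"
    unfolding k_def by measurable
  have "integrable (lborel \<Otimes>\<^sub>M lborel) k"
  proof (rule lborel_pair.Fubini_integrable)
    have "(\<lambda>\<xi>. LINT x|lborel. norm (k (\<xi>, x))) = (\<lambda>\<xi>. (LINT x|lborel. cmod (f x)) * cmod (g \<xi>))"
      by (simp add: k_def norm_mult)
    then show "integrable lborel (\<lambda>\<xi>. LINT x|lborel. norm (k (\<xi>, x)))" using g by simp
    show "AE \<xi> in lborel. integrable lborel (\<lambda>x. k (\<xi>, x))"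
      unfolding k_def split by (intro AE_I2 integrable_mult_left integrable_cis_mult f) measurable
  qed measurable
  then have "(LINT x|lborel. LINT \<xi>|lborel. k (\<xi>, x)) = (LINT \<xi>|lborel. LINT x|lborel. k (\<xi>, x))"
    using lborel_pair.Fubini_integral[of "\<lambda>\<xi> x. k (\<xi>, x)"] by simp
  moreover have "(LINT \<xi>|lborel. k (\<xi>, x)) = f x * (LINT \<xi>|lborel. cis (\<sigma> * (\<xi> * x)) * g \<xi>)" for x
  proof -
    have "(LINT \<xi>|lborel. k (\<xi>, x)) = (LINT \<xi>|lborel. f x * (cis (\<sigma> * (\<xi> * x)) * g \<xi>))"
      by (intro Bochner_Integration.integral_cong refl) (simp add: k_def mult_ac)
    then show ?thesis by simp
  qed
  moreover have "(LINT x|lborel. k (\<xi>, x)) = (LINT x|lborel. cis (\<sigma> * (x * \<xi>)) * f x) * g \<xi>" for \<xi>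
    by (simp add: k_def)
  ultimately show ?thesis
    by (simp add: fint_def mult.assoc mult.left_commute[of "f _"])
qed

lemma hermite_integrable: "integrable lborel (\<lambda>x. complex_of_real (hermite_fun n x))"
  by (rule gauss_bd_integrable[OF gauss_bd_hermite]) measurable

lemma hermite_coeff_fint:
  assumes \<sigma>: "\<sigma> = 1 \<or> \<sigma> = - 1" and f: "integrable lborel f"
  shows "hermite_coeff (fint \<sigma> f) n = (\<i> * of_real \<sigma>) ^ n * hermite_coeff f n"
proof -
  have "hermite_coeff (fint \<sigma> f) n = (LINT x|lborel. f x * fint \<sigma> (\<lambda>x. of_real (hermite_fun n x)) x)"
    unfolding hermite_coeff_def by (rule fint_pairing[OF f hermite_integrable])
  also have "\<dots> = (LINT x|lborel. (\<i> * of_real \<sigma>) ^ n * (f x * of_real (hermite_fun n x)))"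
    unfolding fint_hermite[OF \<sigma>] by (simp only: mult.left_commute)
  also have "\<dots> = (\<i> * of_real \<sigma>) ^ n * hermite_coeff f n"
    unfolding hermite_coeff_def by (rule integral_mult_right_zero)
  finally show ?thesis .
qed

lemma cmod_i_sigma: "\<sigma> = 1 \<or> \<sigma> = - 1 \<Longrightarrow> cmod ((\<i> * of_real \<sigma>) ^ n) = 1"
  by (auto simp: norm_power norm_mult)

lemma L2_with_coeff_ex:
  assumes f: "f \<in> L2" and m: "\<And>n. cmod (m n) = 1"
  shows "\<exists>g\<in>L2. \<forall>n. hermite_coeff g n = m n * hermite_coeff f n"
proof -
  have "summable (\<lambda>n. (cmod (m n * hermite_coeff f n))\<^sup>2)"
    using summable_hermite_coeff[OF f] by (simp add: norm_mult m)
  from hermite_series_limit_ex[OF this] obtain g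
    where g: "L2_limit (\<lambda>N. hermite_sum (\<lambda>n. m n * hermite_coeff f n) {..<N}) g" by blast
  then show ?thesis using hermite_series_limit[OF g] by (auto simp: L2_limit_def)
qed

text \<open>Plancherel through coefficients: an L2 function with the expected coefficients exists,
  the bounded function \<open>fint \<sigma> f\<close> has the same ones, so the two agree almost
  everywhere.\<close>

lemma fint_L2:
  assumes \<sigma>: "\<sigma> = 1 \<or> \<sigma> = - 1" and f: "f \<in> L2" "integrable lborel f"
  shows "fint \<sigma> f \<in> L2"
proof -
  obtain g where g: "g \<in> L2" "\<And>n. hermite_coeff g n = (\<i> * of_real \<sigma>) ^ n * hermite_coeff f n"
    using L2_with_coeff_ex[OF f(1), of "\<lambda>n. (\<i> * of_real \<sigma>) ^ n"] cmod_i_sigma[OF \<sigma>] by blast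
  have "AE x in lborel. g x = fint \<sigma> f x"
    by (rule hermite_testable_eqI) (auto simp: g hermite_testable_L2 fint_testable f hermite_coeff_fint[OF \<sigma>])
  then show ?thesis
    using L2_measurable[OF f(1)] by (intro L2_cong_AE[OF g(1)]) auto
qed

section \<open>Truncation and the limit in mean\<close>

definition trunc :: "nat \<Rightarrow> (real \<Rightarrow> complex) \<Rightarrow> real \<Rightarrow> complex" where
  "trunc N f x = indicator {- real N..real N} x *\<^sub>R f x"

lemma trunc_L2:
  assumes f: "f \<in> L2"
  shows "trunc N f \<in> L2"
proof -
  have "(\<lambda>x. indicator {- real N..real N} x * f x) \<in> L2"
    by (rule L2_mult_bounded[where B=1, OF _ _ f]) (auto split: split_indicator)
  moreover have "(\<lambda>x. indicator {- real N..real N} x * f x) = trunc N f"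
    by (auto simp: trunc_def[abs_def] fun_eq_iff split: split_indicator)
  ultimately show ?thesis by simp
qed

lemma trunc_integrable:
  assumes f: "f \<in> L2"
  shows "integrable lborel (trunc N f)"
proof -
  have "(\<lambda>x. indicator {- real N..real N} x) \<in> L2"
  proof (rule L2_I)
    have "(\<lambda>x. (cmod (indicator {- real N..real N} x))\<^sup>2) = (indicator {- real N..real N} :: real \<Rightarrow> real)"
      by (auto simp: fun_eq_iff split: split_indicator)
    then show "integrable lborel (\<lambda>x. (cmod (indicator {- real N..real N} x))\<^sup>2)"
      by (simp add: integrable_indicator_iff)
  qed auto
  from L2_mult_integrable[OF this f] have "integrable lborel (\<lambda>x. indicator {- real N..real N} x * f x)" .
  moreover have "(\<lambda>x. indicator {- real N..real N} x * f x) = trunc N f"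
    by (auto simp: trunc_def[abs_def] fun_eq_iff split: split_indicator)
  ultimately show ?thesis by simp
qed

lemma trunc_limit:
  assumes f: "f \<in> L2"
  shows "L2_limit (\<lambda>N. trunc N f) f"
proof -
  note [measurable] = L2_measurable[OF f] L2_measurable[OF trunc_L2[OF f]]
  have "(\<lambda>N. LINT x|lborel. (cmod (trunc N f x - f x))\<^sup>2) \<longlonglongrightarrow> (LINT x::real|lborel. 0)"
  proof (rule integral_dominated_convergence[where w="\<lambda>x. (cmod (f x))\<^sup>2"])
    show "integrable lborel (\<lambda>x. (cmod (f x))\<^sup>2)" by (rule L2_integrable_sq[OF f])
    show "AE x in lborel. (\<lambda>N. (cmod (trunc N f x - f x))\<^sup>2) \<longlonglongrightarrow> 0"
    proof (intro AE_I2 tendsto_eventually)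
      fix x :: real
      obtain M where M: "\<bar>x\<bar> \<le> real M" using real_arch_simple by blast
      show "\<forall>\<^sub>F N in sequentially. (cmod (trunc N f x - f x))\<^sup>2 = 0"
        using eventually_ge_at_top[of M]
      proof eventually_elim
        case (elim N)
        then have "real M \<le> real N" by simp
        with M have "x \<in> {- real N..real N}" by (auto simp: abs_le_iff)
        then show ?case by (simp add: trunc_def)
      qed
    qed
    show "AE x in lborel. norm ((cmod (trunc N f x - f x))\<^sup>2) \<le> (cmod (f x))\<^sup>2" for N
      by (auto simp: trunc_def split: split_indicator)
  qed measurable
  then show ?thesis by (simp add: L2_limit_def f trunc_L2)
qed

lemma fourier_eq: "fourier f = L2_lim (\<lambda>N. fint (- 1) (trunc N f))"
  unfolding fourier_def fint_def set_lebesgue_integral_def trunc_def by simp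

lemma inverse_fourier_eq: "inverse_fourier f = L2_lim (\<lambda>N. fint 1 (trunc N f))"
  unfolding inverse_fourier_def fint_def set_lebesgue_integral_def trunc_def by (simp add: mult.commute)

text \<open>The truncations tend to \<open>f\<close>, and a unimodular multiplier carries this
  convergence to their transforms. The selected limit inherits the coefficients of the candidate
  \<open>g\<close>.\<close>

lemma L2_lim_fint:
  assumes \<sigma>: "\<sigma> = 1 \<or> \<sigma> = - 1" and f: "f \<in> L2"
  shows "L2_lim (\<lambda>N. fint \<sigma> (trunc N f)) \<in> L2"
    and "hermite_coeff (L2_lim (\<lambda>N. fint \<sigma> (trunc N f))) n = (\<i> * of_real \<sigma>) ^ n * hermite_coeff f n"
proof -
  obtain g where g: "g \<in> L2" "\<And>n. hermite_coeff g n = (\<i> * of_real \<sigma>) ^ n * hermite_coeff f n"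
    using L2_with_coeff_ex[OF f(1), of "\<lambda>n. (\<i> * of_real \<sigma>) ^ n"] cmod_i_sigma[OF \<sigma>] by blast
  have L: "L2_limit (\<lambda>N. fint \<sigma> (trunc N f)) g"
  proof (rule L2_limit_by_coeff[OF _ g(1) trunc_L2[OF f] f _ trunc_limit[OF f]])
    show "cmod (hermite_coeff (fint \<sigma> (trunc N f)) n - hermite_coeff g n) = cmod (hermite_coeff (trunc N f) n - hermite_coeff f n)" for N n
      unfolding g hermite_coeff_fint[OF \<sigma> trunc_integrable[OF f]] right_diff_distrib[symmetric] norm_mult cmod_i_sigma[OF \<sigma>]
      by simp
  qed (intro fint_L2 \<sigma> trunc_L2 trunc_integrable f)
  then have L': "L2_limit (\<lambda>N. fint \<sigma> (trunc N f)) (L2_lim (\<lambda>N. fint \<sigma> (trunc N f)))"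
    by (rule L2_limit_L2_lim)
  then show L2: "L2_lim (\<lambda>N. fint \<sigma> (trunc N f)) \<in> L2" by (simp add: L2_limit_def)
  show "hermite_coeff (L2_lim (\<lambda>N. fint \<sigma> (trunc N f))) n = (\<i> * of_real \<sigma>) ^ n * hermite_coeff f n"
    using hermite_coeff_cong_AE[OF L2 g(1) L2_limit_unique[OF L' L]] by (simp add: g)
qed

lemma fourier_L2: "f \<in> L2 \<Longrightarrow> fourier f \<in> L2"
  and hermite_coeff_fourier: "f \<in> L2 \<Longrightarrow> hermite_coeff (fourier f) n = (- \<i>) ^ n * hermite_coeff f n"
  using L2_lim_fint[of "-1" f] by (simp_all add: fourier_eq)

lemma inverse_fourier_L2: "f \<in> L2 \<Longrightarrow> inverse_fourier f \<in> L2"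
  and hermite_coeff_inverse_fourier: "f \<in> L2 \<Longrightarrow> hermite_coeff (inverse_fourier f) n = \<i> ^ n * hermite_coeff f n"
  using L2_lim_fint[of 1 f] by (simp_all add: inverse_fourier_eq)

text \<open>Both sides have the same Parseval series, which extends the pairing identity from
  integrable functions to every \<open>f\<close> in L2.\<close>

lemma inverse_fourier_pairing:
  assumes f: "f \<in> L2" and g: "gauss_bd g" and [measurable]: "g \<in> borel_measurable borel"
  shows "(LINT x|lborel. inverse_fourier f x * g x) = (LINT y|lborel. f y * fint 1 g y)"
proof -
  have gL: "g \<in> L2" by (rule gauss_bd_L2[OF g]) measurable
  have gi: "integrable lborel g" by (rule gauss_bd_integrable[OF g]) measurable
  have "(\<lambda>n. \<i> ^ n * hermite_coeff f n * hermite_coeff g n) sums (LINT x|lborel. inverse_fourier f x * g x)"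
    using hermite_parseval[OF inverse_fourier_L2[OF f] gL] by (simp add: hermite_coeff_inverse_fourier f)
  moreover have "(\<lambda>n. \<i> ^ n * hermite_coeff f n * hermite_coeff g n) sums (LINT y|lborel. f y * fint 1 g y)"
    using hermite_parseval[OF f fint_L2[of 1, OF _ gL gi]] by (simp add: hermite_coeff_fint gi mult_ac)
  ultimately show ?thesis by (rule sums_unique2)
qed

lemma gauss_bd_affine:
  assumes f: "gauss_bd f" and c: "c \<noteq> 0"
  shows "gauss_bd (\<lambda>x. f (t + c * x))"
proof -
  obtain K d where 1: "d > 0" "K \<ge> 0" "\<And>x. cmod (f x) \<le> K * exp (- d * x\<^sup>2)"
    using gauss_bdE'[OF f] by metis
  show ?thesis
  proof (rule gauss_bdI)
    show "d * c\<^sup>2 > 0" using 1 c by simp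
    fix x
    have "- d * (t + c * x)\<^sup>2 = - d * t\<^sup>2 - 2 * d * t * c * x - d * c\<^sup>2 * x\<^sup>2"
      by (simp add: power2_eq_square algebra_simps)
    also have "\<dots> \<le> 0 + \<bar>2 * d * t * c\<bar> * \<bar>x\<bar> - d * c\<^sup>2 * x\<^sup>2"
    proof -
      have "- d * t\<^sup>2 \<le> 0" using 1 by simp
      moreover have "- (2 * d * t * c * x) \<le> \<bar>2 * d * t * c\<bar> * \<bar>x\<bar>" by (simp only: abs_mult[symmetric])
      ultimately show ?thesis by linarith
    qed
    finally have "exp (- d * (t + c * x)\<^sup>2) \<le> exp (\<bar>2 * d * t * c\<bar> * \<bar>x\<bar> - d * c\<^sup>2 * x\<^sup>2)" by simp
    from mult_left_mono[OF this 1(2)] 1(3)[of "t + c * x"]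
    show "cmod (f (t + c * x)) \<le> K * exp (\<bar>2 * d * t * c\<bar> * \<bar>x\<bar> - d * c\<^sup>2 * x\<^sup>2)" by linarith
  qed
qed

text \<open>Moves an affine change of argument from the transform to the test function. The case b =
  0 yields scaling and Mehler's formula, the case c = 1 linear modulation.\<close>

lemma inverse_fourier_affine_pairing:
  assumes f: "f \<in> L2" and c: "c > 0" and g: "gauss_bd g" and [measurable]: "g \<in> borel_measurable borel"
  shows "(LINT x|lborel. inverse_fourier f (b + x / c) * g x) =
    (LINT y|lborel. f y * (cis (b * y) * (fint 1 g (y / c))))"
proof -
  \<comment> \<open>The substitution x = c (u - b) makes u the argument of
    \<open>inverse_fourier f\<close>.\<close>
  have "(LINT x|lborel. inverse_fourier f (b + x / c) * g x) =
      \<bar>c\<bar> *\<^sub>R (LINT u|lborel. inverse_fourier f (b + (- (c * b) + c * u) / c) * g (- (c * b) + c * u))"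
    using c by (intro lborel_integral_real_affine) simp
  also have "(LINT u|lborel. inverse_fourier f (b + (- (c * b) + c * u) / c) * g (- (c * b) + c * u)) =
      (LINT u|lborel. inverse_fourier f u * g (- (c * b) + c * u))"
    using c by (simp add: field_simps)
  also have "\<dots> = (LINT y|lborel. f y * fint 1 (\<lambda>u. g (- (c * b) + c * u)) y)"
    using c by (intro inverse_fourier_pairing f gauss_bd_affine g) auto
  finally have 1: "(LINT x|lborel. inverse_fourier f (b + x / c) * g x) =
      \<bar>c\<bar> *\<^sub>R (LINT y|lborel. f y * fint 1 (\<lambda>u. g (- (c * b) + c * u)) y)" .
  have 2: "fint 1 (\<lambda>u. g (- (c * b) + c * u)) y = of_real (1 / c) * (cis (b * y) * fint 1 g (y / c))" for y
  proof -
    have "(LINT x|lborel. cis (x * (y / c)) * g x) =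
        \<bar>c\<bar> *\<^sub>R (LINT u|lborel. cis ((- (c * b) + c * u) * (y / c)) * g (- (c * b) + c * u))"
      using c by (intro lborel_integral_real_affine) simp
    also have "(LINT u|lborel. cis ((- (c * b) + c * u) * (y / c)) * g (- (c * b) + c * u)) =
        (LINT u|lborel. cis (- (b * y)) * (cis (u * y) * g (- (c * b) + c * u)))"
    proof (intro Bochner_Integration.integral_cong refl)
      fix u
      have "(- (c * b) + c * u) * (y / c) = - (b * y) + u * y" using c by (simp add: field_simps)
      then show "cis ((- (c * b) + c * u) * (y / c)) * g (- (c * b) + c * u) =
          cis (- (b * y)) * (cis (u * y) * g (- (c * b) + c * u))"
        by (simp only: cis_mult[symmetric] mult.assoc)
    qed
    also have "\<dots> = cis (- (b * y)) * (LINT u|lborel. cis (u * y) * g (- (c * b) + c * u))"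
      by (rule integral_mult_right_zero)
    finally have "of_real (1 / c) * cis (b * y) * (LINT x|lborel. cis (x * (y / c)) * g x) =
        (cis (b * y) * cis (- (b * y))) * (LINT u|lborel. cis (u * y) * g (- (c * b) + c * u))"
      using c by (simp add: scaleR_conv_of_real)
    then show ?thesis
      by (simp add: fint_def cis_mult mult_ac)
  qed
  have "(LINT y|lborel. f y * fint 1 (\<lambda>u. g (- (c * b) + c * u)) y) =
      (LINT y|lborel. of_real (1 / c) * (f y * (cis (b * y) * fint 1 g (y / c))))"
    unfolding 2 by (simp only: mult.left_commute)
  also have "\<dots> = of_real (1 / c) * (LINT y|lborel. f y * (cis (b * y) * fint 1 g (y / c)))"
    by (rule integral_mult_right_zero)
  finally show ?thesis
    unfolding 1 using c by (simp add: scaleR_conv_of_real)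
qed

subsection \<open>Symmetries on the Fourier side\<close>

lemma pairing_scale_arg:
  fixes f g :: "real \<Rightarrow> complex"
  assumes c: "c > 0"
  shows "(LINT y|lborel. f y * g (y / c)) = of_real c * (LINT y|lborel. f (c * y) * g y)"
proof -
  have "(LINT y|lborel. f y * g (y / c)) = \<bar>c\<bar> *\<^sub>R (LINT y|lborel. f (0 + c * y) * g ((0 + c * y) / c))"
    using c by (intro lborel_integral_real_affine) simp
  then show ?thesis using c by (simp add: scaleR_conv_of_real)
qed

lemma inverse_fourier_scale:
  assumes f: "f \<in> L2" and c: "c > 0"
  shows "AE x in lborel. inverse_fourier (\<lambda>x. of_real (sqrt c) * f (c * x)) x =
    of_real (1 / sqrt c) * inverse_fourier f (x / c)"
proof (rule L2_eqI)
  have fc: "(\<lambda>x. f (c * x)) \<in> L2" using L2_real_affine[OF f, of c 0] c by simp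
  show "inverse_fourier (\<lambda>x. of_real (sqrt c) * f (c * x)) \<in> L2"
    by (intro inverse_fourier_L2 L2_scale fc)
  show "(\<lambda>x. of_real (1 / sqrt c) * inverse_fourier f (x / c)) \<in> L2"
    using L2_real_affine[OF inverse_fourier_L2[OF f], of "1 / c" 0] c by (intro L2_scale) simp
  fix n
  have "hermite_coeff (\<lambda>x. inverse_fourier f (0 + x / c)) n =
      (LINT y|lborel. f y * (\<i> ^ n * of_real (hermite_fun n (y / c))))"
    unfolding hermite_coeff_def
    by (subst inverse_fourier_affine_pairing[OF f c gauss_bd_hermite]) (simp_all add: fint_hermite)
  also have "\<dots> = of_real c * (LINT y|lborel. f (c * y) * (\<i> ^ n * of_real (hermite_fun n y)))"
    by (rule pairing_scale_arg[OF c])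
  also have "\<dots> = of_real c * (\<i> ^ n * hermite_coeff (\<lambda>x. f (c * x)) n)"
    unfolding hermite_coeff_def by (simp add: mult.left_commute[of "f _"])
  finally have 1: "hermite_coeff (\<lambda>x. inverse_fourier f (x / c)) n = of_real c * (\<i> ^ n * hermite_coeff (\<lambda>x. f (c * x)) n)"
    by simp
  have 2: "hermite_coeff (inverse_fourier (\<lambda>x. of_real (sqrt c) * f (c * x))) n =
      \<i> ^ n * (of_real (sqrt c) * hermite_coeff (\<lambda>x. f (c * x)) n)"
    by (simp only: hermite_coeff_scale hermite_coeff_inverse_fourier[OF L2_scale[OF fc]])
  \<comment> \<open>The Jacobian c times c^(-1/2) on one side has to match c^(1/2) on the
    other.\<close>
  have 3: "complex_of_real (sqrt c) = of_real (1 / sqrt c * c)" using c by (simp add: real_div_sqrt)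
  show "hermite_coeff (inverse_fourier (\<lambda>x. of_real (sqrt c) * f (c * x))) n =
      hermite_coeff (\<lambda>x. of_real (1 / sqrt c) * inverse_fourier f (x / c)) n"
    unfolding hermite_coeff_scale[of "of_real (1 / sqrt c)"] 1 2 by (subst 3) (simp only: of_real_mult mult_ac)
qed

lemma inverse_fourier_modulate:
  assumes f: "f \<in> L2"
  shows "AE x in lborel. inverse_fourier (\<lambda>x. cis (b * x) * f x) x = inverse_fourier f (x + b)"
proof (rule L2_eqI)
  have m: "(\<lambda>x. cis (b * x) * f x) \<in> L2" by (rule L2_cis[OF f]) measurable
  then show "inverse_fourier (\<lambda>x. cis (b * x) * f x) \<in> L2" by (rule inverse_fourier_L2)
  show "(\<lambda>x. inverse_fourier f (x + b)) \<in> L2"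
    using L2_real_affine[OF inverse_fourier_L2[OF f], of 1 b] by (simp add: add.commute)
  fix n
  have "hermite_coeff (\<lambda>x. inverse_fourier f (b + x / 1)) n =
      (LINT y|lborel. f y * (cis (b * y) * (\<i> ^ n * of_real (hermite_fun n y))))"
    unfolding hermite_coeff_def
    by (subst inverse_fourier_affine_pairing[OF f _ gauss_bd_hermite]) (simp_all add: fint_hermite)
  also have "\<dots> = (LINT y|lborel. \<i> ^ n * ((cis (b * y) * f y) * of_real (hermite_fun n y)))"
    by (simp only: mult_ac)
  also have "\<dots> = \<i> ^ n * hermite_coeff (\<lambda>x. cis (b * x) * f x) n"
    unfolding hermite_coeff_def by (rule integral_mult_right_zero)
  finally show "hermite_coeff (inverse_fourier (\<lambda>x. cis (b * x) * f x)) n = hermite_coeff (\<lambda>x. inverse_fourier f (x + b)) n"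
    using hermite_coeff_inverse_fourier[OF m] by (simp add: add.commute)
qed

subsection \<open>The harmonic propagator as a Fourier transform\<close>

text \<open>With \<open>s = sin (2 * t)\<close> and \<open>a = - cot (2 * t) / 2\<close> the map below is Mehler's formula
  for \<open>e\<^sup>i\<^sup>t\<^sup>H\<close>, up to a constant factor.\<close>

definition mehler :: "real \<Rightarrow> real \<Rightarrow> (real \<Rightarrow> complex) \<Rightarrow> real \<Rightarrow> complex" where
  "mehler a s f x = cis (a * x\<^sup>2) * inverse_fourier (\<lambda>y. cis (a * y\<^sup>2) * f y) (x / s)"

lemma L2_chirp: "f \<in> L2 \<Longrightarrow> (\<lambda>y. cis (a * y\<^sup>2) * f y) \<in> L2"
  by (rule L2_cis) measurable

lemma mehler_L2:
  assumes f: "f \<in> L2" and s: "s > 0"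
  shows "mehler a s f \<in> L2"
proof -
  have "(\<lambda>x. inverse_fourier (\<lambda>y. cis (a * y\<^sup>2) * f y) (x / s)) \<in> L2"
    using L2_real_affine[OF inverse_fourier_L2[OF L2_chirp[OF f, of a]], of "1 / s" 0] s by simp
  from L2_chirp[OF this, of a] show ?thesis unfolding mehler_def[abs_def] .
qed

lemma L2_sq_scale_arg:
  assumes s: "s > 0"
  shows "L2_sq (\<lambda>x. f (x / s)) = s * L2_sq f"
proof -
  have "L2_sq (\<lambda>x. f (x / s)) = \<bar>s\<bar> *\<^sub>R (LINT u|lborel. (cmod (f ((0 + s * u) / s)))\<^sup>2)"
    using s by (intro lborel_integral_real_affine) simp
  then show ?thesis using s by simp
qed

lemma L2_sq_inverse_fourier:
  assumes f: "f \<in> L2"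
  shows "L2_sq (inverse_fourier f) = L2_sq f"
proof -
  have "(\<lambda>n. (cmod (hermite_coeff f n))\<^sup>2) sums L2_sq (inverse_fourier f)"
    using hermite_parseval_sq[OF inverse_fourier_L2[OF f]]
    by (simp add: hermite_coeff_inverse_fourier f norm_mult norm_power)
  then show ?thesis using hermite_parseval_sq[OF f] by (rule sums_unique2)
qed

text \<open>This will fix the modulus of the normalising constant in Mehler's formula.\<close>

lemma L2_sq_mehler:
  assumes f: "f \<in> L2" and s: "s > 0"
  shows "L2_sq (mehler a s f) = s * L2_sq f"
proof -
  have "L2_sq (mehler a s f) = L2_sq (\<lambda>x. inverse_fourier (\<lambda>y. cis (a * y\<^sup>2) * f y) (x / s))"
    by (simp add: mehler_def norm_mult)
  also have "\<dots> = s * L2_sq (inverse_fourier (\<lambda>y. cis (a * y\<^sup>2) * f y))"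
    by (rule L2_sq_scale_arg[OF s])
  also have "\<dots> = s * L2_sq (\<lambda>y. cis (a * y\<^sup>2) * f y)"
    unfolding L2_sq_inverse_fourier[OF L2_chirp[OF f]] ..
  also have "\<dots> = s * L2_sq f" by (simp add: norm_mult)
  finally show ?thesis .
qed

text \<open>Moving the map onto the Hermite function leaves the integral of
  \<open>chirp_hpsi_integral_eq\<close>, whose outgoing chirp cancels the chirp on \<open>f\<close>.
  The map is thus diagonal on Hermite functions.\<close>

lemma hermite_coeff_mehler:
  assumes f: "f \<in> L2" and s: "s > 0" "s\<^sup>2 * (1 + 4 * a\<^sup>2) = 1"
  shows "hermite_coeff (mehler a s f) n =
    of_real (1 / sqrt (2 * pi)) * chirp_moment a 0 * (\<i> * of_real s * (1 + 2 * \<i> * of_real a)) ^ n * hermite_coeff f n"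
proof -
  define K where "K = of_real (1 / sqrt (2 * pi)) * chirp_moment a 0 * (\<i> * of_real s * (1 + 2 * \<i> * of_real a)) ^ n"
  let ?g = "\<lambda>x. cis (a * x\<^sup>2) * complex_of_real (hermite_fun n x)"
  have F: "fint 1 ?g (y / s) = K * (cis (- a * y\<^sup>2) * of_real (hermite_fun n y))" for y
  proof -
    have "(LINT x|lborel. cis (1 * (x * (y / s))) * ?g x) =
        (LINT x|lborel. of_real (1 / hnorm n) * (cis ((y / s) * x) * (cis (a * x\<^sup>2) * of_real (hpsi n x))))"
      by (intro Bochner_Integration.integral_cong refl) (simp add: hermite_fun_eq_hpsi mult_ac)
    also have "\<dots> = of_real (1 / hnorm n) * chirp_hpsi_integral a n (y / s)"
      unfolding chirp_hpsi_integral_def by (rule integral_mult_right_zero)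
    finally have E: "(LINT x|lborel. cis (1 * (x * (y / s))) * ?g x) = of_real (1 / hnorm n) * chirp_hpsi_integral a n (y / s)" .
    have sy: "s * (y / s) = y" using s by simp
    show ?thesis
      unfolding fint_def E chirp_hpsi_integral_eq[OF s(2)] sy K_def
      by (simp add: hermite_fun_eq_hpsi mult_ac)
  qed
  have "hermite_coeff (mehler a s f) n =
      (LINT x|lborel. inverse_fourier (\<lambda>y. cis (a * y\<^sup>2) * f y) (0 + x / s) * ?g x)"
    by (simp add: hermite_coeff_def mehler_def mult_ac)
  also have "\<dots> = (LINT y|lborel. cis (a * y\<^sup>2) * f y * (cis (0 * y) * fint 1 ?g (y / s)))"
    by (intro inverse_fourier_affine_pairing L2_chirp f s gauss_bd_cis gauss_bd_hermite) measurable
  also have "\<dots> = (LINT y|lborel. K * (f y * of_real (hermite_fun n y)))"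
  proof (intro Bochner_Integration.integral_cong refl)
    fix y
    have "cis (a * y\<^sup>2) * cis (- a * y\<^sup>2) = 1" by (simp add: cis_mult)
    then have "cis (a * y\<^sup>2) * cis (- a * y\<^sup>2) * (K * (f y * of_real (hermite_fun n y))) = K * (f y * of_real (hermite_fun n y))"
      by simp
    then show "cis (a * y\<^sup>2) * f y * (cis (0 * y) * fint 1 ?g (y / s)) = K * (f y * of_real (hermite_fun n y))"
      unfolding F by (simp add: mult_ac)
  qed
  also have "\<dots> = K * hermite_coeff f n"
    unfolding hermite_coeff_def by (rule integral_mult_right_zero)
  finally show ?thesis unfolding K_def .
qed

lemma harmonic_schroedinger_mehler:
  assumes t: "0 < t" "t < pi / 2"
  obtains \<kappa> where "(cmod \<kappa>)\<^sup>2 = 1 / sin (2 * t)"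
    "\<And>f. f \<in> L2 \<Longrightarrow> AE x in lborel. harmonic_schroedinger t f x =
        \<kappa> * mehler (- cot (2 * t) / 2) (sin (2 * t)) f x"
proof -
  define s where "s = sin (2 * t)"
  define a where "a = - cot (2 * t) / 2"
  define M where "M = of_real (1 / sqrt (2 * pi)) * chirp_moment a 0"
  define w where "w = \<i> * of_real s * (1 + 2 * \<i> * of_real a)"
  have s: "s > 0" unfolding s_def using t by (intro sin_gt_zero) auto
  \<comment> \<open>This turns the constraint relating s and a into sin^2 + cos^2 = 1.\<close>
  have as: "2 * a * s = - cos (2 * t)" using s by (simp add: a_def s_def cot_def)
  have "s\<^sup>2 * (1 + 4 * a\<^sup>2) = s\<^sup>2 + (2 * a * s)\<^sup>2" by (simp add: power2_eq_square algebra_simps)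
  also have "\<dots> = 1" unfolding as by (simp add: s_def)
  finally have sa: "s\<^sup>2 * (1 + 4 * a\<^sup>2) = 1" .
  \<comment> \<open>The ratio i s (1 + 2 i a) = i s - 2 a s of consecutive eigenvalues is the factor
    exp (2 i t) between the levels 2 n + 1 of the propagator.\<close>
  have w: "w = cis (2 * t)"
  proof -
    have "w = \<i> * of_real s - of_real (2 * a * s)" by (simp add: w_def algebra_simps)
    then show ?thesis unfolding as by (simp add: complex_eq_iff s_def)
  qed
  have c: "hermite_coeff (mehler a s f) n = M * w ^ n * hermite_coeff f n" if "f \<in> L2" for f n
    using hermite_coeff_mehler[OF that s sa] by (simp add: M_def w_def)
  \<comment> \<open>Comparing norms on the ground state gives |M|^2 = s without evaluating the
    complex Gaussian integral.\<close>
  let ?h = "\<lambda>x. complex_of_real (hermite_fun 0 x)"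
  have "(\<lambda>n. (cmod (hermite_coeff (mehler a s ?h) n))\<^sup>2) sums (s * L2_sq ?h)"
    using hermite_parseval_sq[OF mehler_L2[OF hermite_L2[of 0] s, of a]]
    unfolding L2_sq_mehler[OF hermite_L2 s] .
  then have "(\<lambda>n. (cmod M)\<^sup>2 * (cmod (hermite_coeff ?h n))\<^sup>2) sums (s * L2_sq ?h)"
    by (simp only: c[OF hermite_L2] norm_mult norm_power w norm_cis power_one mult_1_right power_mult_distrib)
  moreover have "(\<lambda>n. (cmod M)\<^sup>2 * (cmod (hermite_coeff ?h n))\<^sup>2) sums ((cmod M)\<^sup>2 * L2_sq ?h)"
    by (intro sums_mult hermite_parseval_sq hermite_L2)
  ultimately have "s * L2_sq ?h = (cmod M)\<^sup>2 * L2_sq ?h" by (rule sums_unique2)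
  moreover have "complex_of_real (L2_sq ?h) = 1"
    unfolding L2_sq_eq_pairing using hermite_orthonormal[of 0 0] by simp
  ultimately have M: "(cmod M)\<^sup>2 = s" by simp
  then have M0: "M \<noteq> 0" using s by auto
  show ?thesis
  proof (rule that[of "cis t / M"])
    show "(cmod (cis t / M))\<^sup>2 = 1 / sin (2 * t)"
      by (simp add: norm_divide power_divide M s_def)
    fix f assume f: "f \<in> L2"
    show "AE x in lborel. harmonic_schroedinger t f x = cis t / M * mehler (- cot (2 * t) / 2) (sin (2 * t)) f x"
      unfolding s_def[symmetric] a_def[symmetric]
    proof (rule L2_eqI)
      fix n
      have "cis (t * (2 * real n + 1)) = cis t * w ^ n"
        unfolding w Complex.DeMoivre cis_mult by (simp add: algebra_simps)
      then show "hermite_coeff (harmonic_schroedinger t f) n = hermite_coeff (\<lambda>x. cis t / M * mehler a s f x) n"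
        unfolding hermite_coeff_scale c[OF f] hermite_coeff_harmonic_schroedinger[OF f] using M0 by simp
    qed (intro harmonic_schroedinger_L2 L2_scale mehler_L2 f s)+
  qed
qed

subsection \<open>Integration without measurability assumptions\<close>

text \<open>Altering a function at finitely many points preserves being Borel and being non-Borel,
  and in the second case both integrals are 0 by convention. Endpoints of time intervals may so be
  changed for integrands of unknown measurability.\<close>

lemma integral_cong_finite:
  fixes f g :: "real \<Rightarrow> 'a :: {banach, second_countable_topology}"
  assumes S: "finite S" and eq: "\<And>x. x \<notin> S \<Longrightarrow> f x = g x"
  shows "(LINT x|lborel. f x) = (LINT x|lborel. g x)"
proof -
  have m: "k \<in> borel_measurable borel" if [measurable]: "h \<in> borel_measurable borel"
    and hk: "\<And>x. x \<notin> S \<Longrightarrow> h x = k x" for h k :: "real \<Rightarrow> 'a"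
  proof -
    have "k = (\<lambda>x. h x + (\<Sum>s\<in>S. indicator {s} x *\<^sub>R (k s - h s)))"
    proof
      fix x
      have "(\<Sum>s\<in>S. indicator {s} x *\<^sub>R (k s - h s)) = (\<Sum>s\<in>S. if x = s then k s - h s else 0)"
        by (intro sum.cong refl) (auto split: split_indicator)
      then show "k x = h x + (\<Sum>s\<in>S. indicator {s} x *\<^sub>R (k s - h s))"
        using S hk[of x] by (cases "x \<in> S") auto
    qed
    moreover have "(\<lambda>x. h x + (\<Sum>s\<in>S. indicator {s} x *\<^sub>R (k s - h s))) \<in> borel_measurable borel"
      by measurable
    ultimately show ?thesis by simp
  qed
  show ?thesis
  proof (cases "f \<in> borel_measurable borel")
    case True
    have "AE x in lborel. x \<notin> S"
      by (rule AE_not_in[OF finite_imp_null_set_lborel[OF S]])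
    then have "AE x in lborel. f x = g x" by eventually_elim (rule eq)
    with True m[OF True eq] show ?thesis by (intro integral_cong_AE) auto
  next
    case False
    with m[of g f] eq have "g \<notin> borel_measurable borel" by auto
    with False have "\<not> integrable lborel f" "\<not> integrable lborel g"
      using borel_measurable_integrable[of lborel] by auto
    then show ?thesis by (simp add: not_integrable_integral_eq)
  qed
qed

text \<open>For overlapping windows, the part of the first that precedes b, translated by p,
  completes the second. Distant windows are reached period by period.\<close>

lemma periodic_set_integral:
  fixes G :: "real \<Rightarrow> 'a :: {banach, second_countable_topology}"
  assumes p: "p > 0" and per: "\<And>x. G (x + p) = G x"
  shows "(LINT x:{a..<a + p}|lborel. G x) = (LINT x:{b..<b + p}|lborel. G x)"
proof -
  have shift: "(LINT x:{a + p..<b + p}|lborel. G x) = (LINT x:{a..<b}|lborel. G x)"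
    "set_integrable lborel {a + p..<b + p} G \<longleftrightarrow> set_integrable lborel {a..<b} G" for a b
  proof -
    have e: "indicator {a + p..<b + p} (p + 1 * x) *\<^sub>R G (p + 1 * x) = indicator {a..<b} x *\<^sub>R G x" for x
      using per[of x] by (simp add: add.commute indicator_def)
    let ?h = "\<lambda>x. indicator {a + p..<b + p} x *\<^sub>R G x"
    show "(LINT x:{a + p..<b + p}|lborel. G x) = (LINT x:{a..<b}|lborel. G x)"
      using lborel_integral_real_affine[of 1 ?h p] unfolding e set_lebesgue_integral_def by simp
    show "set_integrable lborel {a + p..<b + p} G \<longleftrightarrow> set_integrable lborel {a..<b} G"
      using lborel_integrable_real_affine_iff[of 1 ?h p] unfolding e set_integrable_def by simp
  qed
  have near: "(LINT x:{a..<a + p}|lborel. G x) = (LINT x:{b..<b + p}|lborel. G x)"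
    if ab: "a \<le> b" "b \<le> a + p" for a b
  proof -
    have u: "{a..<a + p} = {a..<b} \<union> {b..<a + p}" "{b..<b + p} = {b..<a + p} \<union> {a + p..<b + p}"
      using ab p by auto
    show ?thesis
    proof (cases "set_integrable lborel {a..<b} G \<and> set_integrable lborel {b..<a + p} G")
      case True
      then show ?thesis
        unfolding u using shift[of a b]
        by (subst (1 2) set_integral_Un) (auto simp: add.commute)
    next
      case False
      \<comment> \<open>If either piece fails to be integrable, so do both windows, and both
        integrals take the default value 0.\<close>
      have "\<not> set_integrable lborel {a..<a + p} G"
        using False set_integrable_subset[of lborel "{a..<a + p}" G] ab by auto
      moreover have "\<not> set_integrable lborel {b..<b + p} G"
        using False shift(2)[of a b] set_integrable_subset[of lborel "{b..<b + p}" G "{b..<a + p}"]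
          set_integrable_subset[of lborel "{b..<b + p}" G "{a + p..<b + p}"] ab by auto
      ultimately show ?thesis
        unfolding set_lebesgue_integral_def set_integrable_def by (simp add: not_integrable_integral_eq)
    qed
  qed
  have far: "(LINT x:{a..<a + p}|lborel. G x) = (LINT x:{b..<b + p}|lborel. G x)"
    if "a \<le> b" "b \<le> a + real n * p" for a b n
    using that
  proof (induction n arbitrary: a)
    case (Suc n)
    show ?case
    proof (cases "b \<le> a + p")
      case False
      then have "(LINT x:{a + p..<a + p + p}|lborel. G x) = (LINT x:{b..<b + p}|lborel. G x)"
        using Suc.prems by (intro Suc.IH) (auto simp: algebra_simps)
      with near[of a "a + p"] p show ?thesis by simp
    qed (use near Suc.prems in auto)
  qed auto
  have arch: "\<exists>n. c \<le> d + real n * p" for c d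
  proof -
    obtain n :: nat where "(c - d) / p < real n" using reals_Archimedean2 by blast
    with p show ?thesis by (intro exI[of _ n]) (simp add: field_simps)
  qed
  from arch[of b a] obtain m where m: "b \<le> a + real m * p" ..
  from arch[of a b] obtain n where n: "a \<le> b + real n * p" ..
  show ?thesis
  proof (cases "a \<le> b")
    case True
    then show ?thesis using m by (rule far)
  next
    case False
    then have "b \<le> a" by simp
    from far[OF this n] show ?thesis by (rule sym)
  qed
qed

section \<open>Change of variables along an increasing bijection onto the line\<close>

lemma deriv_pos_less:
  fixes g g' :: "real \<Rightarrow> real"
  assumes D: "\<And>t. t \<in> {l<..<r} \<Longrightarrow> (g has_real_derivative g' t) (at t)"
    and pos: "\<And>t. t \<in> {l<..<r} \<Longrightarrow> g' t > 0"
    and x: "x \<in> {l<..<r}" "y \<in> {l<..<r}" "x < y"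
  shows "g x < g y"
proof (rule DERIV_pos_imp_increasing[OF x(3)])
  fix z assume "x \<le> z" "z \<le> y"
  with x have "z \<in> {l<..<r}" by auto
  then show "\<exists>d. (g has_real_derivative d) (at z) \<and> d > 0" using D pos by blast
qed

text \<open>Lebesgue measure is determined by its values on boxes; the preimage of a box is an
  interval, on which g' integrates to the length of the box by the fundamental theorem of
  calculus.\<close>

lemma lborel_eq_distr_bij:
  fixes g g' :: "real \<Rightarrow> real"
  assumes [measurable]: "g \<in> borel_measurable borel" "g' \<in> borel_measurable borel"
    and D: "\<And>t. t \<in> {l<..<r} \<Longrightarrow> (g has_real_derivative g' t) (at t)"
    and pos: "\<And>t. t \<in> {l<..<r} \<Longrightarrow> g' t > 0"
    and surj: "\<And>c. \<exists>t\<in>{l<..<r}. g t = c"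
  shows "lborel = distr (density lborel (\<lambda>t. ennreal (indicator {l<..<r} t * g' t))) borel g"
proof -
  have mono: "g x < g y" if "x \<in> {l<..<r}" "y \<in> {l<..<r}" "x < y" for x y
    using that D pos by (intro deriv_pos_less[of l r g g'])
  show ?thesis
  proof (rule lborel_eqI)
    fix c d :: real
    assume "\<And>b. b \<in> Basis \<Longrightarrow> c \<bullet> b \<le> d \<bullet> b"
    then have cd: "c \<le> d" by simp
    obtain x y where x: "x \<in> {l<..<r}" "g x = c" and y: "y \<in> {l<..<r}" "g y = d"
      using surj[of c] surj[of d] by blast
    have xy: "x \<le> y" using mono[OF y(1) x(1)] x(2) y(2) cd by linarith
    have mem: "c < g t \<and> g t < d \<longleftrightarrow> x < t \<and> t < y" if "t \<in> {l<..<r}" for t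
      using mono[OF x(1) that] mono[OF that y(1)] mono[OF that x(1)] mono[OF y(1) that] x(2) y(2)
      by (cases t x rule: linorder_cases; cases t y rule: linorder_cases) auto
    have [measurable]: "g -` {c<..<d} \<in> sets borel"
      using measurable_sets_borel[of g borel "{c<..<d}"] by simp
    have "emeasure (distr (density lborel (\<lambda>t. ennreal (indicator {l<..<r} t * g' t))) borel g) (box c d) =
        (\<integral>\<^sup>+t. ennreal (indicator {l<..<r} t * g' t) * indicator (g -` {c<..<d}) t \<partial>lborel)"
      by (subst emeasure_distr) (auto simp: emeasure_density)
    also have "\<dots> = (\<integral>\<^sup>+t. ennreal (g' t) * indicator {x..y} t \<partial>lborel)"
    proof (rule nn_integral_cong_AE)
      have "AE t in lborel. t \<notin> {x, y}"
        by (rule AE_not_in[OF finite_imp_null_set_lborel]) simp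
      then show "AE t in lborel. ennreal (indicator {l<..<r} t * g' t) * indicator (g -` {c<..<d}) t =
          ennreal (g' t) * indicator {x..y} t"
      proof eventually_elim
        case (elim t)
        show ?case
        proof (cases "t \<in> {l<..<r}")
          case True
          with mem[OF this] elim show ?thesis by (auto simp: indicator_def)
        next
          case False
          with x y elim show ?thesis by (auto simp: indicator_def)
        qed
      qed
    qed
    also have "\<dots> = ennreal (g y - g x)"
      using x y by (intro nn_integral_FTC_Icc[OF _ D _ xy] order_less_imp_le[OF pos]) auto
    finally show "emeasure (distr (density lborel (\<lambda>t. ennreal (indicator {l<..<r} t * g' t))) borel g) (box c d) =
        (\<Prod>b\<in>Basis. (d - c) \<bullet> b)"
      using x y by simp
  qed simp
qed

lemma integral_substitution_bij:
  fixes g g' :: "real \<Rightarrow> real" and Q :: "real \<Rightarrow> 'a :: {banach, second_countable_topology}"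
  assumes [measurable]: "g \<in> borel_measurable borel" "g' \<in> borel_measurable borel"
    and D: "\<And>t. t \<in> {l<..<r} \<Longrightarrow> (g has_real_derivative g' t) (at t)"
    and pos: "\<And>t. t \<in> {l<..<r} \<Longrightarrow> g' t > 0"
    and surj: "\<And>c. \<exists>t\<in>{l<..<r}. g t = c"
  shows "(LINT t:{l<..<r}|lborel. g' t *\<^sub>R Q (g t)) = (LINT a|lborel. Q a)"
proof -
  let ?w = "\<lambda>t. indicator {l<..<r} t * g' t"
  have nn: "0 \<le> ?w t" for t using pos[of t] by (auto simp: indicator_def)
  note L = lborel_eq_distr_bij[OF assms]
  have lhs: "(LINT t:{l<..<r}|lborel. g' t *\<^sub>R Q (g t)) = (LINT t|lborel. ?w t *\<^sub>R Q (g t))"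
    by (simp add: set_lebesgue_integral_def)
  show ?thesis
  proof (cases "Q \<in> borel_measurable borel")
    case True
    note [measurable] = this
    have "(\<lambda>t. Q (g t)) \<in> borel_measurable borel" by measurable
    note [simp] = this
    have "(LINT a|lborel. Q a) = (LINT a|distr (density lborel (\<lambda>t. ennreal (?w t))) borel g. Q a)"
      using L by simp
    also have "\<dots> = (LINT t|density lborel (\<lambda>t. ennreal (?w t)). Q (g t))"
      by (rule integral_distr) auto
    also have "\<dots> = (LINT t|lborel. ?w t *\<^sub>R Q (g t))"
      by (rule integral_density) (simp_all add: nn)
    finally show ?thesis using lhs by simp
  next
    case False
    have mono: "g x < g y" if "x \<in> {l<..<r}" "y \<in> {l<..<r}" "x < y" for x y
      using that D pos by (intro deriv_pos_less[of l r g g'])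
    \<comment> \<open>The inverse of \<open>g\<close> is monotone, hence Borel, and composing with
      it would recover a measurable \<open>Q\<close> from a measurable integrand. So the integrand
      is not measurable either, and both sides are 0.\<close>
    obtain \<gamma> where \<gamma>: "\<And>a. \<gamma> a \<in> {l<..<r}" "\<And>a. g (\<gamma> a) = a"
    proof -
      have "\<forall>c. \<exists>t. t \<in> {l<..<r} \<and> g t = c" using surj by blast
      from choice[OF this] show ?thesis using that by blast
    qed
    have "mono \<gamma>"
    proof (rule monoI)
      fix a b :: real assume "a \<le> b"
      then show "\<gamma> a \<le> \<gamma> b" using mono[OF \<gamma>(1)[of b] \<gamma>(1)[of a]] \<gamma>(2)[of a] \<gamma>(2)[of b] by linarith
    qed
    then have [measurable]: "\<gamma> \<in> borel_measurable borel" by (rule borel_measurable_mono)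
    have "(\<lambda>t. ?w t *\<^sub>R Q (g t)) \<notin> borel_measurable borel"
    proof
      assume h: "(\<lambda>t. ?w t *\<^sub>R Q (g t)) \<in> borel_measurable borel"
      have "(\<lambda>a. 1 / g' (\<gamma> a)) \<in> borel_measurable borel" by measurable
      from borel_measurable_scaleR[OF this measurable_compose[OF \<open>\<gamma> \<in> borel_measurable borel\<close> h]]
      have "(\<lambda>a. (1 / g' (\<gamma> a)) *\<^sub>R ((\<lambda>t. ?w t *\<^sub>R Q (g t)) (\<gamma> a))) \<in> borel_measurable borel"
        .
      also have "(\<lambda>a. (1 / g' (\<gamma> a)) *\<^sub>R ((\<lambda>t. ?w t *\<^sub>R Q (g t)) (\<gamma> a))) = Q"
        using \<gamma> pos[OF \<gamma>(1)] by (auto simp: fun_eq_iff less_imp_neq[symmetric])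
      finally show False using False by simp
    qed
    then have "\<not> integrable lborel (\<lambda>t. ?w t *\<^sub>R Q (g t))" "\<not> integrable lborel Q"
      using False borel_measurable_integrable[of lborel] by auto
    then show ?thesis unfolding lhs by (simp add: not_integrable_integral_eq)
  qed
qed

lemma integral_substitution_cot:
  fixes Q :: "real \<Rightarrow> complex"
  shows "(LINT t:{0<..<pi / 2}|lborel. (1 / (sin (2 * t))\<^sup>2) *\<^sub>R Q (- cot (2 * t) / 2)) = (LINT a|lborel. Q a)"
proof (rule integral_substitution_bij)
  show "(\<lambda>t::real. - cot (2 * t) / 2) \<in> borel_measurable borel"
    unfolding cot_def by measurable
  show "(\<lambda>t::real. 1 / (sin (2 * t))\<^sup>2) \<in> borel_measurable borel" by measurable
  fix t :: real assume t: "t \<in> {0<..<pi / 2}"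
  then have s: "sin (2 * t) > 0" by (intro sin_gt_zero) auto
  then show "1 / (sin (2 * t))\<^sup>2 > 0" by simp
  show "((\<lambda>t. - cot (2 * t) / 2) has_real_derivative 1 / (sin (2 * t))\<^sup>2) (at t)"
    using s by (auto intro!: derivative_eq_intros DERIV_chain2[OF DERIV_cot] simp: field_simps)
next
  fix a :: real
  have b: "- (pi / 2) < arctan (2 * a)" "arctan (2 * a) < pi / 2"
    using arctan_bounded[of "2 * a"] by auto
  show "\<exists>t\<in>{0<..<pi / 2}. - cot (2 * t) / 2 = a"
  \<comment> \<open>Solves - cot (2 t) = 2 a by means of cot (pi / 2 + v) = - tan v.\<close>
  proof (rule bexI[of _ "pi / 4 + arctan (2 * a) / 2"])
    have "2 * (pi / 4 + arctan (2 * a) / 2) = pi / 2 + arctan (2 * a)" by simp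
    then have "- cot (2 * (pi / 4 + arctan (2 * a) / 2)) = tan (arctan (2 * a))"
      by (simp add: cot_def tan_def sin_add cos_add)
    then show "- cot (2 * (pi / 4 + arctan (2 * a) / 2)) / 2 = a" by (simp add: tan_arctan)
  qed (use b in auto)
qed

subsection \<open>The sextilinear form\<close>

text \<open>A family indexed by naturals stands for the six arguments, so that a symmetry acts on
  all of them by one map.\<close>

definition prod6_integral :: "(nat \<Rightarrow> real \<Rightarrow> complex) \<Rightarrow> complex" where
  "prod6_integral F = (LINT x|lborel. F 0 x * F 1 x * F 2 x * cnj (F 3 x * F 4 x * F 5 x))"

lemma prod6_integral_cong_AE:
  assumes L: "\<And>k. F k \<in> L2" "\<And>k. F' k \<in> L2" and eq: "\<And>k. AE x in lborel. F k x = F' k x"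
  shows "prod6_integral F = prod6_integral F'"
  unfolding prod6_integral_def
proof (rule integral_cong_AE)
  note [measurable] = L2_measurable[OF L(1)] L2_measurable[OF L(2)]
    L2_measurable[OF L2_cnj[OF L(1)]] L2_measurable[OF L2_cnj[OF L(2)]]
  show "(\<lambda>x. F 0 x * F 1 x * F 2 x * cnj (F 3 x * F 4 x * F 5 x)) \<in> borel_measurable lborel"
    "(\<lambda>x. F' 0 x * F' 1 x * F' 2 x * cnj (F' 3 x * F' 4 x * F' 5 x)) \<in> borel_measurable lborel"
    unfolding complex_cnj_mult by measurable
  have "AE x in lborel. \<forall>k. F k x = F' k x"
    using eq by (simp add: AE_all_countable)
  then show "AE x in lborel. F 0 x * F 1 x * F 2 x * cnj (F 3 x * F 4 x * F 5 x) =
      F' 0 x * F' 1 x * F' 2 x * cnj (F' 3 x * F' 4 x * F' 5 x)"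
    by eventually_elim simp
qed

text \<open>Three factors face three conjugates: phases cancel and |u|^6 = r^3 survives. The phase
  of \<open>u\<close> may vary with x, which covers chirps as well as constants.\<close>

lemma prod6_integral_mult:
  assumes u: "\<And>x. (cmod (u x))\<^sup>2 = r"
  shows "prod6_integral (\<lambda>k x. u x * F k x) = of_real (r ^ 3) * prod6_integral F"
proof -
  have "u x * F 0 x * (u x * F 1 x) * (u x * F 2 x) * cnj (u x * F 3 x * (u x * F 4 x) * (u x * F 5 x)) =
      of_real (r ^ 3) * (F 0 x * F 1 x * F 2 x * cnj (F 3 x * F 4 x * F 5 x))" for x
  proof -
    have "complex_of_real r = u x * cnj (u x)"
      using u[of x] complex_norm_square[of "u x"] by simp
    then show ?thesis by (simp add: power3_eq_cube mult_ac)
  qed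
  then show ?thesis
    unfolding prod6_integral_def by (simp only: integral_mult_right_zero)
qed

lemma prod6_integral_affine:
  assumes c: "c \<noteq> 0"
  shows "prod6_integral (\<lambda>k x. F k (t + c * x)) = of_real (1 / \<bar>c\<bar>) * prod6_integral F"
proof -
  have "prod6_integral F = \<bar>c\<bar> *\<^sub>R prod6_integral (\<lambda>k x. F k (t + c * x))"
    unfolding prod6_integral_def by (rule lborel_integral_real_affine[OF c])
  then show ?thesis using c by (simp add: scaleR_conv_of_real)
qed

definition harmonic_prod6 :: "(nat \<Rightarrow> real \<Rightarrow> complex) \<Rightarrow> real \<Rightarrow> complex" where
  "harmonic_prod6 F t = prod6_integral (\<lambda>k. harmonic_schroedinger t (F k))"

definition E6_family :: "(nat \<Rightarrow> real \<Rightarrow> complex) \<Rightarrow> complex" where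
  "E6_family F = E6 (F 0) (F 1) (F 2) (F 3) (F 4) (F 5)"

lemma E6_family_eq:
  "E6_family F = of_real (2 / pi) * (LINT t:{- pi / 4..pi / 4}|lborel. harmonic_prod6 F t)"
  by (simp add: E6_family_def E6_def harmonic_prod6_def prod6_integral_def)

lemma E6_invariant_iff_family:
  "E6_invariant T \<longleftrightarrow> (\<forall>F. (\<forall>k. F k \<in> L2) \<longrightarrow> E6_family (\<lambda>k. T (F k)) = E6_family F)"
proof
  assume R: "\<forall>F. (\<forall>k. F k \<in> L2) \<longrightarrow> E6_family (\<lambda>k. T (F k)) = E6_family F"
  show "E6_invariant T"
    unfolding E6_invariant_def
  proof (intro ballI)
    fix f1 f2 f3 f4 f5 f6
    assume L: "f1 \<in> L2" "f2 \<in> L2" "f3 \<in> L2" "f4 \<in> L2" "f5 \<in> L2" "f6 \<in> L2"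
    define F :: "nat \<Rightarrow> real \<Rightarrow> complex" where
      "F k = (if k = 0 then f1 else if k = 1 then f2 else if k = 2 then f3 else if k = 3 then f4
        else if k = 4 then f5 else f6)" for k
    have "\<forall>k. F k \<in> L2" using L by (simp add: F_def)
    with R have "E6_family (\<lambda>k. T (F k)) = E6_family F" by blast
    then show "E6 (T f1) (T f2) (T f3) (T f4) (T f5) (T f6) = E6 f1 f2 f3 f4 f5 f6"
      by (simp add: E6_family_def F_def)
  qed
qed (simp add: E6_invariant_def E6_family_def)

lemma harmonic_schroedinger_cong:
  assumes f: "f \<in> L2" "g \<in> L2" and c: "\<And>n. cis (t * (2 * real n + 1)) * hermite_coeff f n =
      z * (cis (t' * (2 * real n + 1)) * hermite_coeff g n)"
  shows "AE x in lborel. harmonic_schroedinger t f x = z * harmonic_schroedinger t' g x"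
  by (rule L2_eqI)
     (simp_all add: harmonic_schroedinger_L2 L2_scale f hermite_coeff_scale hermite_coeff_harmonic_schroedinger c)

text \<open>A phase common to all six functions drops out of the product, so symmetries diagonal on
  Hermite functions matter only up to such a phase.\<close>

lemma harmonic_prod6_cong:
  assumes L: "\<And>k. F k \<in> L2" "\<And>k. F' k \<in> L2" and z: "cmod z = 1"
    and c: "\<And>k n. cis (t * (2 * real n + 1)) * hermite_coeff (F k) n =
      z * (cis (t' * (2 * real n + 1)) * hermite_coeff (F' k) n)"
  shows "harmonic_prod6 F t = harmonic_prod6 F' t'"
proof -
  have "harmonic_prod6 F t = prod6_integral (\<lambda>k x. z * harmonic_schroedinger t' (F' k) x)"
    unfolding harmonic_prod6_def
    by (intro prod6_integral_cong_AE harmonic_schroedinger_L2 L2_scale L harmonic_schroedinger_cong c)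
  also have "\<dots> = harmonic_prod6 F' t'"
    using prod6_integral_mult[of "\<lambda>_. z" 1] z by (simp add: harmonic_prod6_def)
  finally show ?thesis .
qed

text \<open>The propagator sees a function only through its Hermite coefficients, so the form
  depends only on L2 classes.\<close>

lemma E6_family_cong_AE:
  assumes L: "\<And>k. F k \<in> L2" "\<And>k. F' k \<in> L2" and eq: "\<And>k. AE x in lborel. F k x = F' k x"
  shows "E6_family F = E6_family F'"
proof -
  have "harmonic_prod6 F t = harmonic_prod6 F' t" for t
    by (rule harmonic_prod6_cong[where z=1]) (auto simp: L hermite_coeff_cong_AE[OF L eq])
  then show ?thesis by (simp add: E6_family_eq)
qed

subsection \<open>Periodicity in time\<close>

lemma hermite_fun_uminus: "hermite_fun n (- x) = (- 1) ^ n * hermite_fun n x"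
  by (simp add: hermite_fun_eq_hpsi hpsi_uminus)

text \<open>Since exp (i (2 n + 1) pi / 2) = i (- 1)^n, the propagator at time pi / 2 is i times the
  reflection of x, and the integral over x is unchanged by both.\<close>

lemma harmonic_prod6_periodic:
  assumes L: "\<And>k. F k \<in> L2"
  shows "harmonic_prod6 F (t + pi / 2) = harmonic_prod6 F t"
proof -
  have R: "(\<lambda>x. f (0 + - 1 * x)) \<in> L2" if "f \<in> L2" for f
    using that by (rule L2_real_affine) simp
  have c: "hermite_coeff (\<lambda>x. f (0 + - 1 * x)) n = (- 1) ^ n * hermite_coeff f n" for f n
  proof -
    have "hermite_coeff f n = \<bar>- 1\<bar> *\<^sub>R (LINT x|lborel. f (0 + - 1 * x) * of_real (hermite_fun n (0 + - 1 * x)))"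
      unfolding hermite_coeff_def by (rule lborel_integral_real_affine) simp
    also have "\<dots> = (LINT x|lborel. (- 1) ^ n * (f (0 + - 1 * x) * of_real (hermite_fun n x)))"
      by (simp add: hermite_fun_uminus mult_ac)
    also have "\<dots> = (- 1) ^ n * hermite_coeff (\<lambda>x. f (0 + - 1 * x)) n"
      unfolding hermite_coeff_def by (rule integral_mult_right_zero)
    finally have "hermite_coeff f n = (- 1) ^ n * hermite_coeff (\<lambda>x. f (0 + - 1 * x)) n" .
    then have "(- 1) ^ n * hermite_coeff f n = ((- 1) ^ n * (- 1) ^ n) * hermite_coeff (\<lambda>x. f (0 + - 1 * x)) n"
      by simp
    then show ?thesis by (simp flip: power_mult_distrib)
  qed
  have e: "cis ((t + pi / 2) * (2 * real n + 1)) = \<i> * ((- 1) ^ n * cis (t * (2 * real n + 1)))" for n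
  proof -
    have "(t + pi / 2) * (2 * real n + 1) = pi / 2 + (real n * pi + t * (2 * real n + 1))"
      by (simp add: algebra_simps)
    then have "cis ((t + pi / 2) * (2 * real n + 1)) = cis (pi / 2) * (cis (real n * pi) * cis (t * (2 * real n + 1)))"
      by (simp only: cis_mult)
    then show ?thesis by (simp flip: Complex.DeMoivre)
  qed
  have "harmonic_prod6 F (t + pi / 2) =
      prod6_integral (\<lambda>k x. \<i> * (\<lambda>x. harmonic_schroedinger t (F k) (0 + - 1 * x)) x)"
    unfolding harmonic_prod6_def
  proof (intro prod6_integral_cong_AE harmonic_schroedinger_L2 L2_scale R L)
    fix k
    show "AE x in lborel. harmonic_schroedinger (t + pi / 2) (F k) x =
        \<i> * harmonic_schroedinger t (F k) (0 + - 1 * x)"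
    proof (rule L2_eqI)
      fix n
      show "hermite_coeff (harmonic_schroedinger (t + pi / 2) (F k)) n =
          hermite_coeff (\<lambda>x. \<i> * harmonic_schroedinger t (F k) (0 + - 1 * x)) n"
        unfolding hermite_coeff_scale c hermite_coeff_harmonic_schroedinger[OF L] e by simp
    qed (intro harmonic_schroedinger_L2 L2_scale R L)+
  qed
  also have "\<dots> = prod6_integral (\<lambda>k x. harmonic_schroedinger t (F k) (0 + - 1 * x))"
    using prod6_integral_mult[of "\<lambda>_. \<i>" 1] by simp
  also have "\<dots> = harmonic_prod6 F t"
    unfolding harmonic_prod6_def by (subst prod6_integral_affine) auto
  finally show ?thesis .
qed

text \<open>The closed interval of the definition is a half-open period plus one endpoint; once that
  point is dropped, the period may start anywhere.\<close>

lemma E6_family_eq_period: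
  assumes L: "\<And>k. F k \<in> L2"
  shows "E6_family F = of_real (2 / pi) * (LINT t:{a..<a + pi / 2}|lborel. harmonic_prod6 F t)"
proof -
  have "(LINT t:{- pi / 4..pi / 4}|lborel. harmonic_prod6 F t) =
      (LINT t:{- pi / 4..<- pi / 4 + pi / 2}|lborel. harmonic_prod6 F t)"
    unfolding set_lebesgue_integral_def
    by (rule integral_cong_finite[of "{pi / 4}"]) (auto simp: indicator_def)
  also have "\<dots> = (LINT t:{a..<a + pi / 2}|lborel. harmonic_prod6 F t)"
    by (rule periodic_set_integral) (simp_all add: harmonic_prod6_periodic L)
  finally show ?thesis by (simp add: E6_family_eq)
qed

text \<open>A time shift moves the window of integration, and periodicity moves it back.\<close>

lemma E6_family_shift:
  assumes L: "\<And>k. F k \<in> L2" and eq: "\<And>t. harmonic_prod6 F' t = harmonic_prod6 F (c + t)"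
  shows "E6_family F' = E6_family F"
proof -
  let ?h = "\<lambda>s t. indicator {s - pi / 4..s + pi / 4} t *\<^sub>R harmonic_prod6 F t"
  have "(LINT t:{- pi / 4..pi / 4}|lborel. harmonic_prod6 F' t) = (LINT t|lborel. ?h c (c + 1 * t))"
    unfolding set_lebesgue_integral_def
    by (intro Bochner_Integration.integral_cong refl) (auto simp: indicator_def eq)
  also have "\<dots> = (LINT t|lborel. ?h c t)"
    using lborel_integral_real_affine[of 1 "?h c" c] by simp
  also have "\<dots> = (LINT t:{c - pi / 4..<c - pi / 4 + pi / 2}|lborel. harmonic_prod6 F t)"
    unfolding set_lebesgue_integral_def
    by (rule integral_cong_finite[of "{c + pi / 4}"]) (auto simp: indicator_def)
  finally show ?thesis
    by (simp only: E6_family_eq[of F'] E6_family_eq_period[OF L, where a="c - pi / 4"])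
qed

subsection \<open>The form in the free Schroedinger picture\<close>

text \<open>The free propagator at time r multiplies the Fourier side by exp (- i r y^2), so this is
  the six-fold product for the free evolution, at time - a, of the inverse Fourier transforms of the
  family.\<close>

definition chirp_prod6 :: "(nat \<Rightarrow> real \<Rightarrow> complex) \<Rightarrow> real \<Rightarrow> complex" where
  "chirp_prod6 F a = prod6_integral (\<lambda>k. inverse_fourier (\<lambda>y. cis (a * y\<^sup>2) * F k y))"

lemma harmonic_prod6_eq_chirp:
  assumes L: "\<And>k. F k \<in> L2" and t: "0 < t" "t < pi / 2"
  shows "harmonic_prod6 F t = (1 / (sin (2 * t))\<^sup>2) *\<^sub>R chirp_prod6 F (- cot (2 * t) / 2)"
proof -
  define s where "s = sin (2 * t)"
  define a where "a = - cot (2 * t) / 2"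
  have s: "s > 0" unfolding s_def using t by (intro sin_gt_zero) auto
  obtain \<kappa> where \<kappa>: "(cmod \<kappa>)\<^sup>2 = 1 / s"
    "\<And>f. f \<in> L2 \<Longrightarrow> AE x in lborel. harmonic_schroedinger t f x = \<kappa> * mehler a s f x"
    using harmonic_schroedinger_mehler[OF t] unfolding s_def a_def by blast
  let ?I = "\<lambda>k. inverse_fourier (\<lambda>y. cis (a * y\<^sup>2) * F k y)"
  have "harmonic_prod6 F t = prod6_integral (\<lambda>k x. \<kappa> * mehler a s (F k) x)"
    unfolding harmonic_prod6_def
    by (intro prod6_integral_cong_AE harmonic_schroedinger_L2 L2_scale mehler_L2 L s \<kappa>)
  \<comment> \<open>The constant and the outer chirp form one common factor of squared modulus 1 /
    s.\<close>
  also have "\<dots> = prod6_integral (\<lambda>k x. (\<kappa> * cis (a * x\<^sup>2)) * ?I k (0 + 1 / s * x))"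
    by (simp add: mehler_def mult.assoc)
  also have "\<dots> = of_real ((1 / s) ^ 3) * prod6_integral (\<lambda>k x. ?I k (0 + 1 / s * x))"
    by (rule prod6_integral_mult) (simp add: norm_mult \<kappa>)
  also have "\<dots> = of_real ((1 / s) ^ 3) * (of_real (1 / \<bar>1 / s\<bar>) * prod6_integral ?I)"
    using s by (subst prod6_integral_affine) auto
  also have "\<dots> = (1 / s\<^sup>2) *\<^sub>R chirp_prod6 F a"
    using s by (simp add: chirp_prod6_def scaleR_conv_of_real power3_eq_cube power2_eq_square field_simps)
  finally show ?thesis unfolding s_def a_def .
qed

theorem E6_family_eq_chirp:
  assumes L: "\<And>k. F k \<in> L2"
  shows "E6_family F = of_real (2 / pi) * (LINT a|lborel. chirp_prod6 F a)"
proof -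
  \<comment> \<open>The period starting at 0 is chosen because - cot (2 t) / 2 increases over the
    whole line on its interior; the endpoint 0 is discarded.\<close>
  have "(LINT t:{0..<0 + pi / 2}|lborel. harmonic_prod6 F t) =
      (LINT t:{0<..<pi / 2}|lborel. (1 / (sin (2 * t))\<^sup>2) *\<^sub>R chirp_prod6 F (- cot (2 * t) / 2))"
    unfolding set_lebesgue_integral_def
    by (rule integral_cong_finite[of "{0}"]) (auto simp: indicator_def harmonic_prod6_eq_chirp L)
  then show ?thesis
    by (simp only: E6_family_eq_period[OF L, where a=0] integral_substitution_cot)
qed

subsection \<open>Invariance\<close>

text \<open>For c = 1 and c = - 1 the left side is the eigenvalue i^n or (- i)^n of the inverse or
  forward Fourier transform, here matched with the harmonic propagator at time c pi / 4 up to a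
  constant phase.\<close>

lemma cis_quarter: "cis (c * (pi / 2)) ^ n = cis (- c * (pi / 4)) * cis (c * (pi / 4) * (2 * real n + 1))"
proof -
  have "real n * (c * (pi / 2)) = - c * (pi / 4) + c * (pi / 4) * (2 * real n + 1)"
    by (simp add: field_simps)
  then show ?thesis unfolding Complex.DeMoivre cis_mult by (rule arg_cong[of _ _ cis])
qed

lemma E6_family_fourier:
  assumes L: "\<And>k. F k \<in> L2"
  shows "E6_family (\<lambda>k. fourier (F k)) = E6_family F"
proof (rule E6_family_shift[OF L])
  fix t
  have "cis (- 1 * (pi / 2)) = - \<i>" by (simp add: complex_eq_iff)
  then have "(- \<i>) ^ n = cis (pi / 4) * cis (- (pi / 4) * (2 * real n + 1))" for n
    using cis_quarter[of "-1" n] by simp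
  then have "cis (t * (2 * real n + 1)) * hermite_coeff (fourier (F k)) n =
      cis (pi / 4) * (cis ((- (pi / 4) + t) * (2 * real n + 1)) * hermite_coeff (F k) n)" for k n
    unfolding hermite_coeff_fourier[OF L] distrib_right[of "- (pi / 4)"] cis_mult[symmetric] by (simp only: mult_ac)
  then show "harmonic_prod6 (\<lambda>k. fourier (F k)) t = harmonic_prod6 F (- (pi / 4) + t)"
    by (intro harmonic_prod6_cong[where z="cis (pi / 4)"] fourier_L2 L) auto
qed

lemma E6_family_inverse_fourier:
  assumes L: "\<And>k. F k \<in> L2"
  shows "E6_family (\<lambda>k. inverse_fourier (F k)) = E6_family F"
proof (rule E6_family_shift[OF L])
  fix t
  have "\<i> ^ n = cis (- (pi / 4)) * cis (pi / 4 * (2 * real n + 1))" for n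
    using cis_quarter[of 1 n] by simp
  then have "cis (t * (2 * real n + 1)) * hermite_coeff (inverse_fourier (F k)) n =
      cis (- (pi / 4)) * (cis ((pi / 4 + t) * (2 * real n + 1)) * hermite_coeff (F k) n)" for k n
    unfolding hermite_coeff_inverse_fourier[OF L] distrib_right[of "pi / 4"] cis_mult[symmetric] by (simp only: mult_ac)
  then show "harmonic_prod6 (\<lambda>k. inverse_fourier (F k)) t = harmonic_prod6 F (pi / 4 + t)"
    by (intro harmonic_prod6_cong[where z="cis (- (pi / 4))"] inverse_fourier_L2 L) auto
qed

lemma E6_family_harmonic:
  assumes L: "\<And>k. F k \<in> L2"
  shows "E6_family (\<lambda>k. harmonic_schroedinger c (F k)) = E6_family F"
proof (rule E6_family_shift[OF L])
  fix t
  show "harmonic_prod6 (\<lambda>k. harmonic_schroedinger c (F k)) t = harmonic_prod6 F (c + t)"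
    by (intro harmonic_prod6_cong[where z=1])
       (simp_all add: harmonic_schroedinger_L2 L hermite_coeff_harmonic_schroedinger distrib_right cis_mult[symmetric] mult_ac)
qed

lemma E6_family_const_modulation:
  assumes L: "\<And>k. F k \<in> L2"
  shows "E6_family (\<lambda>k x. cis c * F k x) = E6_family F"
proof -
  have "harmonic_prod6 (\<lambda>k x. cis c * F k x) t = harmonic_prod6 F t" for t
    by (rule harmonic_prod6_cong[where z="cis c"]) (simp_all add: L L2_scale hermite_coeff_scale)
  then show ?thesis by (simp add: E6_family_eq)
qed

lemma E6_family_quadratic_modulation:
  assumes L: "\<And>k. F k \<in> L2"
  shows "E6_family (\<lambda>k x. cis (c * x\<^sup>2) * F k x) = E6_family F"
proof -
  have "cis (a * y\<^sup>2) * (cis (c * y\<^sup>2) * z) = cis ((c + 1 * a) * y\<^sup>2) * z" for a y z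
    by (simp add: distrib_right mult.assoc[symmetric] cis_mult add.commute)
  then have "chirp_prod6 (\<lambda>k x. cis (c * x\<^sup>2) * F k x) a = chirp_prod6 F (c + 1 * a)" for a
    by (simp only: chirp_prod6_def)
  then have "(LINT a|lborel. chirp_prod6 (\<lambda>k x. cis (c * x\<^sup>2) * F k x) a) = (LINT a|lborel. chirp_prod6 F a)"
    using lborel_integral_real_affine[of 1 "chirp_prod6 F" c] by simp
  then show ?thesis by (simp only: E6_family_eq_chirp L L2_chirp)
qed

text \<open>Power counting: six factors c^(-1/2) give c^(-3), the dilation of x returns c, and the
  remaining c^(-2) is the Jacobian of the dilation of a.\<close>

lemma E6_family_scale:
  assumes L: "\<And>k. F k \<in> L2" and c: "c > 0"
  shows "E6_family (\<lambda>k x. of_real (sqrt c) * F k (c * x)) = E6_family F"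
proof -
  have Lc: "(\<lambda>x. of_real (sqrt c) * F k (c * x)) \<in> L2" for k
    using L2_real_affine[OF L[of k], of c 0] c by (intro L2_scale) simp
  let ?I = "\<lambda>a k. inverse_fourier (\<lambda>y. cis (a / c\<^sup>2 * y\<^sup>2) * F k y)"
  have I: "?I a k \<in> L2" for a k by (intro inverse_fourier_L2 L2_chirp L)
  have "chirp_prod6 (\<lambda>k x. of_real (sqrt c) * F k (c * x)) a = of_real (1 / c\<^sup>2) * chirp_prod6 F (a / c\<^sup>2)" for a
  proof -
    \<comment> \<open>Pulling the dilation of the argument out of the chirp changes its parameter
      from a to a / c^2.\<close>
    have e: "cis (a * y\<^sup>2) * (of_real (sqrt c) * F k (c * y)) =
        of_real (sqrt c) * (\<lambda>y. cis (a / c\<^sup>2 * y\<^sup>2) * F k y) (c * y)" for k y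
      using c by (simp add: power_mult_distrib)
    have "chirp_prod6 (\<lambda>k x. of_real (sqrt c) * F k (c * x)) a =
        prod6_integral (\<lambda>k x. of_real (1 / sqrt c) * ?I a k (0 + 1 / c * x))"
      unfolding chirp_prod6_def
    proof (rule prod6_integral_cong_AE)
      fix k
      show "inverse_fourier (\<lambda>y. cis (a * y\<^sup>2) * (of_real (sqrt c) * F k (c * y))) \<in> L2"
        by (intro inverse_fourier_L2 L2_chirp Lc)
      show "(\<lambda>x. of_real (1 / sqrt c) * ?I a k (0 + 1 / c * x)) \<in> L2"
        using c by (intro L2_scale L2_real_affine I) simp
      show "AE x in lborel. inverse_fourier (\<lambda>y. cis (a * y\<^sup>2) * (of_real (sqrt c) * F k (c * y))) x =
          of_real (1 / sqrt c) * ?I a k (0 + 1 / c * x)"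
        unfolding e using inverse_fourier_scale[OF L2_chirp[OF L[of k], of "a / c\<^sup>2"] c] by simp
    qed
    also have "\<dots> = of_real ((1 / c) ^ 3) * prod6_integral (\<lambda>k x. ?I a k (0 + 1 / c * x))"
      by (rule prod6_integral_mult) (use c in \<open>simp add: norm_divide power_divide\<close>)
    also have "\<dots> = of_real ((1 / c) ^ 3) * (of_real (1 / \<bar>1 / c\<bar>) * prod6_integral (?I a))"
      using c by (subst prod6_integral_affine) auto
    also have "\<dots> = of_real (1 / c\<^sup>2) * chirp_prod6 F (a / c\<^sup>2)"
      using c by (simp add: chirp_prod6_def power3_eq_cube power2_eq_square field_simps)
    finally show ?thesis .
  qed
  then have "(LINT a|lborel. chirp_prod6 (\<lambda>k x. of_real (sqrt c) * F k (c * x)) a) =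
      of_real (1 / c\<^sup>2) * (LINT a|lborel. chirp_prod6 F (0 + 1 / c\<^sup>2 * a))"
    by simp
  also have "\<dots> = (LINT a|lborel. chirp_prod6 F a)"
    using c by (subst lborel_integral_real_affine[of "1 / c\<^sup>2" "chirp_prod6 F" 0]) (simp_all add: scaleR_conv_of_real)
  finally show ?thesis by (simp only: E6_family_eq_chirp L Lc)
qed

lemma L2_linear_modulation: "f \<in> L2 \<Longrightarrow> (\<lambda>x. cis (c * x) * f x) \<in> L2"
  by (rule L2_cis) measurable

lemma E6_family_linear_modulation:
  assumes L: "\<And>k. F k \<in> L2"
  shows "E6_family (\<lambda>k x. cis (c * x) * F k x) = E6_family F"
proof -
  have "chirp_prod6 (\<lambda>k x. cis (c * x) * F k x) a = chirp_prod6 F a" for a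
  proof -
    let ?I = "\<lambda>k. inverse_fourier (\<lambda>y. cis (a * y\<^sup>2) * F k y)"
    have I: "?I k \<in> L2" for k by (intro inverse_fourier_L2 L2_chirp L)
    have "chirp_prod6 (\<lambda>k x. cis (c * x) * F k x) a = prod6_integral (\<lambda>k x. ?I k (c + 1 * x))"
      unfolding chirp_prod6_def
    proof (rule prod6_integral_cong_AE)
      fix k
      show "inverse_fourier (\<lambda>y. cis (a * y\<^sup>2) * (cis (c * y) * F k y)) \<in> L2"
        by (intro inverse_fourier_L2 L2_chirp L2_linear_modulation L)
      show "(\<lambda>x. ?I k (c + 1 * x)) \<in> L2" by (rule L2_real_affine[OF I]) simp
      show "AE x in lborel. inverse_fourier (\<lambda>y. cis (a * y\<^sup>2) * (cis (c * y) * F k y)) x = ?I k (c + 1 * x)"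
        using inverse_fourier_modulate[OF L2_chirp[OF L[of k], of a], of c] by (simp add: mult.left_commute add.commute)
    qed
    also have "\<dots> = chirp_prod6 F a"
      unfolding chirp_prod6_def by (subst prod6_integral_affine) auto
    finally show ?thesis .
  qed
  then show ?thesis by (simp only: E6_family_eq_chirp L L2_linear_modulation)
qed

lemma inverse_fourier_fourier:
  assumes f: "f \<in> L2"
  shows "AE x in lborel. inverse_fourier (fourier f) x = f x"
proof (rule L2_eqI)
  fix n
  have "\<i> ^ n * (- \<i>) ^ n = 1" by (simp flip: power_mult_distrib)
  then show "hermite_coeff (inverse_fourier (fourier f)) n = hermite_coeff f n"
    by (simp add: hermite_coeff_inverse_fourier fourier_L2 f hermite_coeff_fourier flip: mult.assoc)
qed (intro inverse_fourier_L2 fourier_L2 f)+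

text \<open>The L2 norm of the difference is translation invariant, so it vanishes for the
  translates as well.\<close>

lemma AE_eq_translate:
  assumes f: "f \<in> L2" and g: "g \<in> L2" and eq: "AE x in lborel. f x = g x"
  shows "AE x in lborel. f (x + c) = g (x + c)"
proof -
  have d: "(\<lambda>x. f x - g x) \<in> L2" by (rule L2_diff[OF f g])
  note [measurable] = L2_measurable[OF d]
  have "L2_sq (\<lambda>x. f x - g x) = (LINT x::real|lborel. 0)"
    by (rule integral_cong_AE) (use eq in auto)
  moreover have "L2_sq (\<lambda>x. f x - g x) = L2_sq (\<lambda>x. f (c + 1 * x) - g (c + 1 * x))"
    using lborel_integral_real_affine[of 1 "\<lambda>x. (cmod (f x - g x))\<^sup>2" c] by simp
  ultimately have "L2_sq (\<lambda>x. f (c + 1 * x) - g (c + 1 * x)) = 0" by simp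
  from L2_sq_eq_0_AE[OF L2_real_affine[OF d, of 1 c, simplified] this[simplified]]
  show ?thesis by (simp add: add.commute)
qed

lemma E6_family_translation:
  assumes L: "\<And>k. F k \<in> L2"
  shows "E6_family (\<lambda>k x. F k (x + c)) = E6_family F"
proof -
  have Lc: "(\<lambda>x. F k (x + c)) \<in> L2" for k
    using L2_real_affine[OF L[of k], of 1 c] by (simp add: add.commute)
  have "E6_family (\<lambda>k x. F k (x + c)) = E6_family (\<lambda>k. inverse_fourier (\<lambda>x. cis (c * x) * fourier (F k) x))"
  proof (rule E6_family_cong_AE[OF Lc])
    fix k
    show "inverse_fourier (\<lambda>x. cis (c * x) * fourier (F k) x) \<in> L2"
      by (intro inverse_fourier_L2 L2_linear_modulation fourier_L2 L)
    have "AE x in lborel. inverse_fourier (fourier (F k)) (x + c) = F k (x + c)"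
      by (intro AE_eq_translate inverse_fourier_fourier inverse_fourier_L2 fourier_L2 L)
    with inverse_fourier_modulate[OF fourier_L2[OF L[of k]], of c]
    show "AE x in lborel. F k (x + c) = inverse_fourier (\<lambda>x. cis (c * x) * fourier (F k) x) x"
      by eventually_elim simp
  qed
  also have "\<dots> = E6_family F"
    by (simp only: E6_family_inverse_fourier E6_family_linear_modulation E6_family_fourier L2_linear_modulation fourier_L2 L)
  finally show ?thesis .
qed

lemma E6_family_free_schroedinger:
  assumes L: "\<And>k. F k \<in> L2"
  shows "E6_family (\<lambda>k. free_schroedinger c (F k)) = E6_family F"
proof -
  have "E6_family (\<lambda>k. free_schroedinger c (F k)) =
      E6_family (\<lambda>k. inverse_fourier (\<lambda>y. cis ((- c) * y\<^sup>2) * fourier (F k) y))"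
    by (simp add: free_schroedinger_def)
  also have "\<dots> = E6_family F"
    by (simp only: E6_family_inverse_fourier E6_family_quadratic_modulation E6_family_fourier L2_chirp fourier_L2 L)
  finally show ?thesis .
qed

theorem theorem3p8:
  "E6_invariant fourier \<and>
   (\<forall>a::real. E6_invariant (\<lambda>f x. cis a * f x)) \<and>
   (\<forall>a::real. a > 0 \<longrightarrow> E6_invariant (\<lambda>f x. of_real (sqrt a) * f (a * x))) \<and>
   (\<forall>a::real. E6_invariant (\<lambda>f x. cis (a * x) * f x)) \<and>
   (\<forall>a::real. E6_invariant (\<lambda>f x. f (x + a))) \<and>
   (\<forall>a::real. E6_invariant (\<lambda>f x. cis (a * x\<^sup>2) * f x)) \<and>
   (\<forall>a::real. E6_invariant (free_schroedinger a)) \<and>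
   (\<forall>a::real. E6_invariant (harmonic_schroedinger a))"
  unfolding E6_invariant_iff_family
  by (auto intro: E6_family_fourier E6_family_const_modulation E6_family_scale
      E6_family_linear_modulation E6_family_translation E6_family_quadratic_modulation
      E6_family_free_schroedinger E6_family_harmonic)

end
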